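(* Suppose that $R$ is an $F$-finite ring and that $(R,\Delta,\mathfrak a_\bullet)$ is a triple. Fix an ideal $I\subseteq R$. The following are equivalent: (a) $I$ is uniformly $(\Delta,\mathfrak a_\bullet,F)$-compatible. (b) For every $e>0$, every $a\in\mathfrak a_{p^e-1}$ and every $f\in I$, the composition $$\operatorname{Hom}_R(F^e_*R(\lceil (p^e-1)\Delta\rceil),R)\to\operatorname{Hom}_R(F^e_*R,R)\xrightarrow{F^e_*(\times af)}\operatorname{Hom}_R(F^e_*R,R)\to\operatorname{Hom}_R(R,R)=R\to R/I$$ is zero, where the first three maps are obtained by applying $\operatorname{Hom}_R(-,R)$ to $R\to F^e_*R\xrightarrow{F^e_*(\times af)}F^e_*R\to F^e_*R(\lceil (p^e-1)\Delta\rceil)$ (the first map being the $e$-iterated Frobenius and the last the inclusion). If, in addition, $R$ is a local ring with maximal ideal $\mathfrak m$ and $E_R$ denotes the injective hull of $R/\mathfrak m$, then (a) and (b) are also equivalent to: (c) For every $e>0$, every $a\in\mathfrak a_{p^e-1}$ and every $f\in I$, the composition $$E_{R/I}\to E_R\to E_R\otimes_RF^e_*R\xrightarrow{F^e_*(\times af)}E_R\otimes_RF^e_*R\to E_R\otimes_RF^e_*R(\lceil (p^e-1)\Delta\rceil)$$ is zero.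
   Context: All rings are commutative, noetherian, excellent, of prime characteristic $p>0$ and $F$-finite (finite as modules over themselves via Frobenius). $F^e_*M$ denotes $M$ viewed as an $R$-module via the $e$-iterated Frobenius; $F^e_*(\times x)$ is multiplication by $x$ on $F^e_*R$. $R^\circ$ is the set of elements of $R$ in no minimal prime. A graded system of ideals $\mathfrak a_\bullet=\{\mathfrak a_i\}_{i\ge 0}$ satisfies $\mathfrak a_i\mathfrak a_j\subseteq\mathfrak a_{i+j}$. A triple $(R,\Delta,\mathfrak a_\bullet)$ consists of a reduced ring $R$, an effective $\mathbb R$-(Weil) divisor $\Delta$ on $\operatorname{Spec}R$, and a graded system of ideals of $R$ such that: $R$ is a normal domain if $\Delta\ne0$; $\mathfrak a_0=R$; $\mathfrak a_i\cap R^\circ\neq\emptyset$ for all $i$. $R(D)$ denotes the global sections of $\mathcal O_{\operatorname{Spec}R}(D)$ (and $R(0)=R$). An ideal $I\subseteq R$ is uniformly $(\Delta,\mathfrak a_\bullet,F)$-compatible if for every $e>0$, every $a\in\mathfrak a_{p^e-1}$ and every $R$-linear map $\phi:F^e_*R(\lceil (p^e-1)\Delta\rceil)\to R$ one has $\phi(F^e_*(aI))\subseteq I$ (where $F^e_*(aI)\subseteq F^e_*R\subseteq F^e_*R(\lceil (p^e-1)\Delta\rceil)$). $E_{R/I}=\operatorname{Ann}_{E_R}(I)\subseteq E_R$ is the injective hull of the residue field over $R/I$; the map $E_R\to E_R\otimes_RF^e_*R$ is $z\mapsto z\otimes1$. *)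

theory Defs
  imports
    "HOL-Algebra.Ring_Divisibility"
    "HOL-Algebra.Ideal_Product"
    "HOL-Algebra.Free_Abelian_Groups"
    "HOL-Computational_Algebra.Primes"
begin

section \<open>Modules\<close>

definition Hom_mod ::
    "('a, 'b) ring_scheme \<Rightarrow> ('a, 'm, 'c) module_scheme \<Rightarrow> ('a, 'n, 'd) module_scheme \<Rightarrow> ('m \<Rightarrow> 'n) set"
  where "Hom_mod R M N =
    {\<phi> \<in> carrier M \<rightarrow>\<^sub>E carrier N.
       (\<forall>x\<in>carrier M. \<forall>y\<in>carrier M. \<phi> (x \<oplus>\<^bsub>M\<^esub> y) = \<phi> x \<oplus>\<^bsub>N\<^esub> \<phi> y) \<and>
       (\<forall>r\<in>carrier R. \<forall>x\<in>carrier M. \<phi> (r \<odot>\<^bsub>M\<^esub> x) = r \<odot>\<^bsub>N\<^esub> \<phi> x)}"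

text \<open>\<open>Hom_pre M g\<close> is the result of applying \<open>Hom(-, P)\<close> to a map \<open>g\<close> with source \<open>M\<close>.\<close>

definition Hom_pre :: "('a, 'm, 'c) module_scheme \<Rightarrow> ('m \<Rightarrow> 'n) \<Rightarrow> ('n \<Rightarrow> 'q) \<Rightarrow> ('m \<Rightarrow> 'q)"
  where "Hom_pre M g = (\<lambda>\<phi>. compose (carrier M) \<phi> g)"

text \<open>A ring \<open>S\<close> as a module along a ring homomorphism \<open>f\<close> into \<open>S\<close>.\<close>

definition ring_module :: "('a \<Rightarrow> 's) \<Rightarrow> ('s, 'b) ring_scheme \<Rightarrow> ('a, 's) module"
  where "ring_module f S =
    \<lparr>carrier = carrier S, monoid.mult = (\<otimes>\<^bsub>S\<^esub>), one = \<one>\<^bsub>S\<^esub>, ring.zero = \<zero>\<^bsub>S\<^esub>, add = (\<oplus>\<^bsub>S\<^esub>),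
     smult = (\<lambda>r x. f r \<otimes>\<^bsub>S\<^esub> x)\<rparr>"

abbreviation self_module :: "('a, 'b) ring_scheme \<Rightarrow> ('a, 'a) module"
  where "self_module R \<equiv> ring_module (\<lambda>r. r) R"

definition quot_module :: "('a, 'b) ring_scheme \<Rightarrow> 'a set \<Rightarrow> ('a, 'a set) module"
  where "quot_module R I = ring_module (\<lambda>r. I +>\<^bsub>R\<^esub> r) (R Quot I)"

definition fin_gen_module :: "('a, 'b) ring_scheme \<Rightarrow> ('a, 'm, 'c) module_scheme \<Rightarrow> bool"
  where "fin_gen_module R M \<longleftrightarrow>
    (\<exists>S \<subseteq> carrier M. finite S \<and>
       (\<forall>x\<in>carrier M. \<exists>c\<in>S \<rightarrow> carrier R. x = (\<Oplus>\<^bsub>M\<^esub>s\<in>S. c s \<odot>\<^bsub>M\<^esub> s)))"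

definition Ann_in :: "('a, 'm, 'c) module_scheme \<Rightarrow> 'a set \<Rightarrow> 'm set"
  where "Ann_in M I = {z \<in> carrier M. \<forall>r\<in>I. r \<odot>\<^bsub>M\<^esub> z = \<zero>\<^bsub>M\<^esub>}"


subsection \<open>Injective hulls\<close>

text \<open>
  HOL cannot quantify over all types of test modules inside a definition, so the type \<open>'t\<close> of
  their elements is a parameter. In \<open>injective_hull\<close> it is the type of elements of the ring:
  all ideals are then among the test modules, so by Baer's criterion nothing is lost
  (see \<open>injective_module_any_type\<close> below).
\<close>

definition injective_module ::
    "'t itself \<Rightarrow> ('a, 'b) ring_scheme \<Rightarrow> ('a, 'm, 'c) module_scheme \<Rightarrow> bool"
  where "injective_module _ R E \<longleftrightarrow> module R E \<and>
    (\<forall>(A :: ('a, 't) module) (B :: ('a, 't) module) i f.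
       module R A \<and> module R B \<and>
       i \<in> Hom_mod R A B \<and> inj_on i (carrier A) \<and> f \<in> Hom_mod R A E \<longrightarrow>
       (\<exists>g \<in> Hom_mod R B E. \<forall>x\<in>carrier A. g (i x) = f x))"

definition essential_mono ::
    "('a, 'b) ring_scheme \<Rightarrow> ('a, 'n, 'd) module_scheme \<Rightarrow> ('a, 'm, 'c) module_scheme \<Rightarrow> ('n \<Rightarrow> 'm) \<Rightarrow> bool"
  where "essential_mono R N E j \<longleftrightarrow>
    j \<in> Hom_mod R N E \<and> inj_on j (carrier N) \<and>
    (\<forall>H. submodule H R E \<and> H \<noteq> {\<zero>\<^bsub>E\<^esub>} \<longrightarrow> H \<inter> j ` carrier N \<noteq> {\<zero>\<^bsub>E\<^esub>})"

definition injective_hull ::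
    "('a, 'b) ring_scheme \<Rightarrow> ('a, 'n, 'd) module_scheme \<Rightarrow> ('a, 'm, 'c) module_scheme \<Rightarrow> bool"
  where "injective_hull R N E \<longleftrightarrow>
    injective_module TYPE('a) R E \<and> (\<exists>j. essential_mono R N E j)"


subsection \<open>Tensor products\<close>

definition tensor_rel ::
    "('a, 'b) ring_scheme \<Rightarrow> ('a, 'm, 'c) module_scheme \<Rightarrow> ('a, 'n, 'd) module_scheme \<Rightarrow> ('m \<times> 'n \<Rightarrow>\<^sub>0 int) set"
  where "tensor_rel R M N = generate (free_Abelian_group (carrier M \<times> carrier N))
    ({frag_of (x \<oplus>\<^bsub>M\<^esub> x', y) - frag_of (x, y) - frag_of (x', y) | x x' y.
        x \<in> carrier M \<and> x' \<in> carrier M \<and> y \<in> carrier N} \<union>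
     {frag_of (x, y \<oplus>\<^bsub>N\<^esub> y') - frag_of (x, y) - frag_of (x, y') | x y y'.
        x \<in> carrier M \<and> y \<in> carrier N \<and> y' \<in> carrier N} \<union>
     {frag_of (r \<odot>\<^bsub>M\<^esub> x, y) - frag_of (x, r \<odot>\<^bsub>N\<^esub> y) | r x y.
        r \<in> carrier R \<and> x \<in> carrier M \<and> y \<in> carrier N})"

definition tensor_coset ::
    "('a, 'b) ring_scheme \<Rightarrow> ('a, 'm, 'c) module_scheme \<Rightarrow> ('a, 'n, 'd) module_scheme \<Rightarrow>
     ('m \<times> 'n \<Rightarrow>\<^sub>0 int) \<Rightarrow> ('m \<times> 'n \<Rightarrow>\<^sub>0 int) set"
  where "tensor_coset R M N c = tensor_rel R M N #>\<^bsub>free_Abelian_group (carrier M \<times> carrier N)\<^esub> c"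

definition pure_tensor ::
    "('a, 'b) ring_scheme \<Rightarrow> ('a, 'm, 'c) module_scheme \<Rightarrow> ('a, 'n, 'd) module_scheme \<Rightarrow>
     'm \<Rightarrow> 'n \<Rightarrow> ('m \<times> 'n \<Rightarrow>\<^sub>0 int) set"
  where "pure_tensor R M N x y = tensor_coset R M N (frag_of (x, y))"

text \<open>The homomorphism \<open>f \<otimes> g : M \<otimes> N \<rightarrow> M' \<otimes> N'\<close>; the union is over representatives of a coset.\<close>

definition tensor_map ::
    "('a, 'b) ring_scheme \<Rightarrow> ('a, 'm', 'c') module_scheme \<Rightarrow> ('a, 'n', 'd') module_scheme \<Rightarrow>
     ('m \<Rightarrow> 'm') \<Rightarrow> ('n \<Rightarrow> 'n') \<Rightarrow> ('m \<times> 'n \<Rightarrow>\<^sub>0 int) set \<Rightarrow> ('m' \<times> 'n' \<Rightarrow>\<^sub>0 int) set"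
  where "tensor_map R M' N' f g X =
    (\<Union>c\<in>X. tensor_coset R M' N' (frag_extend (\<lambda>(x, y). frag_of (f x, g y)) c))"

text \<open>The fields \<open>mult\<close> and \<open>one\<close> of a module record carry no meaning.\<close>

definition tensor ::
    "('a, 'b) ring_scheme \<Rightarrow> ('a, 'm, 'c) module_scheme \<Rightarrow> ('a, 'n, 'd) module_scheme \<Rightarrow>
     ('a, ('m \<times> 'n \<Rightarrow>\<^sub>0 int) set) module"
  where "tensor R M N =
    (let Q = free_Abelian_group (carrier M \<times> carrier N) Mod tensor_rel R M N
     in \<lparr>carrier = carrier Q, monoid.mult = undefined, one = undefined,
         ring.zero = \<one>\<^bsub>Q\<^esub>, add = (\<otimes>\<^bsub>Q\<^esub>),
         smult = (\<lambda>r. tensor_map R M N (\<lambda>x. r \<odot>\<^bsub>M\<^esub> x) (\<lambda>y. y))\<rparr>)"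


section \<open>Rings\<close>

definition reduced_ring :: "('a, 'b) ring_scheme \<Rightarrow> bool"
  where "reduced_ring R \<longleftrightarrow>
    (\<forall>x\<in>carrier R. \<forall>n::nat. x [^]\<^bsub>R\<^esub> n = \<zero>\<^bsub>R\<^esub> \<longrightarrow> x = \<zero>\<^bsub>R\<^esub>)"

definition has_ring_char :: "('a, 'b) ring_scheme \<Rightarrow> nat \<Rightarrow> bool"
  where "has_ring_char R p \<longleftrightarrow> (\<forall>n::nat. add_pow R n \<one>\<^bsub>R\<^esub> = \<zero>\<^bsub>R\<^esub> \<longleftrightarrow> p dvd n)"

definition local_ring :: "('a, 'b) ring_scheme \<Rightarrow> 'a set \<Rightarrow> bool"
  where "local_ring R \<mm> \<longleftrightarrow> maximalideal \<mm> R \<and> (\<forall>\<nn>. maximalideal \<nn> R \<longrightarrow> \<nn> = \<mm>)"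

definition minimal_primes :: "('a, 'b) ring_scheme \<Rightarrow> 'a set set"
  where "minimal_primes R = {P. primeideal P R \<and> (\<forall>Q. primeideal Q R \<and> Q \<subseteq> P \<longrightarrow> Q = P)}"

definition ring_circ :: "('a, 'b) ring_scheme \<Rightarrow> 'a set"
  where "ring_circ R = carrier R - \<Union>(minimal_primes R)"

definition height_one_primes :: "('a, 'b) ring_scheme \<Rightarrow> 'a set set"
  where "height_one_primes R = {P. primeideal P R \<and>
    (\<exists>Q. primeideal Q R \<and> Q \<subset> P) \<and>
    \<not> (\<exists>Q Q'. primeideal Q R \<and> primeideal Q' R \<and> Q' \<subset> Q \<and> Q \<subset> P)}"


subsection \<open>The Frobenius\<close>

text \<open>\<open>F\<^sup>e\<^sub>*M\<close> has the same underlying set as \<open>M\<close>, so \<open>F\<^sup>e\<^sub>*\<close> of a map is the map itself.\<close>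

definition Frob_push ::
    "('a, 'b) ring_scheme \<Rightarrow> nat \<Rightarrow> nat \<Rightarrow> ('a, 'm, 'c) module_scheme \<Rightarrow> ('a, 'm, 'c) module_scheme"
  where "Frob_push R p e M = M\<lparr>smult := (\<lambda>r x. (r [^]\<^bsub>R\<^esub> (p ^ e)) \<odot>\<^bsub>M\<^esub> x)\<rparr>"

text \<open>
  A noetherian F-finite ring is excellent by a theorem of Kunz, so excellence needs no separate
  hypothesis.
\<close>

definition F_finite :: "('a, 'b) ring_scheme \<Rightarrow> nat \<Rightarrow> bool"
  where "F_finite R p \<longleftrightarrow> fin_gen_module R (Frob_push R p 1 (self_module R))"


subsection \<open>The total ring of fractions\<close>

definition nonzerodivisors :: "('a, 'b) ring_scheme \<Rightarrow> 'a set"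
  where "nonzerodivisors R = {s \<in> carrier R. \<forall>a\<in>carrier R. s \<otimes>\<^bsub>R\<^esub> a = \<zero>\<^bsub>R\<^esub> \<longrightarrow> a = \<zero>\<^bsub>R\<^esub>}"

definition fraction :: "('a, 'b) ring_scheme \<Rightarrow> 'a \<Rightarrow> 'a \<Rightarrow> ('a \<times> 'a) set"
  where "fraction R a s = {(b, t). b \<in> carrier R \<and> t \<in> nonzerodivisors R \<and> a \<otimes>\<^bsub>R\<^esub> t = b \<otimes>\<^bsub>R\<^esub> s}"

text \<open>Sums and products take the union over all representatives, which give the same class.\<close>

definition total_fractions :: "('a, 'b) ring_scheme \<Rightarrow> ('a \<times> 'a) set ring"
  where "total_fractions R =
    \<lparr>carrier = {fraction R a s | a s. a \<in> carrier R \<and> s \<in> nonzerodivisors R},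
     monoid.mult = (\<lambda>X Y. \<Union>(a, s)\<in>X. \<Union>(b, t)\<in>Y. fraction R (a \<otimes>\<^bsub>R\<^esub> b) (s \<otimes>\<^bsub>R\<^esub> t)),
     one = fraction R \<one>\<^bsub>R\<^esub> \<one>\<^bsub>R\<^esub>,
     ring.zero = fraction R \<zero>\<^bsub>R\<^esub> \<one>\<^bsub>R\<^esub>,
     add = (\<lambda>X Y. \<Union>(a, s)\<in>X. \<Union>(b, t)\<in>Y.
              fraction R ((a \<otimes>\<^bsub>R\<^esub> t) \<oplus>\<^bsub>R\<^esub> (b \<otimes>\<^bsub>R\<^esub> s)) (s \<otimes>\<^bsub>R\<^esub> t))\<rparr>"

definition to_fractions :: "('a, 'b) ring_scheme \<Rightarrow> 'a \<Rightarrow> ('a \<times> 'a) set"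
  where "to_fractions R a = fraction R a \<one>\<^bsub>R\<^esub>"

text \<open>\<open>x\<close> is a root of the monic polynomial with lower coefficients \<open>c 0, \<dots>, c (n - 1)\<close>.\<close>

definition integral_over_base :: "('a, 'b) ring_scheme \<Rightarrow> ('a \<times> 'a) set \<Rightarrow> bool"
  where "integral_over_base R x \<longleftrightarrow>
    (\<exists>n::nat. n > 0 \<and> (\<exists>c \<in> {..<n} \<rightarrow> carrier R.
      x [^]\<^bsub>total_fractions R\<^esub> n \<oplus>\<^bsub>total_fractions R\<^esub>
      (\<Oplus>\<^bsub>total_fractions R\<^esub>i\<in>{..<n}. to_fractions R (c i) \<otimes>\<^bsub>total_fractions R\<^esub> x [^]\<^bsub>total_fractions R\<^esub> i)
      = \<zero>\<^bsub>total_fractions R\<^esub>))"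

definition normal_domain :: "('a, 'b) ring_scheme \<Rightarrow> bool"
  where "normal_domain R \<longleftrightarrow> domain R \<and>
    (\<forall>x\<in>carrier (total_fractions R). integral_over_base R x \<longrightarrow> x \<in> to_fractions R ` carrier R)"


section \<open>Divisors\<close>

text \<open>
  For a prime \<open>P\<close> of a domain \<open>R\<close> with fraction field \<open>K\<close>: the local ring \<open>R\<^sub>P\<close> as a subring of
  \<open>K\<close>, and its maximal ideal.
\<close>

definition localization_at :: "('a, 'b) ring_scheme \<Rightarrow> 'a set \<Rightarrow> ('a \<times> 'a) set ring"
  where "localization_at R P = (total_fractions R)
    \<lparr>carrier := {fraction R a s | a s. a \<in> carrier R \<and> s \<in> carrier R - P}\<rparr>"

definition localization_max :: "('a, 'b) ring_scheme \<Rightarrow> 'a set \<Rightarrow> ('a \<times> 'a) set set"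
  where "localization_max R P = {fraction R a s | a s. a \<in> P \<and> s \<in> carrier R - P}"

text \<open>
  The normalized valuation of \<open>K\<close> attached to \<open>P\<close> when \<open>R\<^sub>P\<close> is a discrete valuation ring:
  \<open>x = u t\<^sup>n\<close> with \<open>t\<close> a uniformizer and \<open>u\<close> a unit of \<open>R\<^sub>P\<close>. Only meaningful for \<open>x \<noteq> 0\<close>.
\<close>

definition ord_at :: "('a, 'b) ring_scheme \<Rightarrow> 'a set \<Rightarrow> ('a \<times> 'a) set \<Rightarrow> int"
  where "ord_at R P x = (THE n. \<exists>t u.
    t \<in> carrier (localization_at R P) \<and>
    localization_max R P = PIdl\<^bsub>localization_at R P\<^esub> t \<and>
    u \<in> Units (localization_at R P) \<and>
    x = u \<otimes>\<^bsub>total_fractions R\<^esub> (t [^]\<^bsub>total_fractions R\<^esub> n))"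

text \<open>
  Weil divisors are coefficient functions on the primes, finitely supported on the primes of
  height one.
\<close>

definition effective_R_divisor :: "('a, 'b) ring_scheme \<Rightarrow> ('a set \<Rightarrow> real) \<Rightarrow> bool"
  where "effective_R_divisor R \<Delta> \<longleftrightarrow>
    finite {P. \<Delta> P \<noteq> 0} \<and> {P. \<Delta> P \<noteq> 0} \<subseteq> height_one_primes R \<and> (\<forall>P. \<Delta> P \<ge> 0)"

definition ceil_mult :: "nat \<Rightarrow> ('a set \<Rightarrow> real) \<Rightarrow> 'a set \<Rightarrow> int"
  where "ceil_mult n \<Delta> = (\<lambda>P. \<lceil>real n * \<Delta> P\<rceil>)"

text \<open>
  The global sections \<open>R(D)\<close> inside the total ring of fractions. The case \<open>D = 0\<close> is the convention
  \<open>R(0) = R\<close>, needed because \<open>R\<close> is then not assumed to be a normal domain.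
\<close>

definition sections :: "('a, 'b) ring_scheme \<Rightarrow> ('a set \<Rightarrow> int) \<Rightarrow> ('a \<times> 'a) set set"
  where "sections R D =
    (if D = (\<lambda>_. 0) then to_fractions R ` carrier R
     else {x \<in> carrier (total_fractions R).
             x = \<zero>\<^bsub>total_fractions R\<^esub> \<or> (\<forall>P\<in>height_one_primes R. ord_at R P x + D P \<ge> 0)})"

definition sections_module ::
    "('a, 'b) ring_scheme \<Rightarrow> ('a set \<Rightarrow> int) \<Rightarrow> ('a, ('a \<times> 'a) set) module"
  where "sections_module R D =
    (ring_module (to_fractions R) (total_fractions R))\<lparr>carrier := sections R D\<rparr>"


section \<open>Triples and compatible ideals\<close>

definition graded_system :: "('a, 'b) ring_scheme \<Rightarrow> (nat \<Rightarrow> 'a set) \<Rightarrow> bool"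
  where "graded_system R \<aa> \<longleftrightarrow>
    (\<forall>i. ideal (\<aa> i) R) \<and> (\<forall>i j. \<aa> i \<cdot>\<^bsub>R\<^esub> \<aa> j \<subseteq> \<aa> (i + j))"

definition is_triple ::
    "('a, 'b) ring_scheme \<Rightarrow> ('a set \<Rightarrow> real) \<Rightarrow> (nat \<Rightarrow> 'a set) \<Rightarrow> bool"
  where "is_triple R \<Delta> \<aa> \<longleftrightarrow>
    reduced_ring R \<and> effective_R_divisor R \<Delta> \<and> graded_system R \<aa> \<and>
    (\<Delta> \<noteq> (\<lambda>_. 0) \<longrightarrow> normal_domain R) \<and>
    \<aa> 0 = carrier R \<and> (\<forall>i. \<aa> i \<inter> ring_circ R \<noteq> {})"

abbreviation FR :: "('a, 'b) ring_scheme \<Rightarrow> nat \<Rightarrow> nat \<Rightarrow> ('a, 'a) module"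
  where "FR R p e \<equiv> Frob_push R p e (self_module R)"

definition FR_div ::
    "('a, 'b) ring_scheme \<Rightarrow> nat \<Rightarrow> ('a set \<Rightarrow> real) \<Rightarrow> nat \<Rightarrow> ('a, ('a \<times> 'a) set) module"
  where "FR_div R p \<Delta> e = Frob_push R p e (sections_module R (ceil_mult (p ^ e - 1) \<Delta>))"

definition uniformly_compatible ::
    "('a, 'b) ring_scheme \<Rightarrow> nat \<Rightarrow> ('a set \<Rightarrow> real) \<Rightarrow> (nat \<Rightarrow> 'a set) \<Rightarrow> 'a set \<Rightarrow> bool"
  where "uniformly_compatible R p \<Delta> \<aa> I \<longleftrightarrow>
    (\<forall>e>0. \<forall>a\<in>\<aa> (p ^ e - 1). \<forall>\<phi>\<in>Hom_mod R (FR_div R p \<Delta> e) (self_module R).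
       \<phi> ` to_fractions R ` (\<lambda>x. a \<otimes>\<^bsub>R\<^esub> x) ` I \<subseteq> I)"

text \<open>
  The composition \<open>Hom(F\<^sup>e\<^sub>*R(D), R) \<rightarrow> Hom(F\<^sup>e\<^sub>*R, R) \<rightarrow> Hom(F\<^sup>e\<^sub>*R, R) \<rightarrow> Hom(R, R) = R \<rightarrow> R/I\<close> with
  the middle map induced by multiplication by \<open>a f\<close>.
\<close>

definition Hom_composite ::
    "('a, 'b) ring_scheme \<Rightarrow> nat \<Rightarrow> 'a set \<Rightarrow> nat \<Rightarrow> 'a \<Rightarrow> 'a \<Rightarrow> (('a \<times> 'a) set \<Rightarrow> 'a) \<Rightarrow> 'a set"
  where "Hom_composite R p I e a f =
    (\<lambda>r. I +>\<^bsub>R\<^esub> r) \<circ> (\<lambda>\<psi>. \<psi> \<one>\<^bsub>R\<^esub>) \<circ>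
    Hom_pre (self_module R) (\<lambda>r. r [^]\<^bsub>R\<^esub> (p ^ e)) \<circ>
    Hom_pre (FR R p e) (\<lambda>x. (a \<otimes>\<^bsub>R\<^esub> f) \<otimes>\<^bsub>R\<^esub> x) \<circ>
    Hom_pre (FR R p e) (to_fractions R)"

text \<open>
  The composition \<open>E\<^bsub>R/I\<^esub> \<rightarrow> E \<rightarrow> E \<otimes> F\<^sup>e\<^sub>*R \<rightarrow> E \<otimes> F\<^sup>e\<^sub>*R \<rightarrow> E \<otimes> F\<^sup>e\<^sub>*R(D)\<close>, as a function to be
  restricted to \<open>Ann_in E I\<close>.
\<close>

definition tensor_composite ::
    "('a, 'b) ring_scheme \<Rightarrow> nat \<Rightarrow> ('a set \<Rightarrow> real) \<Rightarrow> ('a, 'm, 'c) module_scheme \<Rightarrow>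
     nat \<Rightarrow> 'a \<Rightarrow> 'a \<Rightarrow> 'm \<Rightarrow> ('m \<times> ('a \<times> 'a) set \<Rightarrow>\<^sub>0 int) set"
  where "tensor_composite R p \<Delta> E e a f =
    tensor_map R E (FR_div R p \<Delta> e) (\<lambda>z. z) (to_fractions R) \<circ>
    tensor_map R E (FR R p e) (\<lambda>z. z) (\<lambda>x. (a \<otimes>\<^bsub>R\<^esub> f) \<otimes>\<^bsub>R\<^esub> x) \<circ>
    (\<lambda>z. pure_tensor R E (FR R p e) z \<one>\<^bsub>R\<^esub>)"


section \<open>Baer's criterion: injectivity does not depend on the type of test modules\<close>

lemma Hom_mod_closed:
  assumes "\<phi> \<in> Hom_mod R M N" "x \<in> carrier M"
  shows "\<phi> x \<in> carrier N"
  using assms by (auto simp: Hom_mod_def)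

lemma Hom_mod_add:
  assumes "\<phi> \<in> Hom_mod R M N" "x \<in> carrier M" "y \<in> carrier M"
  shows "\<phi> (x \<oplus>\<^bsub>M\<^esub> y) = \<phi> x \<oplus>\<^bsub>N\<^esub> \<phi> y"
  using assms by (auto simp: Hom_mod_def)

lemma Hom_mod_smult:
  assumes "\<phi> \<in> Hom_mod R M N" "r \<in> carrier R" "x \<in> carrier M"
  shows "\<phi> (r \<odot>\<^bsub>M\<^esub> x) = r \<odot>\<^bsub>N\<^esub> \<phi> x"
  using assms by (auto simp: Hom_mod_def)

lemma Hom_mod_zero:
  assumes "\<phi> \<in> Hom_mod R M N" "module R M" "module R N"
  shows "\<phi> \<zero>\<^bsub>M\<^esub> = \<zero>\<^bsub>N\<^esub>"
proof -
  interpret M: module R M by fact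
  interpret N: module R N by fact
  have "\<phi> (\<zero>\<^bsub>R\<^esub> \<odot>\<^bsub>M\<^esub> \<zero>\<^bsub>M\<^esub>) = \<zero>\<^bsub>R\<^esub> \<odot>\<^bsub>N\<^esub> \<phi> \<zero>\<^bsub>M\<^esub>"
    by (rule Hom_mod_smult[OF assms(1)]) auto
  then show ?thesis using Hom_mod_closed[OF assms(1) M.zero_closed] by simp
qed

lemma module_ideal_module:
  assumes "cring R" "ideal J R" shows "module R ((self_module R)\<lparr>carrier := J\<rparr>)"
proof -
  interpret cring R by fact
  interpret J: ideal J R by fact
  have Jc: "\<And>x. x \<in> J \<Longrightarrow> x \<in> carrier R" by (rule J.Icarr)
  have "abelian_group ((self_module R)\<lparr>carrier := J\<rparr>)"
  proof (rule abelian_groupI)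
    fix x assume "x \<in> carrier ((self_module R)\<lparr>carrier := J\<rparr>)"
    then have "\<ominus>\<^bsub>R\<^esub> x \<in> J" "\<ominus>\<^bsub>R\<^esub> x \<oplus>\<^bsub>R\<^esub> x = \<zero>\<^bsub>R\<^esub>"
      using Jc by (auto simp: ring_module_def l_neg)
    then show "\<exists>y\<in>carrier ((self_module R)\<lparr>carrier := J\<rparr>).
        y \<oplus>\<^bsub>(self_module R)\<lparr>carrier := J\<rparr>\<^esub> x = \<zero>\<^bsub>(self_module R)\<lparr>carrier := J\<rparr>\<^esub>"
      by (auto simp: ring_module_def)
  qed (use Jc in \<open>auto simp: ring_module_def a_ac\<close>)
  then show ?thesis
    by (intro moduleI)
       (use Jc in \<open>auto simp: ring_module_def is_cring m_assoc l_distr r_distr J.I_l_closed\<close>)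
qed

lemma module_self_module:
  assumes "cring R" shows "module R (self_module R)"
proof -
  interpret cring R by fact
  have "(self_module R)\<lparr>carrier := carrier R\<rparr> = self_module R"
    by (simp add: ring_module_def)
  then show ?thesis using module_ideal_module[OF assms oneideal] by simp
qed

theorem injective_module_any_type:
  assumes inj: "injective_module TYPE('a) R (E :: ('a, 'm, 'c) module_scheme)"
  shows "injective_module TYPE('t) R E"
  unfolding injective_module_def
proof (intro conjI allI impI)
  show ER: "module R E" using inj unfolding injective_module_def by blast
  fix A B :: "('a, 't) module" and i f
  assume asm: "module R A \<and> module R B \<and> i \<in> Hom_mod R A B \<and> inj_on i (carrier A) \<and> f \<in> Hom_mod R A E"
  interpret A: module R A using asm by blast
  interpret B: module R B using asm by blast
  interpret E: module R E by fact
  have i: "i \<in> Hom_mod R A B" and ii: "inj_on i (carrier A)" and f: "f \<in> Hom_mod R A E"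
    using asm by auto
  have cR: "cring R" using ER by (rule module.axioms(1))
  note Eabel = E.abelian_group_axioms
  define S where "S = {G. G \<subseteq> carrier B \<times> carrier E \<and> (\<lambda>x. (i x, f x)) ` carrier A \<subseteq> G \<and>
     (\<forall>x y x' y'. (x, y) \<in> G \<and> (x', y') \<in> G \<longrightarrow> (x \<oplus>\<^bsub>B\<^esub> x', y \<oplus>\<^bsub>E\<^esub> y') \<in> G) \<and>
     (\<forall>r\<in>carrier R. \<forall>x y. (x, y) \<in> G \<longrightarrow> (r \<odot>\<^bsub>B\<^esub> x, r \<odot>\<^bsub>E\<^esub> y) \<in> G) \<and>
     (\<forall>y. (\<zero>\<^bsub>B\<^esub>, y) \<in> G \<longrightarrow> y = \<zero>\<^bsub>E\<^esub>)}"
  have SD: "x \<in> carrier B" "y \<in> carrier E" if "G \<in> S" "(x, y) \<in> G" for G x y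
    using that by (auto simp: S_def)
  have Sif: "(i x, f x) \<in> G" if "G \<in> S" "x \<in> carrier A" for G x
    using that by (auto simp: S_def)
  have Sadd: "(x \<oplus>\<^bsub>B\<^esub> x', y \<oplus>\<^bsub>E\<^esub> y') \<in> G" if "G \<in> S" "(x, y) \<in> G" "(x', y') \<in> G" for G x y x' y'
    using that unfolding S_def by blast
  have Ssm: "(r \<odot>\<^bsub>B\<^esub> x, r \<odot>\<^bsub>E\<^esub> y) \<in> G" if "G \<in> S" "(x, y) \<in> G" "r \<in> carrier R" for G x y r
    using that unfolding S_def by blast
  have Sz: "y = \<zero>\<^bsub>E\<^esub>" if "G \<in> S" "(\<zero>\<^bsub>B\<^esub>, y) \<in> G" for G y
    using that unfolding S_def by blast
  have Sneg: "(\<ominus>\<^bsub>B\<^esub> x, \<ominus>\<^bsub>E\<^esub> y) \<in> G" if "G \<in> S" "(x, y) \<in> G" for G x y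
  proof -
    have "((\<ominus>\<^bsub>R\<^esub> \<one>\<^bsub>R\<^esub>) \<odot>\<^bsub>B\<^esub> x, (\<ominus>\<^bsub>R\<^esub> \<one>\<^bsub>R\<^esub>) \<odot>\<^bsub>E\<^esub> y) \<in> G"
      using Ssm[OF that] by auto
    then show ?thesis using SD[OF that]
      by (simp add: B.smult_l_minus E.smult_l_minus)
  qed
  have Suniq: "y = y'" if G: "G \<in> S" "(x, y) \<in> G" "(x, y') \<in> G" for G x y y'
  proof -
    have "(x \<oplus>\<^bsub>B\<^esub> \<ominus>\<^bsub>B\<^esub> x, y \<oplus>\<^bsub>E\<^esub> \<ominus>\<^bsub>E\<^esub> y') \<in> G"
      using Sadd[OF G(1,2) Sneg[OF G(1,3)]] .
    then have "(\<zero>\<^bsub>B\<^esub>, y \<oplus>\<^bsub>E\<^esub> \<ominus>\<^bsub>E\<^esub> y') \<in> G" using SD[OF G(1,2)] by (simp add: B.r_neg)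
    then have "y \<oplus>\<^bsub>E\<^esub> \<ominus>\<^bsub>E\<^esub> y' = \<zero>\<^bsub>E\<^esub>" by (rule Sz[OF G(1)])
    then show ?thesis using SD[OF G(1,2)] SD[OF G(1,3)]
      by (metis E.minus_equality E.minus_minus E.a_inv_closed)
  qed
  define G0 where "G0 = (\<lambda>x. (i x, f x)) ` carrier A"
  have G0: "G0 \<in> S"
    unfolding S_def
  proof (intro CollectI conjI allI ballI impI)
    show "G0 \<subseteq> carrier B \<times> carrier E"
      using Hom_mod_closed[OF i] Hom_mod_closed[OF f] by (auto simp: G0_def)
    show "(x \<oplus>\<^bsub>B\<^esub> x', y \<oplus>\<^bsub>E\<^esub> y') \<in> G0" if xy: "(x, y) \<in> G0 \<and> (x', y') \<in> G0" for x y x' y'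
    proof -
      from xy obtain a b where "a \<in> carrier A" "b \<in> carrier A" "x = i a" "y = f a" "x' = i b" "y' = f b"
        by (auto simp: G0_def)
      then show ?thesis unfolding G0_def
        by (intro image_eqI[of _ _ "a \<oplus>\<^bsub>A\<^esub> b"]) (auto simp: Hom_mod_add[OF i] Hom_mod_add[OF f])
    qed
    show "(r \<odot>\<^bsub>B\<^esub> x, r \<odot>\<^bsub>E\<^esub> y) \<in> G0" if "r \<in> carrier R" "(x, y) \<in> G0" for r x y
    proof -
      from that obtain a where "a \<in> carrier A" "x = i a" "y = f a"
        by (auto simp: G0_def)
      then show ?thesis unfolding G0_def using that(1)
        by (intro image_eqI[of _ _ "r \<odot>\<^bsub>A\<^esub> a"]) (auto simp: Hom_mod_smult[OF i] Hom_mod_smult[OF f])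
    qed
    show "y = \<zero>\<^bsub>E\<^esub>" if "(\<zero>\<^bsub>B\<^esub>, y) \<in> G0" for y
    proof -
      from that obtain a where a: "a \<in> carrier A" "\<zero>\<^bsub>B\<^esub> = i a" "y = f a"
        by (auto simp: G0_def)
      have "i a = i \<zero>\<^bsub>A\<^esub>"
        using a(2) Hom_mod_zero[OF i A.module_axioms B.module_axioms] by (rule trans[OF sym sym])
      then have "a = \<zero>\<^bsub>A\<^esub>" using inj_onD[OF ii] a(1) A.zero_closed by blast
      then show ?thesis using a(3) Hom_mod_zero[OF f A.module_axioms ER] by simp
    qed
  qed (auto simp: G0_def)
  have "\<exists>G\<in>S. \<forall>X\<in>S. G \<subseteq> X \<longrightarrow> X = G"
  proof (rule subset_Zorn_nonempty)
    show "S \<noteq> {}" using G0 by auto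
    fix \<C> assume ne: "\<C> \<noteq> {}" and ch: "subset.chain S \<C>"
    have CS: "\<And>G. G \<in> \<C> \<Longrightarrow> G \<in> S" and lin: "\<And>G H. G \<in> \<C> \<Longrightarrow> H \<in> \<C> \<Longrightarrow> G \<subseteq> H \<or> H \<subseteq> G"
      using ch by (auto simp: subset_chain_def)
    show "\<Union>\<C> \<in> S"
      unfolding S_def
    proof (intro CollectI conjI allI ballI impI)
      show "\<Union>\<C> \<subseteq> carrier B \<times> carrier E" using CS SD by fast
      show "(\<lambda>x. (i x, f x)) ` carrier A \<subseteq> \<Union>\<C>" using CS Sif ne by fast
      show "(x \<oplus>\<^bsub>B\<^esub> x', y \<oplus>\<^bsub>E\<^esub> y') \<in> \<Union>\<C>" if xy: "(x, y) \<in> \<Union>\<C> \<and> (x', y') \<in> \<Union>\<C>" for x y x' y'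
      proof -
        from xy obtain G H where GH: "G \<in> \<C>" "H \<in> \<C>" "(x, y) \<in> G" "(x', y') \<in> H" by blast
        with lin obtain K where "K \<in> \<C>" "(x, y) \<in> K" "(x', y') \<in> K" by blast
        then show ?thesis using Sadd CS by blast
      qed
      show "(r \<odot>\<^bsub>B\<^esub> x, r \<odot>\<^bsub>E\<^esub> y) \<in> \<Union>\<C>" if "r \<in> carrier R" "(x, y) \<in> \<Union>\<C>" for r x y
        using that Ssm CS by blast
      show "y = \<zero>\<^bsub>E\<^esub>" if "(\<zero>\<^bsub>B\<^esub>, y) \<in> \<Union>\<C>" for y
        using that Sz CS by blast
    qed
  qed
  then obtain G where G: "G \<in> S" and Gmax: "\<And>X. X \<in> S \<Longrightarrow> G \<subseteq> X \<Longrightarrow> X = G" by blast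
  have G00: "(\<zero>\<^bsub>B\<^esub>, \<zero>\<^bsub>E\<^esub>) \<in> G"
    using Sif[OF G A.zero_closed] Hom_mod_zero[OF i A.module_axioms B.module_axioms]
      Hom_mod_zero[OF f A.module_axioms ER] by simp
  have dom: "\<exists>y. (b, y) \<in> G" if b: "b \<in> carrier B" for b
  proof -
    define J where "J = {r \<in> carrier R. \<exists>y. (r \<odot>\<^bsub>B\<^esub> b, y) \<in> G}"
    have J: "ideal J R"
    proof (rule idealI)
      show "ring R" using cR by (rule cring.axioms(1))
      have "subgroup J (add_monoid R)"
      proof (rule group.subgroupI)
        show "group (add_monoid R)" using A.R.a_group .
        show "J \<noteq> {}" using G00 b by (auto simp: J_def intro!: exI[of _ "\<zero>\<^bsub>R\<^esub>"])
        show "J \<subseteq> carrier (add_monoid R)" by (auto simp: J_def)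
        fix r assume "r \<in> J"
        then obtain y where r: "r \<in> carrier R" "(r \<odot>\<^bsub>B\<^esub> b, y) \<in> G" by (auto simp: J_def)
        then have "((\<ominus>\<^bsub>R\<^esub> r) \<odot>\<^bsub>B\<^esub> b, \<ominus>\<^bsub>E\<^esub> y) \<in> G" using Sneg[OF G r(2)] b by (simp add: B.smult_l_minus)
        then show "inv\<^bsub>add_monoid R\<^esub> r \<in> J" using r by (auto simp: J_def a_inv_def[symmetric])
      next
        fix r s assume "r \<in> J" "s \<in> J"
        then obtain y z where r: "r \<in> carrier R" "(r \<odot>\<^bsub>B\<^esub> b, y) \<in> G" "s \<in> carrier R" "(s \<odot>\<^bsub>B\<^esub> b, z) \<in> G"
          by (auto simp: J_def)
        then show "r \<otimes>\<^bsub>add_monoid R\<^esub> s \<in> J"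
          using Sadd[OF G r(2,4)] b by (auto simp: J_def B.smult_l_distr)
      qed
      then show "subgroup J (add_monoid R)" .
      fix r s assume "r \<in> J" "s \<in> carrier R"
      then obtain y where r: "r \<in> carrier R" "(r \<odot>\<^bsub>B\<^esub> b, y) \<in> G" by (auto simp: J_def)
      then show "s \<otimes>\<^bsub>R\<^esub> r \<in> J"
        using Ssm[OF G r(2) \<open>s \<in> carrier R\<close>] b \<open>s \<in> carrier R\<close> by (auto simp: J_def B.smult_assoc1)
      then show "r \<otimes>\<^bsub>R\<^esub> s \<in> J" using r \<open>s \<in> carrier R\<close> by (simp add: A.R.m_comm)
    qed
    define h where "h = (\<lambda>r\<in>J. THE y. (r \<odot>\<^bsub>B\<^esub> b, y) \<in> G)"
    have hG: "(r \<odot>\<^bsub>B\<^esub> b, h r) \<in> G" if "r \<in> J" for r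
    proof -
      from that obtain y where y: "(r \<odot>\<^bsub>B\<^esub> b, y) \<in> G" by (auto simp: J_def)
      have "(THE y. (r \<odot>\<^bsub>B\<^esub> b, y) \<in> G) = y"
        using y Suniq[OF G] by (intro the_equality) auto
      then show ?thesis using y that by (simp add: h_def)
    qed
    have hu: "h r = y" if "r \<in> J" "(r \<odot>\<^bsub>B\<^esub> b, y) \<in> G" for r y
      using Suniq[OF G hG[OF that(1)] that(2)] .
    define JM where "JM = (self_module R)\<lparr>carrier := J\<rparr>"
    have JR: "\<And>r. r \<in> J \<Longrightarrow> r \<in> carrier R" by (auto simp: J_def)
    have Jadd: "\<And>r s. r \<in> J \<Longrightarrow> s \<in> J \<Longrightarrow> r \<oplus>\<^bsub>R\<^esub> s \<in> J"
      using J by (simp add: additive_subgroup.a_closed ideal.axioms(1))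
    have JM: "module R JM" unfolding JM_def by (rule module_ideal_module[OF cR J])
    have h: "h \<in> Hom_mod R JM E"
      unfolding Hom_mod_def
    proof (intro CollectI conjI ballI)
      show "h \<in> carrier JM \<rightarrow>\<^sub>E carrier E"
        using SD(2)[OF G hG] by (auto simp: JM_def h_def)
      fix r s assume "r \<in> carrier JM" "s \<in> carrier JM"
      then have rs: "r \<in> J" "s \<in> J" by (auto simp: JM_def)
      then have "((r \<oplus>\<^bsub>R\<^esub> s) \<odot>\<^bsub>B\<^esub> b, h r \<oplus>\<^bsub>E\<^esub> h s) \<in> G"
        using Sadd[OF G hG hG, OF rs] b JR by (simp add: B.smult_l_distr)
      then show "h (r \<oplus>\<^bsub>JM\<^esub> s) = h r \<oplus>\<^bsub>E\<^esub> h s"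
        using hu Jadd[OF rs] by (simp add: JM_def ring_module_def)
    next
      fix r s assume "r \<in> carrier R" "s \<in> carrier JM"
      then have rs: "r \<in> carrier R" "s \<in> J" by (auto simp: JM_def)
      then have "((r \<otimes>\<^bsub>R\<^esub> s) \<odot>\<^bsub>B\<^esub> b, r \<odot>\<^bsub>E\<^esub> h s) \<in> G"
        using Ssm[OF G hG, OF rs(2,1)] b JR by (simp add: B.smult_assoc1)
      then show "h (r \<odot>\<^bsub>JM\<^esub> s) = r \<odot>\<^bsub>E\<^esub> h s"
        using hu rs ideal.I_l_closed[OF J] by (simp add: JM_def ring_module_def)
    qed
    have incl: "(\<lambda>r\<in>J. r) \<in> Hom_mod R JM (self_module R)"
      using JR Jadd ideal.I_l_closed[OF J] by (auto simp: Hom_mod_def JM_def ring_module_def)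
    have incli: "inj_on (\<lambda>r\<in>J. r) (carrier JM)" by (auto simp: JM_def inj_on_def)
    obtain k where k: "k \<in> Hom_mod R (self_module R) E" "\<forall>x\<in>carrier JM. k ((\<lambda>r\<in>J. r) x) = h x"
      using inj JM module_self_module[OF cR] incl incli h
      unfolding injective_module_def by blast
    have kh: "k r = h r" if "r \<in> J" for r using k(2) that by (auto simp: JM_def)
    define e0 where "e0 = k \<one>\<^bsub>R\<^esub>"
    have e0: "e0 \<in> carrier E" unfolding e0_def by (rule Hom_mod_closed[OF k(1)]) (simp add: ring_module_def)
    have kr: "k r = r \<odot>\<^bsub>E\<^esub> e0" if "r \<in> carrier R" for r
      using Hom_mod_smult[OF k(1) that, of "\<one>\<^bsub>R\<^esub>"] that by (simp add: ring_module_def e0_def)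
    define G' where "G' = {(x \<oplus>\<^bsub>B\<^esub> r \<odot>\<^bsub>B\<^esub> b, y \<oplus>\<^bsub>E\<^esub> r \<odot>\<^bsub>E\<^esub> e0) | x y r. (x, y) \<in> G \<and> r \<in> carrier R}"
    have G'I: "(x \<oplus>\<^bsub>B\<^esub> r \<odot>\<^bsub>B\<^esub> b, y \<oplus>\<^bsub>E\<^esub> r \<odot>\<^bsub>E\<^esub> e0) \<in> G'"
      if "(x, y) \<in> G" "r \<in> carrier R" for x y r
      using that unfolding G'_def by blast
    have GG': "G \<subseteq> G'"
    proof
      fix q assume q: "q \<in> G"
      obtain x y where xy: "q = (x, y)" by (cases q)
      have "(x \<oplus>\<^bsub>B\<^esub> \<zero>\<^bsub>R\<^esub> \<odot>\<^bsub>B\<^esub> b, y \<oplus>\<^bsub>E\<^esub> \<zero>\<^bsub>R\<^esub> \<odot>\<^bsub>E\<^esub> e0) \<in> G'"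
        using q xy by (intro G'I) auto
      then show "q \<in> G'" using SD[OF G, of x y] q xy b e0 by simp
    qed
    have "G' \<in> S"
      unfolding S_def
    proof (intro CollectI conjI allI ballI impI)
      show "G' \<subseteq> carrier B \<times> carrier E" using SD[OF G] b e0 by (auto simp: G'_def)
      show "(\<lambda>x. (i x, f x)) ` carrier A \<subseteq> G'" using Sif[OF G] GG' by blast
      show "(x \<oplus>\<^bsub>B\<^esub> x', y \<oplus>\<^bsub>E\<^esub> y') \<in> G'" if "(x, y) \<in> G' \<and> (x', y') \<in> G'" for x y x' y'
      proof -
        from that obtain u v r u' v' r' where *: "(u, v) \<in> G" "(u', v') \<in> G" "r \<in> carrier R" "r' \<in> carrier R"
          "x = u \<oplus>\<^bsub>B\<^esub> r \<odot>\<^bsub>B\<^esub> b" "y = v \<oplus>\<^bsub>E\<^esub> r \<odot>\<^bsub>E\<^esub> e0"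
          "x' = u' \<oplus>\<^bsub>B\<^esub> r' \<odot>\<^bsub>B\<^esub> b" "y' = v' \<oplus>\<^bsub>E\<^esub> r' \<odot>\<^bsub>E\<^esub> e0"
          unfolding G'_def by blast
        have "x \<oplus>\<^bsub>B\<^esub> x' = (u \<oplus>\<^bsub>B\<^esub> u') \<oplus>\<^bsub>B\<^esub> (r \<oplus>\<^bsub>R\<^esub> r') \<odot>\<^bsub>B\<^esub> b"
          using * SD[OF G] b by (simp add: B.smult_l_distr B.a_ac)
        moreover have "y \<oplus>\<^bsub>E\<^esub> y' = (v \<oplus>\<^bsub>E\<^esub> v') \<oplus>\<^bsub>E\<^esub> (r \<oplus>\<^bsub>R\<^esub> r') \<odot>\<^bsub>E\<^esub> e0"
          using * SD[OF G] e0 by (simp add: E.smult_l_distr E.a_ac)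
        moreover have "(u \<oplus>\<^bsub>B\<^esub> u', v \<oplus>\<^bsub>E\<^esub> v') \<in> G" using Sadd[OF G *(1,2)] .
        moreover have "r \<oplus>\<^bsub>R\<^esub> r' \<in> carrier R" using * by simp
        ultimately show ?thesis using G'I by metis
      qed
      show "(s \<odot>\<^bsub>B\<^esub> x, s \<odot>\<^bsub>E\<^esub> y) \<in> G'" if s: "s \<in> carrier R" and "(x, y) \<in> G'" for s x y
      proof -
        from that obtain u v r where *: "(u, v) \<in> G" "r \<in> carrier R"
          "x = u \<oplus>\<^bsub>B\<^esub> r \<odot>\<^bsub>B\<^esub> b" "y = v \<oplus>\<^bsub>E\<^esub> r \<odot>\<^bsub>E\<^esub> e0"
          unfolding G'_def by blast
        have "s \<odot>\<^bsub>B\<^esub> x = s \<odot>\<^bsub>B\<^esub> u \<oplus>\<^bsub>B\<^esub> (s \<otimes>\<^bsub>R\<^esub> r) \<odot>\<^bsub>B\<^esub> b"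
          using * SD[OF G] b s by (simp add: B.smult_r_distr B.smult_assoc1)
        moreover have "s \<odot>\<^bsub>E\<^esub> y = s \<odot>\<^bsub>E\<^esub> v \<oplus>\<^bsub>E\<^esub> (s \<otimes>\<^bsub>R\<^esub> r) \<odot>\<^bsub>E\<^esub> e0"
          using * SD[OF G] e0 s by (simp add: E.smult_r_distr E.smult_assoc1)
        moreover have "(s \<odot>\<^bsub>B\<^esub> u, s \<odot>\<^bsub>E\<^esub> v) \<in> G" using Ssm[OF G *(1) s] .
        moreover have "s \<otimes>\<^bsub>R\<^esub> r \<in> carrier R" using * s by simp
        ultimately show ?thesis using G'I by metis
      qed
      show "y = \<zero>\<^bsub>E\<^esub>" if "(\<zero>\<^bsub>B\<^esub>, y) \<in> G'" for y
      proof -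
        from that obtain u v r where *: "(u, v) \<in> G" "r \<in> carrier R"
          "\<zero>\<^bsub>B\<^esub> = u \<oplus>\<^bsub>B\<^esub> r \<odot>\<^bsub>B\<^esub> b" "y = v \<oplus>\<^bsub>E\<^esub> r \<odot>\<^bsub>E\<^esub> e0"
          unfolding G'_def by blast
        have uv: "u \<in> carrier B" "v \<in> carrier E" using SD[OF G *(1)] by auto
        have "r \<odot>\<^bsub>B\<^esub> b = \<ominus>\<^bsub>B\<^esub> u"
          using *(2,3) uv b by (metis B.smult_closed B.minus_equality B.a_comm)
        then have rG: "(r \<odot>\<^bsub>B\<^esub> b, \<ominus>\<^bsub>E\<^esub> v) \<in> G" using Sneg[OF G *(1)] by simp
        then have "r \<in> J" using *(2) by (auto simp: J_def)
        then have "r \<odot>\<^bsub>E\<^esub> e0 = \<ominus>\<^bsub>E\<^esub> v" using hu[OF _ rG] kh[of r] kr[OF *(2)] by metis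
        then show ?thesis using *(4) uv by (simp add: E.r_neg)
      qed
    qed
    then have "G' = G" using Gmax GG' by blast
    moreover have "(\<zero>\<^bsub>B\<^esub> \<oplus>\<^bsub>B\<^esub> \<one>\<^bsub>R\<^esub> \<odot>\<^bsub>B\<^esub> b, \<zero>\<^bsub>E\<^esub> \<oplus>\<^bsub>E\<^esub> \<one>\<^bsub>R\<^esub> \<odot>\<^bsub>E\<^esub> e0) \<in> G'"
      by (rule G'I[OF G00]) simp
    ultimately show ?thesis using b e0 by auto
  qed
  define g where "g = (\<lambda>b\<in>carrier B. THE y. (b, y) \<in> G)"
  have gG: "(b, g b) \<in> G" if "b \<in> carrier B" for b
  proof -
    from dom[OF that] obtain y where y: "(b, y) \<in> G" ..
    have "(THE y. (b, y) \<in> G) = y" using y Suniq[OF G] by (intro the_equality) auto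
    then show ?thesis using y that by (simp add: g_def)
  qed
  have gu: "g b = y" if "(b, y) \<in> G" for b y
    using Suniq[OF G gG that] SD[OF G that] by simp
  have "g \<in> Hom_mod R B E"
    unfolding Hom_mod_def
  proof (intro CollectI conjI ballI)
    show "g \<in> carrier B \<rightarrow>\<^sub>E carrier E" using SD(2)[OF G gG] by (auto simp: g_def)
    show "g (x \<oplus>\<^bsub>B\<^esub> y) = g x \<oplus>\<^bsub>E\<^esub> g y" if "x \<in> carrier B" "y \<in> carrier B" for x y
      by (rule gu[OF Sadd[OF G gG gG]]) (use that in auto)
    show "g (r \<odot>\<^bsub>B\<^esub> x) = r \<odot>\<^bsub>E\<^esub> g x" if "r \<in> carrier R" "x \<in> carrier B" for r x
      by (rule gu[OF Ssm[OF G gG]]) (use that in auto)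
  qed
  moreover have "\<forall>x\<in>carrier A. g (i x) = f x" using gu Sif[OF G] by blast
  ultimately show "\<exists>g\<in>Hom_mod R B E. \<forall>x\<in>carrier A. g (i x) = f x" by blast
qed

end

theory Submission
  imports Defs
begin

text \<open>
  Every condition is about an element \<open>x = a f\<close> (\<open>f \<in> I\<close>, \<open>a \<in> \<aa>\<^bsub>p^e-1\<^esub>\<close>) of the \<open>R\<close>-module
  \<open>M = F\<^sup>e\<^sub>*R(D)\<close>, where \<open>D = \<lceil>(p^e - 1) \<Delta>\<rceil>\<close>. Chasing \<open>\<phi>\<close> through the composition of \<open>Hom\<close> modules gives
  the class of \<open>\<phi> x\<close> in \<open>R / I\<close>, so (a) and (b) both say that \<open>\<phi> x \<in> I\<close> for all functionals
  \<open>\<phi> : M \<rightarrow> R\<close>. The composition in (c) sends \<open>z\<close> to \<open>z \<otimes> x \<in> E \<otimes> M\<close>. Hence (c) amounts to the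
  duality of \<open>functionals_into_ideal_iff\<close>: all functionals on \<open>M\<close> take \<open>x\<close> into \<open>I\<close> if and only if
  \<open>z \<otimes> x = 0\<close> for all \<open>z \<in> E\<close> annihilated by \<open>I\<close>.

  From right to left, a functional \<open>\<phi>\<close> induces \<open>E \<otimes> M \<rightarrow> E\<close>, \<open>z \<otimes> m \<mapsto> \<phi> m z\<close>, so \<open>\<phi> x\<close> annihilates
  \<open>Ann\<^sub>E I\<close>; an element of \<open>R\<close> outside \<open>I\<close> does not, since \<open>E\<close> is injective and contains the residue
  field (\<open>exists_annihilated_by_ideal_not_by\<close>). From left to right, let \<open>M\<close> have generators \<open>s\<close> and
  finitely many relations \<open>\<rho>\<close>, and write \<open>x = (\<Sum>s. v s s)\<close>. Then \<open>z \<otimes> x = 0\<close> as soon as the linear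
  system \<open>(\<Sum>\<rho>. \<rho> s y \<rho>) = v s z\<close> has a solution \<open>y\<close> in \<open>E\<close>. Over an injective module a linear system
  is solvable once every linear relation between its left hand sides also holds between its right
  hand sides. Such relations are exactly the functionals on \<open>M\<close>, and the requirement becomes
  \<open>\<phi> x z = 0\<close> (\<open>injective_linear_system\<close>).

  The argument uses that \<open>M\<close> is a finitely generated \<open>R\<close>-module (\<open>FR_div_finite\<close>). As \<open>R\<close> is \<open>F\<close>-finite,
  it suffices that \<open>R(D)\<close> is finitely generated over \<open>R\<close>, and for that it suffices that \<open>c R(D) \<subseteq> R\<close>
  for some nonzerodivisor \<open>c\<close>. If \<open>D = 0\<close>, take \<open>c = 1\<close>. Otherwise \<open>R\<close> is a normal noetherian domain;
  its localizations at primes of height one are discrete valuation rings (\<open>ord_at_fraction\<close>) with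
  intersection \<open>R\<close> (\<open>dvd_if_val_le\<close>), and \<open>c\<close> is a product of powers of uniformizers. The same
  valuations show that \<open>R(D)\<close> is a submodule of the fraction field containing \<open>R\<close>.
\<close>

section \<open>The Frobenius in prime characteristic\<close>

lemma (in cring) binomial_theorem:
  assumes x: "x \<in> carrier R" and y: "y \<in> carrier R"
  shows "(x \<oplus> y) [^] (n::nat) =
    (\<Oplus>k\<in>{..n}. add_pow R (n choose k) (x [^] k \<otimes> y [^] (n - k)))"
proof (induction n)
  case 0
  show ?case using x y by simp
next
  case (Suc n)
  define f where "f m k = add_pow R (m choose k) (x [^] k \<otimes> y [^] (m - k))" for m k :: nat
  have fc: "f m k \<in> carrier R" for m k using x y by (simp add: f_def)
  have X: "x \<otimes> f n k = add_pow R (n choose k) (x [^] Suc k \<otimes> y [^] (Suc n - Suc k))" for k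
    using x y unfolding f_def by (simp add: add_pow_rdistr m_ac)
  have Y: "y \<otimes> f n k = add_pow R (n choose k) (x [^] k \<otimes> y [^] (Suc n - k))" if "k \<le> n" for k
    using x y that unfolding f_def by (simp add: add_pow_rdistr m_ac Suc_diff_le)
  have step: "f (Suc n) (Suc k) = x \<otimes> f n k \<oplus> y \<otimes> f n (Suc k)" if "k < n" for k
    using x y that unfolding X Y[OF Suc_leI[OF that]] by (simp add: f_def add.nat_pow_mult)
  have last: "f (Suc n) (Suc n) = x \<otimes> f n n"
    unfolding X by (simp add: f_def)
  have first: "f (Suc n) 0 = y \<otimes> f n 0" unfolding Y[OF le0] by (simp add: f_def)
  have "(x \<oplus> y) [^] Suc n = x \<otimes> (\<Oplus>k\<in>{..n}. f n k) \<oplus> y \<otimes> (\<Oplus>k\<in>{..n}. f n k)"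
    using x y Suc.IH fc by (simp add: f_def[symmetric] nat_pow_Suc r_distr m_comm l_distr)
  also have "\<dots> = (\<Oplus>k\<in>{..n}. x \<otimes> f n k) \<oplus> (\<Oplus>k\<in>{..n}. y \<otimes> f n k)"
    using x y fc by (simp add: finsum_rdistr)
  also have "\<dots> = (\<Oplus>k\<in>{..Suc n}. f (Suc n) k)"
  proof (cases n)
    case 0
    then show ?thesis using x y fc last first by (simp add: a_comm)
  next
    case (Suc m)
    have "(\<Oplus>k\<in>{..m}. f (Suc n) (Suc k)) = (\<Oplus>k\<in>{..m}. x \<otimes> f n k \<oplus> y \<otimes> f n (Suc k))"
      by (rule finsum_cong') (use x y fc step Suc in auto)
    also have "\<dots> = (\<Oplus>k\<in>{..m}. x \<otimes> f n k) \<oplus> (\<Oplus>k\<in>{..m}. y \<otimes> f n (Suc k))"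
      using x y fc by (intro finsum_addf) auto
    finally have mid: "(\<Oplus>k\<in>{..m}. f (Suc n) (Suc k)) =
      (\<Oplus>k\<in>{..m}. x \<otimes> f n k) \<oplus> (\<Oplus>k\<in>{..m}. y \<otimes> f n (Suc k))" .
    have "(\<Oplus>k\<in>{..n}. x \<otimes> f n k) = x \<otimes> f n n \<oplus> (\<Oplus>k\<in>{..m}. x \<otimes> f n k)"
      unfolding Suc by (rule finsum_Suc) (use x fc in auto)
    moreover have "(\<Oplus>k\<in>{..n}. y \<otimes> f n k) = (\<Oplus>k\<in>{..m}. y \<otimes> f n (Suc k)) \<oplus> y \<otimes> f n 0"
      unfolding Suc by (rule finsum_Suc2) (use y fc in auto)
    moreover have "(\<Oplus>k\<in>{..Suc n}. f (Suc n) k) =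
        f (Suc n) (Suc n) \<oplus> ((\<Oplus>k\<in>{..m}. f (Suc n) (Suc k)) \<oplus> f (Suc n) 0)"
    proof -
      have "(\<Oplus>k\<in>{..Suc n}. f (Suc n) k) = f (Suc n) (Suc n) \<oplus> (\<Oplus>k\<in>{..n}. f (Suc n) k)"
        by (rule finsum_Suc) (use fc in auto)
      also have "(\<Oplus>k\<in>{..n}. f (Suc n) k) = (\<Oplus>k\<in>{..m}. f (Suc n) (Suc k)) \<oplus> f (Suc n) 0"
        unfolding Suc by (rule finsum_Suc2) (use fc in auto)
      finally show ?thesis .
    qed
    ultimately show ?thesis
      unfolding mid last first using x y fc by (simp add: a_ac)
  qed
  finally show ?case by (simp add: f_def)
qed

text \<open>
  The binomial coefficients strictly between the ends are divisible by \<open>p\<close>.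
\<close>

lemma (in cring) freshmans_dream:
  assumes p: "normalization_semidom_class.prime p" "has_ring_char R p"
    and x: "x \<in> carrier R" and y: "y \<in> carrier R"
  shows "(x \<oplus> y) [^] p = x [^] p \<oplus> y [^] p"
proof -
  have p0: "p > 0" using p(1) prime_gt_0_nat by blast
  define f where "f k = add_pow R (p choose k) (x [^] k \<otimes> y [^] (p - k))" for k
  have fc: "f k \<in> carrier R" for k using x y by (simp add: f_def)
  have f0: "f k = \<zero>" if "k \<noteq> 0" "k \<noteq> p" "k \<le> p" for k
  proof -
    have "p dvd (p choose k)"
      by (rule dvd_choose_prime) (use that p(1) in auto)
    then have "add_pow R (p choose k) \<one> = \<zero>"
      using p(2) unfolding has_ring_char_def by blast
    moreover have "f k = add_pow R (p choose k) \<one> \<otimes> (x [^] k \<otimes> y [^] (p - k))"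
      using x y unfolding f_def by (simp add: add_pow_ldistr)
    ultimately show ?thesis using x y by simp
  qed
  have "(x \<oplus> y) [^] p = (\<Oplus>k\<in>{..p}. f k)"
    unfolding f_def by (rule binomial_theorem[OF x y])
  also have "\<dots> = (\<Oplus>k\<in>{0, p}. f k)"
    by (rule add.finprod_mono_neutral_cong_right) (use fc f0 in auto)
  also have "\<dots> = f 0 \<oplus> f p"
    using p0 fc by (subst finsum_insert) auto
  also have "\<dots> = x [^] p \<oplus> y [^] p"
    using x y by (simp add: f_def a_comm)
  finally show ?thesis .
qed

lemma (in cring) frobenius_add:
  assumes p: "normalization_semidom_class.prime p" "has_ring_char R p"
    and x: "x \<in> carrier R" and y: "y \<in> carrier R"
  shows "(x \<oplus> y) [^] (p ^ e) = x [^] (p ^ e) \<oplus> y [^] (p ^ e)"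
proof (induction e)
  case (Suc e)
  have "z [^] (p ^ Suc e) = (z [^] (p ^ e)) [^] p" if "z \<in> carrier R" for z
    using that by (simp add: nat_pow_pow mult.commute)
  then show ?case using Suc x y freshmans_dream[OF p] by simp
qed (use x y in simp)

section \<open>The total ring of fractions\<close>

lemma UN_pairs_const:
  assumes "x \<in> X" "y \<in> Y" "\<And>a s b t. (a, s) \<in> X \<Longrightarrow> (b, t) \<in> Y \<Longrightarrow> G a s b t = Z"
  shows "(\<Union>(a, s)\<in>X. \<Union>(b, t)\<in>Y. G a s b t) = Z"
proof (rule SUP_eq_const)
  show "X \<noteq> {}" using assms(1) by blast
  fix x assume "x \<in> X"
  then have "(\<Union>y\<in>Y. case x of (a, s) \<Rightarrow> case y of (b, t) \<Rightarrow> G a s b t) = Z"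
    using assms(2,3) by (intro SUP_eq_const) (auto split: prod.splits)
  then show "(case x of (a, s) \<Rightarrow> \<Union>(b, t)\<in>Y. G a s b t) = Z" by (simp add: case_prod_unfold)
qed

context cring
begin

lemma nonzerodivisor_closed: "s \<in> nonzerodivisors R \<Longrightarrow> s \<in> carrier R"
  by (simp add: nonzerodivisors_def)

lemma one_nonzerodivisor: "\<one> \<in> nonzerodivisors R"
  by (simp add: nonzerodivisors_def)

lemma mult_nonzerodivisors:
  "s \<in> nonzerodivisors R \<Longrightarrow> t \<in> nonzerodivisors R \<Longrightarrow> s \<otimes> t \<in> nonzerodivisors R"
  unfolding nonzerodivisors_def using m_assoc m_closed by (smt (verit) mem_Collect_eq)

lemma nonzerodivisor_cancel:
  assumes "s \<in> nonzerodivisors R" "a \<in> carrier R" "b \<in> carrier R" "s \<otimes> a = s \<otimes> b"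
  shows "a = b"
proof -
  have "s \<otimes> (a \<ominus> b) = \<zero>"
    using assms nonzerodivisor_closed[OF assms(1)] by (simp add: minus_eq r_distr r_minus r_neg)
  then have "a \<ominus> b = \<zero>" using assms unfolding nonzerodivisors_def by blast
  then show ?thesis using assms by simp
qed

lemma mem_fraction:
  "(b, t) \<in> fraction R a s \<longleftrightarrow> b \<in> carrier R \<and> t \<in> nonzerodivisors R \<and> a \<otimes> t = b \<otimes> s"
  by (simp add: fraction_def)

text \<open>
  Transitivity of the equality of fractions, which rests on cancelling the denominator \<open>s\<close>.
\<close>

lemma fraction_subset:
  assumes "a \<in> carrier R" "b \<in> carrier R" "s \<in> nonzerodivisors R" "t \<in> nonzerodivisors R"
    and eq: "a \<otimes> t = b \<otimes> s"
  shows "fraction R a s \<subseteq> fraction R b t"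
proof
  fix q assume "q \<in> fraction R a s"
  then obtain c w where q: "q = (c, w)" "c \<in> carrier R" "w \<in> nonzerodivisors R" "a \<otimes> w = c \<otimes> s"
    by (auto simp: fraction_def)
  note cl = assms(1,2) q(2) assms(3,4)[THEN nonzerodivisor_closed] q(3)[THEN nonzerodivisor_closed]
  have "s \<otimes> (b \<otimes> w) = (b \<otimes> s) \<otimes> w" using cl by (simp add: m_ac)
  also have "\<dots> = (a \<otimes> w) \<otimes> t" unfolding eq[symmetric] using cl by (simp add: m_ac)
  also have "\<dots> = s \<otimes> (c \<otimes> t)" unfolding q(4) using cl by (simp add: m_ac)
  finally have "b \<otimes> w = c \<otimes> t" by (rule nonzerodivisor_cancel[OF assms(3), rotated 2]) (use cl in auto)
  then show "q \<in> fraction R b t" using q by (simp add: mem_fraction)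
qed

lemma fraction_eq_iff:
  assumes "a \<in> carrier R" "b \<in> carrier R" "s \<in> nonzerodivisors R" "t \<in> nonzerodivisors R"
  shows "fraction R a s = fraction R b t \<longleftrightarrow> a \<otimes> t = b \<otimes> s"
proof
  assume "fraction R a s = fraction R b t"
  moreover have "(b, t) \<in> fraction R b t" using assms by (simp add: mem_fraction)
  ultimately have "(b, t) \<in> fraction R a s" by simp
  then show "a \<otimes> t = b \<otimes> s" by (simp add: mem_fraction)
next
  assume "a \<otimes> t = b \<otimes> s"
  then show "fraction R a s = fraction R b t"
    using fraction_subset[OF assms] fraction_subset[OF assms(2,1,4,3)] by auto
qed

lemma fraction_closed:
  "a \<in> carrier R \<Longrightarrow> s \<in> nonzerodivisors R \<Longrightarrow> fraction R a s \<in> carrier (total_fractions R)"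
  by (auto simp: total_fractions_def)

lemma fraction_cases:
  assumes "x \<in> carrier (total_fractions R)"
  obtains a s where "a \<in> carrier R" "s \<in> nonzerodivisors R" "x = fraction R a s"
  using assms by (auto simp: total_fractions_def)

lemma total_fractions_one: "\<one>\<^bsub>total_fractions R\<^esub> = fraction R \<one> \<one>"
  and total_fractions_zero: "\<zero>\<^bsub>total_fractions R\<^esub> = fraction R \<zero> \<one>"
  by (simp_all add: total_fractions_def)

text \<open>Sums and products of classes are unions over representatives; all members of the union agree.\<close>

lemma fraction_mult:
  assumes "a \<in> carrier R" "b \<in> carrier R" "s \<in> nonzerodivisors R" "t \<in> nonzerodivisors R"
  shows "fraction R a s \<otimes>\<^bsub>total_fractions R\<^esub> fraction R b t = fraction R (a \<otimes> b) (s \<otimes> t)"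
proof -
  have indep: "fraction R (a' \<otimes> b') (s' \<otimes> t') = fraction R (a \<otimes> b) (s \<otimes> t)"
    if "(a', s') \<in> fraction R a s" "(b', t') \<in> fraction R b t" for a' s' b' t'
  proof -
    have h: "a' \<in> carrier R" "s' \<in> nonzerodivisors R" "b' \<in> carrier R" "t' \<in> nonzerodivisors R"
      and e: "a \<otimes> s' = a' \<otimes> s" "b \<otimes> t' = b' \<otimes> t" using that by (auto simp: mem_fraction)
    note cl = assms(1,2) assms(3,4)[THEN nonzerodivisor_closed] h(1,3) h(2,4)[THEN nonzerodivisor_closed]
    have "a' \<otimes> b' \<otimes> (s \<otimes> t) = (a' \<otimes> s) \<otimes> (b' \<otimes> t)" using cl by (simp add: m_ac)
    also have "\<dots> = a \<otimes> b \<otimes> (s' \<otimes> t')" unfolding e[symmetric] using cl by (simp add: m_ac)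
    finally show ?thesis using assms h by (simp add: fraction_eq_iff mult_nonzerodivisors)
  qed
  have reps: "(a, s) \<in> fraction R a s" "(b, t) \<in> fraction R b t"
    using assms by (auto simp: mem_fraction)
  show ?thesis
    by (simp add: total_fractions_def) (rule UN_pairs_const[OF reps indep])
qed

lemma fraction_add:
  assumes "a \<in> carrier R" "b \<in> carrier R" "s \<in> nonzerodivisors R" "t \<in> nonzerodivisors R"
  shows "fraction R a s \<oplus>\<^bsub>total_fractions R\<^esub> fraction R b t = fraction R (a \<otimes> t \<oplus> b \<otimes> s) (s \<otimes> t)"
proof -
  have indep: "fraction R (a' \<otimes> t' \<oplus> b' \<otimes> s') (s' \<otimes> t') = fraction R (a \<otimes> t \<oplus> b \<otimes> s) (s \<otimes> t)"
    if "(a', s') \<in> fraction R a s" "(b', t') \<in> fraction R b t" for a' s' b' t'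
  proof -
    have h: "a' \<in> carrier R" "s' \<in> nonzerodivisors R" "b' \<in> carrier R" "t' \<in> nonzerodivisors R"
      and e: "a \<otimes> s' = a' \<otimes> s" "b \<otimes> t' = b' \<otimes> t" using that by (auto simp: mem_fraction)
    note cl = assms(1,2) assms(3,4)[THEN nonzerodivisor_closed] h(1,3) h(2,4)[THEN nonzerodivisor_closed]
    have "(a' \<otimes> t' \<oplus> b' \<otimes> s') \<otimes> (s \<otimes> t) = (a' \<otimes> s) \<otimes> (t \<otimes> t') \<oplus> (b' \<otimes> t) \<otimes> (s \<otimes> s')"
      using cl by (simp add: m_ac l_distr r_distr)
    also have "\<dots> = (a \<otimes> t \<oplus> b \<otimes> s) \<otimes> (s' \<otimes> t')"
      unfolding e[symmetric] using cl by (simp add: m_ac l_distr r_distr)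
    finally show ?thesis
      using assms h nonzerodivisor_closed by (simp add: fraction_eq_iff mult_nonzerodivisors)
  qed
  have reps: "(a, s) \<in> fraction R a s" "(b, t) \<in> fraction R b t"
    using assms by (auto simp: mem_fraction)
  show ?thesis
    by (simp add: total_fractions_def) (rule UN_pairs_const[OF reps indep])
qed

lemma cring_total_fractions: "cring (total_fractions R)"
proof (rule cringI)
  let ?K = "total_fractions R"
  note rules = fraction_mult fraction_add fraction_eq_iff mult_nonzerodivisors fraction_closed
    one_nonzerodivisor total_fractions_one total_fractions_zero
  show "abelian_group ?K"
  proof (rule abelian_groupI)
    fix x y assume "x \<in> carrier ?K" "y \<in> carrier ?K"
    then obtain a s b t where xy: "a \<in> carrier R" "s \<in> nonzerodivisors R" "x = fraction R a s"
      "b \<in> carrier R" "t \<in> nonzerodivisors R" "y = fraction R b t"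
      by (elim fraction_cases)
    then have cl: "s \<in> carrier R" "t \<in> carrier R" by (simp_all add: nonzerodivisor_closed)
    show "x \<oplus>\<^bsub>?K\<^esub> y \<in> carrier ?K" using xy cl by (simp add: rules)
    show "x \<oplus>\<^bsub>?K\<^esub> y = y \<oplus>\<^bsub>?K\<^esub> x" using xy cl by (simp add: rules m_ac a_ac)
    show "\<zero>\<^bsub>?K\<^esub> \<oplus>\<^bsub>?K\<^esub> x = x" using xy cl by (simp add: rules)
    show "\<exists>y\<in>carrier ?K. y \<oplus>\<^bsub>?K\<^esub> x = \<zero>\<^bsub>?K\<^esub>"
      by (rule bexI[of _ "fraction R (\<ominus> a) s"]) (use xy cl in \<open>simp_all add: rules l_minus l_neg\<close>)
    fix z assume "z \<in> carrier ?K"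
    then obtain c u where z: "c \<in> carrier R" "u \<in> nonzerodivisors R" "z = fraction R c u"
      by (elim fraction_cases)
    then have "u \<in> carrier R" by (simp add: nonzerodivisor_closed)
    then show "x \<oplus>\<^bsub>?K\<^esub> y \<oplus>\<^bsub>?K\<^esub> z = x \<oplus>\<^bsub>?K\<^esub> (y \<oplus>\<^bsub>?K\<^esub> z)"
      using xy z cl by (simp add: rules m_ac l_distr r_distr a_ac)
  qed (simp add: rules)
  show "comm_monoid ?K"
  proof (rule comm_monoidI)
    fix x y assume "x \<in> carrier ?K" "y \<in> carrier ?K"
    then obtain a s b t where xy: "a \<in> carrier R" "s \<in> nonzerodivisors R" "x = fraction R a s"
      "b \<in> carrier R" "t \<in> nonzerodivisors R" "y = fraction R b t"
      by (elim fraction_cases)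
    then have cl: "s \<in> carrier R" "t \<in> carrier R" by (simp_all add: nonzerodivisor_closed)
    show "x \<otimes>\<^bsub>?K\<^esub> y \<in> carrier ?K" using xy cl by (simp add: rules)
    show "x \<otimes>\<^bsub>?K\<^esub> y = y \<otimes>\<^bsub>?K\<^esub> x" using xy cl by (simp add: rules m_ac)
    show "\<one>\<^bsub>?K\<^esub> \<otimes>\<^bsub>?K\<^esub> x = x" using xy cl by (simp add: rules)
    fix z assume "z \<in> carrier ?K"
    then obtain c u where z: "c \<in> carrier R" "u \<in> nonzerodivisors R" "z = fraction R c u"
      by (elim fraction_cases)
    then have "u \<in> carrier R" by (simp add: nonzerodivisor_closed)
    then show "x \<otimes>\<^bsub>?K\<^esub> y \<otimes>\<^bsub>?K\<^esub> z = x \<otimes>\<^bsub>?K\<^esub> (y \<otimes>\<^bsub>?K\<^esub> z)"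
      using xy z cl by (simp add: rules m_ac)
  qed (simp add: rules)
  fix x y z assume "x \<in> carrier ?K" "y \<in> carrier ?K" "z \<in> carrier ?K"
  then obtain a s b t c u where xyz: "a \<in> carrier R" "s \<in> nonzerodivisors R" "x = fraction R a s"
    "b \<in> carrier R" "t \<in> nonzerodivisors R" "y = fraction R b t"
    "c \<in> carrier R" "u \<in> nonzerodivisors R" "z = fraction R c u"
    by (elim fraction_cases)
  then have cl: "s \<in> carrier R" "t \<in> carrier R" "u \<in> carrier R"
    by (simp_all add: nonzerodivisor_closed)
  show "(x \<oplus>\<^bsub>?K\<^esub> y) \<otimes>\<^bsub>?K\<^esub> z = x \<otimes>\<^bsub>?K\<^esub> z \<oplus>\<^bsub>?K\<^esub> y \<otimes>\<^bsub>?K\<^esub> z"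
    using xyz cl by (simp add: rules m_ac l_distr r_distr)
qed

lemma to_fractions_closed: "r \<in> carrier R \<Longrightarrow> to_fractions R r \<in> carrier (total_fractions R)"
  by (simp add: to_fractions_def fraction_closed one_nonzerodivisor)

lemma to_fractions_eq_iff:
  "a \<in> carrier R \<Longrightarrow> b \<in> carrier R \<Longrightarrow> to_fractions R a = to_fractions R b \<longleftrightarrow> a = b"
  by (simp add: to_fractions_def fraction_eq_iff one_nonzerodivisor)

lemma to_fractions_mult_fraction:
  "r \<in> carrier R \<Longrightarrow> a \<in> carrier R \<Longrightarrow> s \<in> nonzerodivisors R \<Longrightarrow>
   to_fractions R r \<otimes>\<^bsub>total_fractions R\<^esub> fraction R a s = fraction R (r \<otimes> a) s"
  by (simp add: to_fractions_def fraction_mult one_nonzerodivisor nonzerodivisor_closed)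

lemma to_fractions_ring_hom: "ring_hom_cring R (total_fractions R) (to_fractions R)"
proof -
  interpret K: cring "total_fractions R" by (rule cring_total_fractions)
  have "to_fractions R \<in> ring_hom R (total_fractions R)"
  proof (rule ring_hom_memI)
    fix x y assume xy: "x \<in> carrier R" "y \<in> carrier R"
    show "to_fractions R x \<in> carrier (total_fractions R)" using xy by (simp add: to_fractions_closed)
    show "to_fractions R (x \<otimes> y) = to_fractions R x \<otimes>\<^bsub>total_fractions R\<^esub> to_fractions R y"
      and "to_fractions R (x \<oplus> y) = to_fractions R x \<oplus>\<^bsub>total_fractions R\<^esub> to_fractions R y"
      using xy by (simp_all add: to_fractions_def fraction_mult fraction_add one_nonzerodivisor)
  qed (simp add: to_fractions_def total_fractions_one)
  then show ?thesis
    by (intro ring_hom_cringI is_cring K.is_cring)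
qed

lemma to_fractions_smult_cancel:
  assumes "c \<in> nonzerodivisors R" "x \<in> carrier (total_fractions R)" "y \<in> carrier (total_fractions R)"
    and "to_fractions R c \<otimes>\<^bsub>total_fractions R\<^esub> x = to_fractions R c \<otimes>\<^bsub>total_fractions R\<^esub> y"
  shows "x = y"
proof -
  obtain a s b t where x: "a \<in> carrier R" "s \<in> nonzerodivisors R" "x = fraction R a s"
    and y: "b \<in> carrier R" "t \<in> nonzerodivisors R" "y = fraction R b t"
    using assms(2,3) by (elim fraction_cases)
  note cl = x(1) y(1) x(2)[THEN nonzerodivisor_closed] y(2)[THEN nonzerodivisor_closed]
    assms(1)[THEN nonzerodivisor_closed]
  have "fraction R (c \<otimes> a) s = fraction R (c \<otimes> b) t"
    using assms(4) x y cl by (simp add: to_fractions_mult_fraction)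
  then have "c \<otimes> (a \<otimes> t) = c \<otimes> (b \<otimes> s)"
    using x y cl by (simp add: fraction_eq_iff m_assoc)
  then have "a \<otimes> t = b \<otimes> s" by (rule nonzerodivisor_cancel[OF assms(1), rotated 2]) (use cl in auto)
  then show ?thesis using x y by (simp add: fraction_eq_iff)
qed

end

lemma (in domain) nonzerodivisors_eq: "nonzerodivisors R = carrier R - {\<zero>}"
proof
  show "nonzerodivisors R \<subseteq> carrier R - {\<zero>}"
  proof
    fix s assume s: "s \<in> nonzerodivisors R"
    have "s \<noteq> \<zero>"
    proof
      assume "s = \<zero>"
      then have "s \<otimes> \<one> = \<zero>" by simp
      then show False using s one_closed one_not_zero unfolding nonzerodivisors_def by blast
    qed
    then show "s \<in> carrier R - {\<zero>}" using nonzerodivisor_closed[OF s] by simp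
  qed
  show "carrier R - {\<zero>} \<subseteq> nonzerodivisors R"
    using integral unfolding nonzerodivisors_def by blast
qed

section \<open>Linear maps and free modules\<close>

lemma (in cring) cring_idealI:
  assumes "J \<subseteq> carrier R" "\<zero> \<in> J" "\<And>x y. x \<in> J \<Longrightarrow> y \<in> J \<Longrightarrow> x \<oplus> y \<in> J"
    and sm: "\<And>r x. r \<in> carrier R \<Longrightarrow> x \<in> J \<Longrightarrow> r \<otimes> x \<in> J"
  shows "ideal J R"
proof (rule idealI)
  show "subgroup J (add_monoid R)"
  proof (rule group.subgroupI)
    show "group (add_monoid R)" by (rule a_group)
    fix x assume x: "x \<in> J"
    then have "(\<ominus> \<one>) \<otimes> x \<in> J" "x \<in> carrier R" using assms(1) sm[of "\<ominus> \<one>"] by auto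
    then show "inv\<^bsub>add_monoid R\<^esub> x \<in> J" by (simp add: a_inv_def[symmetric] l_minus)
  qed (use assms in auto)
  fix x r assume xr: "x \<in> J" "r \<in> carrier R"
  then show "r \<otimes> x \<in> J" by (rule sm[rotated])
  then show "x \<otimes> r \<in> J" using xr assms(1) by (simp add: m_comm subset_iff)
qed (rule ring_axioms)

lemma (in module) submoduleI_smult:
  assumes "H \<subseteq> carrier M" "\<zero>\<^bsub>M\<^esub> \<in> H"
    and "\<And>x y. x \<in> H \<Longrightarrow> y \<in> H \<Longrightarrow> x \<oplus>\<^bsub>M\<^esub> y \<in> H"
    and smult: "\<And>r x. r \<in> carrier R \<Longrightarrow> x \<in> H \<Longrightarrow> r \<odot>\<^bsub>M\<^esub> x \<in> H"
  shows "submodule H R M"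
proof (rule submoduleI)
  fix x assume x: "x \<in> H"
  then have "(\<ominus> \<one>) \<odot>\<^bsub>M\<^esub> x = \<ominus>\<^bsub>M\<^esub> x"
    using smult_l_minus[OF R.one_closed, of x] smult_one[of x] assms(1) by auto
  then show "\<ominus>\<^bsub>M\<^esub> x \<in> H" using smult[of "\<ominus> \<one>" x] x by simp
qed (use assms in auto)

lemma (in module) submodule_zero: "submodule H R M \<Longrightarrow> \<zero>\<^bsub>M\<^esub> \<in> H"
  using subgroup.one_closed[of H "add_monoid M"] by (simp add: submodule_def)

text \<open>Unlike \<open>Hom_mod\<close>, this does not prescribe values outside the carrier.\<close>

definition linear_map ::
    "('a, 'b) ring_scheme \<Rightarrow> ('a, 'm, 'c) module_scheme \<Rightarrow> ('a, 'n, 'd) module_scheme \<Rightarrow> ('m \<Rightarrow> 'n) \<Rightarrow> bool"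
  where "linear_map R M N f \<longleftrightarrow>
    (\<forall>x\<in>carrier M. f x \<in> carrier N) \<and>
    (\<forall>x\<in>carrier M. \<forall>y\<in>carrier M. f (x \<oplus>\<^bsub>M\<^esub> y) = f x \<oplus>\<^bsub>N\<^esub> f y) \<and>
    (\<forall>r\<in>carrier R. \<forall>x\<in>carrier M. f (r \<odot>\<^bsub>M\<^esub> x) = r \<odot>\<^bsub>N\<^esub> f x)"

lemma linear_mapD:
  assumes "linear_map R M N f"
  shows "x \<in> carrier M \<Longrightarrow> f x \<in> carrier N"
    and "x \<in> carrier M \<Longrightarrow> y \<in> carrier M \<Longrightarrow> f (x \<oplus>\<^bsub>M\<^esub> y) = f x \<oplus>\<^bsub>N\<^esub> f y"
    and "r \<in> carrier R \<Longrightarrow> x \<in> carrier M \<Longrightarrow> f (r \<odot>\<^bsub>M\<^esub> x) = r \<odot>\<^bsub>N\<^esub> f x"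
  using assms by (auto simp: linear_map_def)

lemma linear_map_comp:
  "linear_map R M N f \<Longrightarrow> linear_map R N P g \<Longrightarrow> linear_map R M P (\<lambda>x. g (f x))"
  by (simp add: linear_map_def)

lemma Hom_mod_linear_map: "\<phi> \<in> Hom_mod R M N \<Longrightarrow> linear_map R M N \<phi>"
  by (auto simp: Hom_mod_def linear_map_def)

lemma linear_map_restrict_Hom:
  assumes "module R M" "linear_map R M N f"
  shows "(\<lambda>x\<in>carrier M. f x) \<in> Hom_mod R M N"
proof -
  interpret module R M by fact
  show ?thesis using assms(2) by (auto simp: Hom_mod_def linear_map_def)
qed

lemma linear_map_zero:
  assumes "linear_map R M N f" "module R M" "module R N"
  shows "f \<zero>\<^bsub>M\<^esub> = \<zero>\<^bsub>N\<^esub>"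
proof -
  interpret M: module R M by fact
  interpret N: module R N by fact
  have "f (\<zero>\<^bsub>R\<^esub> \<odot>\<^bsub>M\<^esub> \<zero>\<^bsub>M\<^esub>) = \<zero>\<^bsub>R\<^esub> \<odot>\<^bsub>N\<^esub> f \<zero>\<^bsub>M\<^esub>"
    by (rule linear_mapD(3)[OF assms(1)]) auto
  then show ?thesis using linear_mapD(1)[OF assms(1) M.zero_closed] by simp
qed

lemma linear_map_minus:
  assumes "linear_map R M N f" "module R M" "module R N" "x \<in> carrier M"
  shows "f (\<ominus>\<^bsub>M\<^esub> x) = \<ominus>\<^bsub>N\<^esub> f x"
proof -
  interpret M: module R M by fact
  interpret N: module R N by fact
  have "f ((\<ominus>\<^bsub>R\<^esub> \<one>\<^bsub>R\<^esub>) \<odot>\<^bsub>M\<^esub> x) = (\<ominus>\<^bsub>R\<^esub> \<one>\<^bsub>R\<^esub>) \<odot>\<^bsub>N\<^esub> f x"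
    by (rule linear_mapD(3)[OF assms(1)]) (use assms(4) in auto)
  then show ?thesis using linear_mapD(1)[OF assms(1,4)] assms(4)
    by (simp add: M.smult_l_minus N.smult_l_minus)
qed

lemma linear_map_kernel_submodule:
  assumes "linear_map R M N f" "module R M" "module R N"
  shows "submodule {x \<in> carrier M. f x = \<zero>\<^bsub>N\<^esub>} R M"
proof -
  interpret M: module R M by fact
  interpret N: module R N by fact
  show ?thesis
    by (rule M.submoduleI_smult)
       (auto simp: linear_map_zero[OF assms] linear_mapD[OF assms(1)])
qed

lemma linear_map_image_submodule:
  assumes "linear_map R M N f" "module R M" "module R N"
  shows "submodule (f ` carrier M) R N"
proof -
  interpret M: module R M by fact
  interpret N: module R N by fact
  show ?thesis
  proof (rule N.submoduleI)
    show "f ` carrier M \<subseteq> carrier N" using linear_mapD(1)[OF assms(1)] by auto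
    show "\<zero>\<^bsub>N\<^esub> \<in> f ` carrier M"
      by (simp flip: linear_map_zero[OF assms])
    show "\<ominus>\<^bsub>N\<^esub> y \<in> f ` carrier M" if "y \<in> f ` carrier M" for y
      using that by (auto simp flip: linear_map_minus[OF assms])
    show "y \<oplus>\<^bsub>N\<^esub> y' \<in> f ` carrier M" if "y \<in> f ` carrier M" "y' \<in> f ` carrier M" for y y'
      using that by (auto simp flip: linear_mapD(2)[OF assms(1)])
    show "r \<odot>\<^bsub>N\<^esub> y \<in> f ` carrier M" if "r \<in> carrier R" "y \<in> f ` carrier M" for r y
      using that by (auto simp flip: linear_mapD(3)[OF assms(1)])
  qed
qed

text \<open>
  The homomorphism theorem. It constructs maps on a module given by generators, where \<open>q\<close> sends a
  coefficient vector to the element it represents; the kernel condition is well-definedness.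
\<close>

lemma linear_map_factor:
  assumes q: "linear_map R M N q" "carrier N = q ` carrier M"
    and f: "linear_map R M P f"
    and M: "module R M" and N: "module R N" and P: "module R P"
    and ker: "\<And>x. x \<in> carrier M \<Longrightarrow> q x = \<zero>\<^bsub>N\<^esub> \<Longrightarrow> f x = \<zero>\<^bsub>P\<^esub>"
  obtains g where "g \<in> Hom_mod R N P" "\<And>x. x \<in> carrier M \<Longrightarrow> g (q x) = f x"
proof -
  interpret M: module R M by fact
  interpret N: module R N by fact
  interpret P: module R P by fact
  define g where "g = (\<lambda>y\<in>carrier N. f (SOME x. x \<in> carrier M \<and> q x = y))"
  have fq: "f x = f x'" if x: "x \<in> carrier M" "x' \<in> carrier M" and "q x = q x'" for x x'
  proof -
    note cl = x linear_mapD(1)[OF q(1) x(2)] linear_mapD(1)[OF f x(1)] linear_mapD(1)[OF f x(2)]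
    have "q (x \<oplus>\<^bsub>M\<^esub> \<ominus>\<^bsub>M\<^esub> x') = \<zero>\<^bsub>N\<^esub>"
      using cl that(3) by (simp add: linear_mapD(2)[OF q(1)] linear_map_minus[OF q(1) M N] N.r_neg)
    then have "f x \<oplus>\<^bsub>P\<^esub> \<ominus>\<^bsub>P\<^esub> f x' = \<zero>\<^bsub>P\<^esub>"
      using ker[of "x \<oplus>\<^bsub>M\<^esub> \<ominus>\<^bsub>M\<^esub> x'"] cl
      by (simp add: linear_mapD(2)[OF f] linear_map_minus[OF f M P])
    then show ?thesis using cl by (metis P.minus_equality P.minus_minus P.a_inv_closed)
  qed
  have gq: "g (q x) = f x" if x: "x \<in> carrier M" for x
  proof -
    have "(SOME x'. x' \<in> carrier M \<and> q x' = q x) \<in> carrier M \<and>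
        q (SOME x'. x' \<in> carrier M \<and> q x' = q x) = q x"
      by (rule someI[of _ x]) (use x in simp)
    then show ?thesis using fq[OF _ x] linear_mapD(1)[OF q(1) x] by (simp add: g_def)
  qed
  have "g \<in> Hom_mod R N P"
    unfolding Hom_mod_def
  proof (intro CollectI conjI ballI)
    show "g \<in> carrier N \<rightarrow>\<^sub>E carrier P"
    proof (rule PiE_I)
      show "g y \<in> carrier P" if "y \<in> carrier N" for y
        using that q(2) gq linear_mapD(1)[OF f] by auto
    qed (simp add: g_def)
    fix y y' assume "y \<in> carrier N" "y' \<in> carrier N"
    then obtain x x' where x: "x \<in> carrier M" "x' \<in> carrier M" "y = q x" "y' = q x'"
      using q(2) by blast
    then show "g (y \<oplus>\<^bsub>N\<^esub> y') = g y \<oplus>\<^bsub>P\<^esub> g y'"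
      using gq[of "x \<oplus>\<^bsub>M\<^esub> x'"] gq by (simp add: linear_mapD[OF q(1)] linear_mapD[OF f])
  next
    fix r y assume r: "r \<in> carrier R" "y \<in> carrier N"
    then obtain x where x: "x \<in> carrier M" "y = q x" using q(2) by blast
    then show "g (r \<odot>\<^bsub>N\<^esub> y) = r \<odot>\<^bsub>P\<^esub> g y"
      using gq[of "r \<odot>\<^bsub>M\<^esub> x"] gq r by (simp add: linear_mapD[OF q(1)] linear_mapD[OF f])
  qed
  then show thesis using gq that by blast
qed

text \<open>
  Vectors are extensional, so that two vectors with the same entries are equal.
\<close>

definition free_module :: "('a, 'b) ring_scheme \<Rightarrow> 't set \<Rightarrow> ('a, 't \<Rightarrow> 'a) module"
  where "free_module R T =
    \<lparr>carrier = T \<rightarrow>\<^sub>E carrier R, monoid.mult = undefined, one = undefined,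
     ring.zero = (\<lambda>_\<in>T. \<zero>\<^bsub>R\<^esub>), add = (\<lambda>f g. \<lambda>t\<in>T. f t \<oplus>\<^bsub>R\<^esub> g t), smult = (\<lambda>r f. \<lambda>t\<in>T. r \<otimes>\<^bsub>R\<^esub> f t)\<rparr>"

lemma free_module_simps [simp]:
  "carrier (free_module R T) = T \<rightarrow>\<^sub>E carrier R"
  "\<zero>\<^bsub>free_module R T\<^esub> = (\<lambda>_\<in>T. \<zero>\<^bsub>R\<^esub>)"
  "f \<oplus>\<^bsub>free_module R T\<^esub> g = (\<lambda>t\<in>T. f t \<oplus>\<^bsub>R\<^esub> g t)"
  "r \<odot>\<^bsub>free_module R T\<^esub> f = (\<lambda>t\<in>T. r \<otimes>\<^bsub>R\<^esub> f t)"
  by (simp_all add: free_module_def)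

lemma module_free_module:
  assumes "cring R" shows "module R (free_module R T)"
proof -
  interpret cring R by fact
  have "abelian_group (free_module R T)"
  proof (rule abelian_groupI)
    fix f assume f: "f \<in> carrier (free_module R T)"
    show "\<exists>g\<in>carrier (free_module R T). g \<oplus>\<^bsub>free_module R T\<^esub> f = \<zero>\<^bsub>free_module R T\<^esub>"
      by (rule bexI[of _ "\<lambda>t\<in>T. \<ominus>\<^bsub>R\<^esub> f t"]) (use f in \<open>auto simp: l_neg PiE_iff fun_eq_iff\<close>)
  qed (auto simp: PiE_iff a_ac fun_eq_iff extensional_def)
  then show ?thesis
    by (intro moduleI is_cring) (auto simp: PiE_iff m_assoc l_distr r_distr fun_eq_iff extensional_def)
qed

lemma linear_map_combination:
  assumes "module R M" "finite S" "g \<in> S \<rightarrow> carrier M"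
  shows "linear_map R (free_module R S) M (\<lambda>c. \<Oplus>\<^bsub>M\<^esub>s\<in>S. c s \<odot>\<^bsub>M\<^esub> g s)"
proof -
  interpret module R M by fact
  have cl: "(\<lambda>s. c s \<odot>\<^bsub>M\<^esub> g s) \<in> S \<rightarrow> carrier M" if "c \<in> S \<rightarrow>\<^sub>E carrier R" for c
    using that assms(3) by (auto simp: PiE_iff Pi_iff)
  show ?thesis
    unfolding linear_map_def
  proof (intro conjI ballI)
    fix c assume "c \<in> carrier (free_module R S)"
    then have c: "c \<in> S \<rightarrow>\<^sub>E carrier R" by simp
    show "(\<Oplus>\<^bsub>M\<^esub>s\<in>S. c s \<odot>\<^bsub>M\<^esub> g s) \<in> carrier M"
      by (rule M.finsum_closed[OF cl[OF c]])
    fix d assume "d \<in> carrier (free_module R S)"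
    then have d: "d \<in> S \<rightarrow>\<^sub>E carrier R" by simp
    have "(\<Oplus>\<^bsub>M\<^esub>s\<in>S. (c \<oplus>\<^bsub>free_module R S\<^esub> d) s \<odot>\<^bsub>M\<^esub> g s) = (\<Oplus>\<^bsub>M\<^esub>s\<in>S. c s \<odot>\<^bsub>M\<^esub> g s \<oplus>\<^bsub>M\<^esub> d s \<odot>\<^bsub>M\<^esub> g s)"
      by (rule M.finsum_cong') (use cl[OF c] cl[OF d] c d assms(3) in \<open>auto simp: PiE_iff Pi_iff smult_l_distr\<close>)
    then show "(\<Oplus>\<^bsub>M\<^esub>s\<in>S. (c \<oplus>\<^bsub>free_module R S\<^esub> d) s \<odot>\<^bsub>M\<^esub> g s) =
        (\<Oplus>\<^bsub>M\<^esub>s\<in>S. c s \<odot>\<^bsub>M\<^esub> g s) \<oplus>\<^bsub>M\<^esub> (\<Oplus>\<^bsub>M\<^esub>s\<in>S. d s \<odot>\<^bsub>M\<^esub> g s)"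
      using M.finsum_addf[OF cl[OF c] cl[OF d]] by simp
  next
    fix r c assume r: "r \<in> carrier R" and "c \<in> carrier (free_module R S)"
    then have c: "c \<in> S \<rightarrow>\<^sub>E carrier R" by simp
    have "r \<odot>\<^bsub>M\<^esub> (\<Oplus>\<^bsub>M\<^esub>s\<in>S. c s \<odot>\<^bsub>M\<^esub> g s) = (\<Oplus>\<^bsub>M\<^esub>s\<in>S. r \<odot>\<^bsub>M\<^esub> (c s \<odot>\<^bsub>M\<^esub> g s))"
      using cl[OF c] r assms(2) by (intro finsum_smult_ldistr) auto
    also have "\<dots> = (\<Oplus>\<^bsub>M\<^esub>s\<in>S. (r \<odot>\<^bsub>free_module R S\<^esub> c) s \<odot>\<^bsub>M\<^esub> g s)"
      by (rule M.finsum_cong') (use r c assms(3) in \<open>auto simp: PiE_iff Pi_iff smult_assoc1\<close>)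
    finally show "(\<Oplus>\<^bsub>M\<^esub>s\<in>S. (r \<odot>\<^bsub>free_module R S\<^esub> c) s \<odot>\<^bsub>M\<^esub> g s) =
        r \<odot>\<^bsub>M\<^esub> (\<Oplus>\<^bsub>M\<^esub>s\<in>S. c s \<odot>\<^bsub>M\<^esub> g s)" by simp
  qed
qed

lemma linear_map_into_free_module:
  assumes "\<And>t. t \<in> T \<Longrightarrow> linear_map R M (self_module R) (\<lambda>x. F x t)"
  shows "linear_map R M (free_module R T) (\<lambda>x. \<lambda>t\<in>T. F x t)"
  using assms unfolding linear_map_def ring_module_def by (auto intro!: restrict_ext)

lemma linear_map_scale:
  assumes "module R M" "z \<in> carrier M"
  shows "linear_map R (self_module R) M (\<lambda>r. r \<odot>\<^bsub>M\<^esub> z)"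
proof -
  interpret module R M by fact
  show ?thesis using assms(2) by (simp add: linear_map_def ring_module_def smult_l_distr smult_assoc1)
qed

definition unit_vector :: "('a, 'b) ring_scheme \<Rightarrow> 't set \<Rightarrow> 't \<Rightarrow> 't \<Rightarrow> 'a"
  where "unit_vector R T s = (\<lambda>t\<in>T. if s = t then \<one>\<^bsub>R\<^esub> else \<zero>\<^bsub>R\<^esub>)"

lemma combination_unit_vector:
  assumes "module R M" "finite S" "g \<in> S \<rightarrow> carrier M" "s0 \<in> S"
  shows "(\<Oplus>\<^bsub>M\<^esub>s\<in>S. unit_vector R S s0 s \<odot>\<^bsub>M\<^esub> g s) = g s0"
proof -
  interpret module R M by fact
  have "(\<Oplus>\<^bsub>M\<^esub>s\<in>S. unit_vector R S s0 s \<odot>\<^bsub>M\<^esub> g s) = (\<Oplus>\<^bsub>M\<^esub>s\<in>S. if s0 = s then g s else \<zero>\<^bsub>M\<^esub>)"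
    by (rule M.finsum_cong') (use assms(3) in \<open>auto simp: unit_vector_def Pi_iff\<close>)
  also have "\<dots> = g s0" by (rule M.finsum_singleton) (use assms in auto)
  finally show ?thesis .
qed

lemma (in cring) unit_vector_closed: "unit_vector R T s \<in> T \<rightarrow>\<^sub>E carrier R"
  by (simp add: unit_vector_def)

text \<open>
  By induction on the support of \<open>b\<close>, both sides being linear and equal on unit vectors.
\<close>

lemma linear_map_free_module:
  assumes M: "module R M" and T: "finite T" and f: "linear_map R (free_module R T) M f"
    and b: "b \<in> T \<rightarrow>\<^sub>E carrier R"
  shows "f b = (\<Oplus>\<^bsub>M\<^esub>t\<in>T. b t \<odot>\<^bsub>M\<^esub> f (unit_vector R T t))"
proof -
  interpret M: module R M by fact
  interpret F: module R "free_module R T" by (rule module_free_module[OF M.R.is_cring])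
  have fu: "(\<lambda>t. f (unit_vector R T t)) \<in> T \<rightarrow> carrier M"
    using linear_mapD(1)[OF f] by (auto simp: M.R.unit_vector_closed)
  define h where "h b = (\<Oplus>\<^bsub>M\<^esub>t\<in>T. b t \<odot>\<^bsub>M\<^esub> f (unit_vector R T t))" for b
  have h: "linear_map R (free_module R T) M h"
    unfolding h_def by (rule linear_map_combination[OF M T fu])
  have "f b = h b" if "finite S" "S \<subseteq> T" "b \<in> T \<rightarrow>\<^sub>E carrier R" "\<And>t. t \<in> T - S \<Longrightarrow> b t = \<zero>\<^bsub>R\<^esub>" for S b
    using that
  proof (induction S arbitrary: b)
    case empty
    then have "b = \<zero>\<^bsub>free_module R T\<^esub>" by (auto simp: PiE_iff fun_eq_iff extensional_def)
    then show ?case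
      using linear_map_zero[OF f F.module_axioms M] linear_map_zero[OF h F.module_axioms M] by metis
  next
    case (insert s S)
    define b' where "b' = (\<lambda>t\<in>T. if t = s then \<zero>\<^bsub>R\<^esub> else b t)"
    have s: "s \<in> T" "b s \<in> carrier R" using insert.prems by (auto simp: PiE_iff)
    have b': "b' \<in> T \<rightarrow>\<^sub>E carrier R" using insert.prems by (auto simp: b'_def PiE_iff)
    have "b = b' \<oplus>\<^bsub>free_module R T\<^esub> (b s \<odot>\<^bsub>free_module R T\<^esub> unit_vector R T s)"
      using insert.prems s by (auto simp: b'_def unit_vector_def PiE_iff fun_eq_iff extensional_def)
    moreover have "f b' = h b'"
      by (rule insert.IH) (use insert.prems insert.hyps b' in \<open>auto simp: b'_def\<close>)
    moreover have "f (unit_vector R T s) = h (unit_vector R T s)"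
      unfolding h_def using combination_unit_vector[OF M T fu s(1)] by simp
    moreover have "b' \<in> carrier (free_module R T)" "unit_vector R T s \<in> carrier (free_module R T)"
      "b s \<odot>\<^bsub>free_module R T\<^esub> unit_vector R T s \<in> carrier (free_module R T)"
      using b' F.smult_closed[OF s(2), of "unit_vector R T s"] by (auto simp: M.R.unit_vector_closed)
    ultimately show ?case using s(2) linear_mapD(2,3)[OF f] linear_mapD(2,3)[OF h] by metis
  qed
  from this[OF T order_refl b] show ?thesis by (simp add: h_def)
qed

section \<open>Noetherian modules\<close>

text \<open>
  The ascending chain condition in the form of a maximum principle.
\<close>

lemma (in noetherian_ring) exists_maximal_ideal_in:
  assumes "\<J> \<noteq> {}" and "\<And>J. J \<in> \<J> \<Longrightarrow> ideal J R"
  obtains J where "J \<in> \<J>" "\<And>K. K \<in> \<J> \<Longrightarrow> J \<subseteq> K \<Longrightarrow> K = J"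
proof -
  have "\<exists>J\<in>\<J>. \<forall>K\<in>\<J>. J \<subseteq> K \<longrightarrow> K = J"
  proof (rule subset_Zorn_nonempty[OF assms(1)])
    fix \<C> assume C: "\<C> \<noteq> {}" "subset.chain \<J> \<C>"
    then have "subset.chain {I. ideal I R} \<C>"
      using assms(2) unfolding subset_chain_def by blast
    then have "\<Union>\<C> \<in> \<C>" by (rule ideal_chain_is_trivial[OF C(1)])
    then show "\<Union>\<C> \<in> \<J>" using C(2) unfolding subset_chain_def by blast
  qed
  then show thesis using that by blast
qed

lemma (in noetherian_ring) exists_maximalideal_above:
  assumes "ideal J R" "J \<noteq> carrier R"
  obtains \<mm> where "maximalideal \<mm> R" "J \<subseteq> \<mm>"
proof -
  let ?F = "{K. ideal K R \<and> J \<subseteq> K \<and> K \<noteq> carrier R}"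
  obtain M where M: "M \<in> ?F" "\<And>K. K \<in> ?F \<Longrightarrow> M \<subseteq> K \<Longrightarrow> K = M"
    by (rule exists_maximal_ideal_in[of ?F]) (use assms in auto)
  have "maximalideal M R"
  proof (rule maximalidealI)
    fix K assume "ideal K R" "M \<subseteq> K" "K \<subseteq> carrier R"
    then show "K = M \<or> K = carrier R" using M by blast
  qed (use M in auto)
  then show thesis using M that by blast
qed

text \<open>
  Generation is expressed by minimality among submodules, so that no linear combinations have to
  be manipulated when generating sets are transferred between modules.
\<close>

definition submodule_generated_by ::
    "('a, 'b) ring_scheme \<Rightarrow> ('a, 'm, 'c) module_scheme \<Rightarrow> 'm set \<Rightarrow> 'm set \<Rightarrow> bool"
  where "submodule_generated_by R M G L \<longleftrightarrow>
    G \<subseteq> L \<and> (\<forall>H. submodule H R M \<and> G \<subseteq> H \<longrightarrow> L \<subseteq> H)"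

lemma (in module) submodule_finsum:
  assumes H: "submodule H R M" and "finite S" and f: "\<And>s. s \<in> S \<Longrightarrow> f s \<in> H"
  shows "(\<Oplus>\<^bsub>M\<^esub>s\<in>S. f s) \<in> H"
  using assms(2) f
proof (induction S)
  case empty
  show ?case using submodule_zero[OF H] by simp
next
  case (insert x F)
  have "f \<in> F \<rightarrow> carrier M" "f x \<in> carrier M" using insert.prems submoduleE(1)[OF H] by blast+
  then show ?case
    using insert submoduleE(5)[OF H] by (simp add: finsum_insert)
qed

lemma (in module) generated_linear_combination:
  assumes S: "submodule_generated_by R M S (carrier M)" "finite S" and x: "x \<in> carrier M"
  obtains c where "c \<in> S \<rightarrow>\<^sub>E carrier R" "x = (\<Oplus>\<^bsub>M\<^esub>s\<in>S. c s \<odot>\<^bsub>M\<^esub> s)"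
proof -
  let ?q = "\<lambda>c. \<Oplus>\<^bsub>M\<^esub>s\<in>S. c s \<odot>\<^bsub>M\<^esub> s" and ?F = "free_module R S"
  have SM: "(\<lambda>s. s) \<in> S \<rightarrow> carrier M" using S(1) by (auto simp: submodule_generated_by_def)
  define H where "H = ?q ` carrier ?F"
  have "submodule H R M"
    unfolding H_def
    by (rule linear_map_image_submodule[OF linear_map_combination[OF module_axioms S(2) SM]
          module_free_module[OF R.is_cring] module_axioms])
  moreover have "S \<subseteq> H"
  proof
    fix s assume "s \<in> S"
    then have q: "?q (unit_vector R S s) = s" by (rule combination_unit_vector[OF module_axioms S(2) SM])
    have u: "unit_vector R S s \<in> carrier ?F" by (simp add: R.unit_vector_closed)
    show "s \<in> H" using imageI[OF u, of ?q] unfolding q H_def .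
  qed
  ultimately have "x \<in> H" using S(1) x unfolding submodule_generated_by_def by blast
  then obtain c where "c \<in> carrier ?F" "x = ?q c" unfolding H_def by (rule imageE)
  then show thesis using that[of c] by simp
qed

lemma (in module) fin_gen_module_generated:
  "fin_gen_module R M \<longleftrightarrow> (\<exists>S. finite S \<and> submodule_generated_by R M S (carrier M))"
proof
  assume "fin_gen_module R M"
  then obtain S where S: "S \<subseteq> carrier M" "finite S"
    "\<And>x. x \<in> carrier M \<Longrightarrow> \<exists>c\<in>S \<rightarrow> carrier R. x = (\<Oplus>\<^bsub>M\<^esub>s\<in>S. c s \<odot>\<^bsub>M\<^esub> s)"
    unfolding fin_gen_module_def by blast
  have "x \<in> H" if H: "submodule H R M" "S \<subseteq> H" and x: "x \<in> carrier M" for H x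
  proof -
    obtain c where c: "c \<in> S \<rightarrow> carrier R" "x = (\<Oplus>\<^bsub>M\<^esub>s\<in>S. c s \<odot>\<^bsub>M\<^esub> s)" using S(3)[OF x] by blast
    show ?thesis unfolding c(2)
      by (rule submodule_finsum[OF H(1) S(2)]) (use c(1) H submoduleE(4)[OF H(1)] in auto)
  qed
  then show "\<exists>S. finite S \<and> submodule_generated_by R M S (carrier M)"
    using S unfolding submodule_generated_by_def by blast
next
  assume "\<exists>S. finite S \<and> submodule_generated_by R M S (carrier M)"
  then obtain S where S: "finite S" "submodule_generated_by R M S (carrier M)" by blast
  have "\<exists>c\<in>S \<rightarrow> carrier R. x = (\<Oplus>\<^bsub>M\<^esub>s\<in>S. c s \<odot>\<^bsub>M\<^esub> s)" if x: "x \<in> carrier M" for x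
    by (rule generated_linear_combination[OF S(2,1) x]) (auto simp: PiE_iff)
  moreover have "S \<subseteq> carrier M" using S(2) by (simp add: submodule_generated_by_def)
  ultimately show "fin_gen_module R M" using S(1) unfolding fin_gen_module_def by blast
qed

lemma (in module) submodule_image_ideal:
  assumes H: "submodule H R M"
    and add: "\<And>x y. x \<in> H \<Longrightarrow> y \<in> H \<Longrightarrow> l (x \<oplus>\<^bsub>M\<^esub> y) = l x \<oplus> l y"
    and smult: "\<And>r x. r \<in> carrier R \<Longrightarrow> x \<in> H \<Longrightarrow> l (r \<odot>\<^bsub>M\<^esub> x) = r \<otimes> l x"
    and closed: "\<And>x. x \<in> H \<Longrightarrow> l x \<in> carrier R"
  shows "ideal (l ` H) R"
proof (rule R.cring_idealI)
  show "\<zero> \<in> l ` H"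
  proof -
    have z: "\<zero>\<^bsub>M\<^esub> \<in> H" by (rule submodule_zero[OF H])
    then have "l \<zero>\<^bsub>M\<^esub> = \<zero> \<otimes> l \<zero>\<^bsub>M\<^esub>" using smult[OF R.zero_closed z] by simp
    then have "l \<zero>\<^bsub>M\<^esub> = \<zero>" using closed[OF z] by simp
    then show ?thesis using z by force
  qed
  show "r \<otimes> y \<in> l ` H" if "r \<in> carrier R" "y \<in> l ` H" for r y
    using that submoduleE(4)[OF H] by (auto simp: smult[symmetric])
  show "y \<oplus> z \<in> l ` H" if "y \<in> l ` H" "z \<in> l ` H" for y z
    using that submoduleE(5)[OF H] by (auto simp: add[symmetric])
qed (use closed in auto)

lemma (in module) submodule_Int:
  assumes "submodule H R M" "submodule L R M" shows "submodule (H \<inter> L) R M"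
  using assms[THEN submodule_zero] assms[THEN submoduleE(1)] submoduleE(3-5)[OF assms(1)]
    submoduleE(3-5)[OF assms(2)]
  by (intro submoduleI) auto

text \<open>
  By induction on the support \<open>S\<close>: the values at \<open>s\<close> of the members of \<open>L\<close> form a finitely generated ideal, and the
  members that vanish at \<open>s\<close> are covered by the induction hypothesis. The ambient index set \<open>T\<close> stays
  fixed, so that all submodules involved live in one module.
\<close>

lemma free_module_submodule_generated:
  assumes R: "cring R" "noetherian_ring R"
    and "finite S" "S \<subseteq> T"
    and "submodule L R (free_module R T)" "\<And>f t. f \<in> L \<Longrightarrow> t \<in> T - S \<Longrightarrow> f t = \<zero>\<^bsub>R\<^esub>"
  shows "\<exists>G. finite G \<and> submodule_generated_by R (free_module R T) G L"
  using assms(3-)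
proof (induction S arbitrary: L)
  case empty
  interpret F: module R "free_module R T" by (rule module_free_module[OF R(1)])
  have "L \<subseteq> {\<zero>\<^bsub>free_module R T\<^esub>}"
  proof
    fix f assume f: "f \<in> L"
    have "f \<in> T \<rightarrow>\<^sub>E carrier R" using F.submoduleE(1)[OF empty.prems(2)] f by auto
    then show "f \<in> {\<zero>\<^bsub>free_module R T\<^esub>}"
      using empty.prems(3)[OF f] by (auto simp: PiE_iff fun_eq_iff extensional_def)
  qed
  then have "submodule_generated_by R (free_module R T) {} L"
    using F.submodule_zero unfolding submodule_generated_by_def by auto
  then show ?case by blast
next
  case (insert s S)
  let ?F = "free_module R T"
  interpret F: module R ?F by (rule module_free_module[OF R(1)])
  note L = insert.prems(2)
  have LF: "f \<in> T \<rightarrow>\<^sub>E carrier R" if "f \<in> L" for f using F.submoduleE(1)[OF L] that by auto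
  have sT: "s \<in> T" using insert.prems(1) by simp
  have val: "ideal ((\<lambda>f. f s) ` H) R" if H: "submodule H R ?F" for H
  proof (rule F.submodule_image_ideal[OF H])
    show "f s \<in> carrier R" if "f \<in> H" for f
      using F.submoduleE(1)[OF H] that sT by (auto simp: PiE_iff)
  qed (use sT in simp_all)
  obtain A where A: "A \<subseteq> carrier R" "finite A" "(\<lambda>f. f s) ` L = genideal R A"
    using noetherian_ring.finetely_gen[OF R(2) val[OF L]] by blast
  have AL: "A \<subseteq> (\<lambda>f. f s) ` L" unfolding A(3) by (rule F.R.genideal_self[OF A(1)])
  obtain B where B: "B \<subseteq> L" "finite B" "A = (\<lambda>f. f s) ` B"
    using finite_subset_image[OF A(2) AL] by blast
  define L' where "L' = {f \<in> L. f s = \<zero>\<^bsub>R\<^esub>}"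
  have sub: "submodule L' R ?F"
  proof (rule F.submoduleI_smult)
    show "L' \<subseteq> carrier ?F" using LF by (auto simp: L'_def)
    show "\<zero>\<^bsub>?F\<^esub> \<in> L'" using F.submodule_zero[OF L] sT by (simp add: L'_def)
    show "f \<oplus>\<^bsub>?F\<^esub> g \<in> L'" if "f \<in> L'" "g \<in> L'" for f g
      using that F.submoduleE(5)[OF L, of f g] sT by (simp add: L'_def)
    show "r \<odot>\<^bsub>?F\<^esub> f \<in> L'" if "r \<in> carrier R" "f \<in> L'" for r f
      using that F.submoduleE(4)[OF L, of r f] sT by (simp add: L'_def)
  qed
  have "f t = \<zero>\<^bsub>R\<^esub>" if "f \<in> L'" "t \<in> T - S" for f t
    using insert.prems(3)[of f t] that by (cases "t = s") (auto simp: L'_def)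
  then obtain G where G: "finite G" "submodule_generated_by R ?F G L'"
    using insert.IH[OF _ sub] insert.prems(1) by blast
  have "L \<subseteq> H" if H: "submodule H R ?F" and GB: "G \<union> B \<subseteq> H" for H
  proof
    fix f assume f: "f \<in> L"
    have HL: "submodule (H \<inter> L) R ?F" by (rule F.submodule_Int[OF H L])
    have "A \<subseteq> (\<lambda>f. f s) ` (H \<inter> L)" unfolding B(3) using GB B(1) by blast
    then have "(\<lambda>f. f s) ` L \<subseteq> (\<lambda>f. f s) ` (H \<inter> L)"
      unfolding A(3) by (rule F.R.genideal_minimal[OF val[OF HL]])
    then obtain h where h: "h \<in> H" "h \<in> L" "f s = h s" using f by blast
    have hf: "h \<in> carrier ?F" "f \<in> carrier ?F" using h(2) f LF by auto
    let ?d = "f \<oplus>\<^bsub>?F\<^esub> (\<ominus>\<^bsub>R\<^esub> \<one>\<^bsub>R\<^esub>) \<odot>\<^bsub>?F\<^esub> h"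
    have "?d s = \<zero>\<^bsub>R\<^esub>"
      using sT h(3) hf by (simp add: PiE_iff F.R.l_minus F.R.r_neg)
    moreover have "?d \<in> L"
      by (intro F.submoduleE(5)[OF L f] F.submoduleE(4)[OF L]) (use h in auto)
    ultimately have "?d \<in> L'" by (simp only: L'_def mem_Collect_eq)
    then have dH: "?d \<in> H"
      using G(2) H GB unfolding submodule_generated_by_def by blast
    have "?d \<oplus>\<^bsub>?F\<^esub> h = f"
      using hf by (auto simp: PiE_iff F.R.l_minus F.R.a_assoc F.R.l_neg fun_eq_iff extensional_def)
    then show "f \<in> H" using F.submoduleE(5)[OF H dH h(1)] by simp
  qed
  moreover have "G \<union> B \<subseteq> L" using B(1) G(2) by (auto simp: submodule_generated_by_def L'_def)
  ultimately have "submodule_generated_by R ?F (G \<union> B) L"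
    unfolding submodule_generated_by_def by blast
  then show ?case using G(1) B(2) by blast
qed

section \<open>Injective modules and duality\<close>

text \<open>
  Injectivity for inclusions. The type of elements of \<open>B\<close> is arbitrary, which is needed for free
  modules and for quotients of \<open>R\<close>.
\<close>

lemma injective_extend:
  fixes B :: "('a, 't) module"
  assumes E: "injective_module TYPE('a) (R :: ('a, 'b) ring_scheme) E"
    and B: "module R B" and H: "submodule H R B"
    and f: "f \<in> Hom_mod R (B\<lparr>carrier := H\<rparr>) E"
  obtains g where "g \<in> Hom_mod R B E" "\<And>x. x \<in> H \<Longrightarrow> g x = f x"
proof -
  let ?A = "B\<lparr>carrier := H\<rparr>"
  have A: "module R ?A" by (rule submodule.submodule_is_module[OF H B])
  have "linear_map R ?A B (\<lambda>x. x)"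
    using module.submoduleE(1)[OF B H] by (auto simp: linear_map_def)
  then have "(\<lambda>x\<in>carrier ?A. x) \<in> Hom_mod R ?A B" by (rule linear_map_restrict_Hom[OF A])
  moreover have "inj_on (\<lambda>x\<in>carrier ?A. x) (carrier ?A)" by (auto simp: inj_on_def)
  ultimately have "\<exists>g\<in>Hom_mod R B E. \<forall>x\<in>carrier ?A. g ((\<lambda>x\<in>carrier ?A. x) x) = f x"
    using injective_module_any_type[OF E, where 't = 't] A B f
    unfolding injective_module_def by blast
  then show thesis using that by auto
qed

text \<open>
  For \<open>E\<close> injective and \<open>M\<close> with generators \<open>s\<close> and finitely many relations \<open>\<rho>\<close>, every
  \<open>x = (\<Sum>s. v s s)\<close> and \<open>z \<in> E\<close> with \<open>\<phi> x z = 0\<close> for all functionals \<open>\<phi>\<close> admit a solution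
  \<open>y\<close> of the linear system \<open>(\<Sum>\<rho>. \<rho> s y \<rho>) = v s z\<close>: the functionals on \<open>M\<close> are the vectors
  \<open>u\<close> orthogonal to all \<open>\<rho>\<close>, so \<open>(u \<bullet> \<rho>)\<^sub>\<rho> \<mapsto> (u \<bullet> v) z\<close> is well defined, and \<open>y\<close> is read off from an
  extension of this map to the whole free module.
\<close>

lemma injective_linear_system:
  fixes R :: "('a, 'b) ring_scheme" and M :: "('a, 'm, 'c) module_scheme"
    and E :: "('a, 'e, 'd) module_scheme"
  assumes R: "cring R" "noetherian_ring R"
    and E: "injective_module TYPE('a) R E"
    and M: "module R M"
    and S: "finite S" "submodule_generated_by R M S (carrier M)"
    and v: "v \<in> S \<rightarrow>\<^sub>E carrier R" "x = (\<Oplus>\<^bsub>M\<^esub>s\<in>S. v s \<odot>\<^bsub>M\<^esub> s)"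
    and z: "z \<in> carrier E"
    and vanish: "\<And>\<phi>. \<phi> \<in> Hom_mod R M (self_module R) \<Longrightarrow> \<phi> x \<odot>\<^bsub>E\<^esub> z = \<zero>\<^bsub>E\<^esub>"
  obtains G y where "finite G" "G \<subseteq> S \<rightarrow>\<^sub>E carrier R"
    "\<And>\<rho>. \<rho> \<in> G \<Longrightarrow> (\<Oplus>\<^bsub>M\<^esub>s\<in>S. \<rho> s \<odot>\<^bsub>M\<^esub> s) = \<zero>\<^bsub>M\<^esub>"
    "y \<in> G \<rightarrow> carrier E"
    "\<And>s. s \<in> S \<Longrightarrow> (\<Oplus>\<^bsub>E\<^esub>\<rho>\<in>G. \<rho> s \<odot>\<^bsub>E\<^esub> y \<rho>) = v s \<odot>\<^bsub>E\<^esub> z"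
proof -
  let ?F = "free_module R S" and ?R1 = "self_module R"
  have ER: "module R E" using E by (simp add: injective_module_def)
  interpret R: cring R by fact
  interpret M: module R M by fact
  interpret E: module R E by fact
  interpret F: module R ?F by (rule module_free_module[OF R(1)])
  interpret R1: module R ?R1 by (rule module_self_module[OF R(1)])
  have R1: "carrier ?R1 = carrier R" "(\<oplus>\<^bsub>?R1\<^esub>) = (\<oplus>\<^bsub>R\<^esub>)" "(\<odot>\<^bsub>?R1\<^esub>) = (\<otimes>\<^bsub>R\<^esub>)" "\<zero>\<^bsub>?R1\<^esub> = \<zero>\<^bsub>R\<^esub>"
    by (simp_all add: ring_module_def)
  have SM: "S \<subseteq> carrier M" using S(2) by (simp add: submodule_generated_by_def)
  define comb where "comb c = (\<Oplus>\<^bsub>M\<^esub>s\<in>S. c s \<odot>\<^bsub>M\<^esub> s)" for c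
  have comb: "linear_map R ?F M comb"
    unfolding comb_def by (rule linear_map_combination[OF M S(1)]) (use SM in auto)
  have "carrier M \<subseteq> comb ` carrier ?F"
    using M.generated_linear_combination[OF S(2,1)] unfolding comb_def free_module_simps(1) by blast
  then have comb_surj: "carrier M = comb ` carrier ?F" using linear_mapD(1)[OF comb] by auto
  define dot where "dot u r = (\<Oplus>\<^bsub>?R1\<^esub>s\<in>S. r s \<otimes>\<^bsub>R\<^esub> u s)" for u r :: "'m \<Rightarrow> 'a"
  have dot_comm: "dot u r = dot r u" if "u \<in> carrier ?F" "r \<in> carrier ?F" for u r
    unfolding dot_def
    by (rule R1.M.finsum_cong') (use that in \<open>auto simp: R1 PiE_iff R.m_comm\<close>)
  have dot: "linear_map R ?F ?R1 (dot u)" if "u \<in> carrier ?F" for u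
    using linear_map_combination[OF R1.module_axioms S(1), of u] that
    by (auto simp: dot_def[abs_def] R1 PiE_iff)
  have dot_closed: "dot u r \<in> carrier R" if "u \<in> carrier ?F" "r \<in> carrier ?F" for u r
    using linear_mapD(1)[OF dot] that by (simp add: R1)
  have dot': "linear_map R ?F ?R1 (\<lambda>u. dot u r)" if r: "r \<in> carrier ?F" for r
  proof -
    have "dot (u \<oplus>\<^bsub>?F\<^esub> u') r = dot u r \<oplus>\<^bsub>R\<^esub> dot u' r" if "u \<in> carrier ?F" "u' \<in> carrier ?F" for u u'
      unfolding dot_comm[OF that(1) r] dot_comm[OF that(2) r] dot_comm[OF F.a_closed[OF that] r]
      using linear_mapD(2)[OF dot[OF r] that] by (simp only: R1)
    moreover have "dot (a \<odot>\<^bsub>?F\<^esub> u) r = a \<otimes>\<^bsub>R\<^esub> dot u r" if "a \<in> carrier R" "u \<in> carrier ?F" for a u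
      unfolding dot_comm[OF that(2) r] dot_comm[OF F.smult_closed[OF that] r]
      using linear_mapD(3)[OF dot[OF r] that] by (simp only: R1)
    ultimately show ?thesis unfolding linear_map_def R1 using dot_closed r by blast
  qed
  \<comment> \<open>The module of all relations between the generators; \<open>G\<close> is a finite generating set of it.\<close>
  define L where "L = {r \<in> carrier ?F. comb r = \<zero>\<^bsub>M\<^esub>}"
  have "submodule L R ?F"
    unfolding L_def by (rule linear_map_kernel_submodule[OF comb F.module_axioms M])
  then obtain G where G: "finite G" "submodule_generated_by R ?F G L"
    using free_module_submodule_generated[OF R S(1) order_refl] by blast
  have GL: "G \<subseteq> L" using G(2) by (simp add: submodule_generated_by_def)
  then have GF: "G \<subseteq> carrier ?F" unfolding L_def by blast
  let ?B = "free_module R G"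
  interpret B: module R ?B by (rule module_free_module[OF R(1)])
  \<comment> \<open>The left hand sides of the system, seen as functions of the coefficients \<open>u\<close> of a relation between them.\<close>
  define \<Phi> where "\<Phi> u = (\<lambda>\<rho>\<in>G. dot u \<rho>)" for u
  have \<Phi>: "linear_map R ?F ?B \<Phi>"
    unfolding \<Phi>_def by (rule linear_map_into_free_module) (use dot' GF in blast)
  have vF: "v \<in> carrier ?F" using v(1) by simp
  have xv: "x = comb v" unfolding comb_def by (rule v(2))
  have f: "linear_map R ?F E (\<lambda>u. dot u v \<odot>\<^bsub>E\<^esub> z)"
    by (rule linear_map_comp[OF dot'[OF vF] linear_map_scale[OF ER z]])
  \<comment> \<open>A vector orthogonal to the chosen relations is orthogonal to all relations, hence a functional on \<open>M\<close>.\<close>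
  have ker: "dot u v \<odot>\<^bsub>E\<^esub> z = \<zero>\<^bsub>E\<^esub>" if u: "u \<in> carrier ?F" and "\<Phi> u = \<zero>\<^bsub>?B\<^esub>" for u
  proof -
    have "dot u \<rho> = \<zero>\<^bsub>R\<^esub>" if "\<rho> \<in> G" for \<rho>
      using fun_cong[OF \<open>\<Phi> u = \<zero>\<^bsub>?B\<^esub>\<close>, of \<rho>] that by (simp add: \<Phi>_def)
    then have "G \<subseteq> {r \<in> carrier ?F. dot u r = \<zero>\<^bsub>?R1\<^esub>}" using GF unfolding R1 by blast
    then have "L \<subseteq> {r \<in> carrier ?F. dot u r = \<zero>\<^bsub>?R1\<^esub>}"
      using G(2) linear_map_kernel_submodule[OF dot[OF u] F.module_axioms R1.module_axioms]
      unfolding submodule_generated_by_def by blast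
    then have "dot u r = \<zero>\<^bsub>?R1\<^esub>" if "r \<in> carrier ?F" "comb r = \<zero>\<^bsub>M\<^esub>" for r
      using that unfolding L_def by blast
    then obtain \<phi> where \<phi>: "\<phi> \<in> Hom_mod R M ?R1" "\<And>r. r \<in> carrier ?F \<Longrightarrow> \<phi> (comb r) = dot u r"
      using linear_map_factor[OF comb comb_surj dot[OF u] F.module_axioms M R1.module_axioms] by blast
    then show ?thesis using vanish[OF \<phi>(1)] vF unfolding xv by simp
  qed
  define N where "N = ?B\<lparr>carrier := \<Phi> ` carrier ?F\<rparr>"
  have N: "module R N"
    unfolding N_def
    by (rule submodule.submodule_is_module[OF linear_map_image_submodule[OF \<Phi>] B.module_axioms])
       (rule F.module_axioms B.module_axioms)+
  have N_simps: "carrier N = \<Phi> ` carrier ?F" "(\<oplus>\<^bsub>N\<^esub>) = (\<oplus>\<^bsub>?B\<^esub>)" "(\<odot>\<^bsub>N\<^esub>) = (\<odot>\<^bsub>?B\<^esub>)" "\<zero>\<^bsub>N\<^esub> = \<zero>\<^bsub>?B\<^esub>"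
    by (simp_all add: N_def)
  have \<Phi>N: "linear_map R ?F N \<Phi>" using \<Phi> unfolding linear_map_def N_simps by blast
  obtain h where h: "h \<in> Hom_mod R N E" "\<And>u. u \<in> carrier ?F \<Longrightarrow> h (\<Phi> u) = dot u v \<odot>\<^bsub>E\<^esub> z"
    using linear_map_factor[OF \<Phi>N N_simps(1) f F.module_axioms N ER] ker unfolding N_simps by blast
  obtain g where g: "g \<in> Hom_mod R ?B E" "\<And>b. b \<in> carrier N \<Longrightarrow> g b = h b"
    using injective_extend[OF E B.module_axioms
        linear_map_image_submodule[OF \<Phi> F.module_axioms B.module_axioms] h(1)[unfolded N_def]]
    unfolding N_simps by blast
  have gl: "linear_map R ?B E g" by (rule Hom_mod_linear_map[OF g(1)])
  define y where "y \<rho> = g (unit_vector R G \<rho>)" for \<rho>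
  show thesis
  proof (rule that)
    show "finite G" by (rule G(1))
    show "G \<subseteq> S \<rightarrow>\<^sub>E carrier R" using GF by simp
    show "(\<Oplus>\<^bsub>M\<^esub>s\<in>S. \<rho> s \<odot>\<^bsub>M\<^esub> s) = \<zero>\<^bsub>M\<^esub>" if "\<rho> \<in> G" for \<rho>
      using that GL unfolding L_def comb_def by blast
    show "y \<in> G \<rightarrow> carrier E"
      using linear_mapD(1)[OF gl] by (auto simp: y_def R.unit_vector_closed)
    fix s assume s: "s \<in> S"
    have us: "unit_vector R S s \<in> carrier ?F" by (simp add: R.unit_vector_closed)
    have dots: "dot (unit_vector R S s) r = r s" if "r \<in> carrier ?F" for r
    proof -
      have "dot (unit_vector R S s) r = dot r (unit_vector R S s)" by (rule dot_comm[OF us that])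
      also have "\<dots> = r s"
        unfolding dot_def
        using combination_unit_vector[OF R1.module_axioms S(1) _ s, of r] that unfolding R1
        by (auto simp: PiE_iff)
      finally show ?thesis .
    qed
    have bG: "(\<lambda>\<rho>\<in>G. \<rho> s) \<in> G \<rightarrow>\<^sub>E carrier R" using GF s by (auto simp: PiE_iff)
    have \<Phi>u: "\<Phi> (unit_vector R S s) = (\<lambda>\<rho>\<in>G. \<rho> s)"
      unfolding \<Phi>_def by (rule restrict_ext) (use dots GF in blast)
    have "g (\<Phi> (unit_vector R S s)) = v s \<odot>\<^bsub>E\<^esub> z"
      using h(2)[OF us] g(2)[OF imageI[OF us, of \<Phi>, folded N_simps(1)]] unfolding dots[OF vF] by (rule trans[rotated])
    then have "g (\<lambda>\<rho>\<in>G. \<rho> s) = v s \<odot>\<^bsub>E\<^esub> z" unfolding \<Phi>u .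
    moreover have "g (\<lambda>\<rho>\<in>G. \<rho> s) = (\<Oplus>\<^bsub>E\<^esub>\<rho>\<in>G. (\<lambda>\<rho>\<in>G. \<rho> s) \<rho> \<odot>\<^bsub>E\<^esub> y \<rho>)"
      unfolding y_def by (rule linear_map_free_module[OF ER G(1) gl bG])
    moreover have "\<dots> = (\<Oplus>\<^bsub>E\<^esub>\<rho>\<in>G. \<rho> s \<odot>\<^bsub>E\<^esub> y \<rho>)"
      by (rule E.M.finsum_cong')
         (use bG linear_mapD(1)[OF gl] in \<open>auto simp: y_def R.unit_vector_closed\<close>)
    ultimately show "(\<Oplus>\<^bsub>E\<^esub>\<rho>\<in>G. \<rho> s \<odot>\<^bsub>E\<^esub> y \<rho>) = v s \<odot>\<^bsub>E\<^esub> z" by simp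
  qed
qed

section \<open>Tensor products\<close>

text \<open>
  Verbatim the generating set in the definition of \<open>tensor_rel\<close>, so that this definition can be folded.
\<close>

definition tensor_gens ::
    "('a, 'b) ring_scheme \<Rightarrow> ('a, 'm, 'c) module_scheme \<Rightarrow> ('a, 'n, 'd) module_scheme \<Rightarrow> ('m \<times> 'n \<Rightarrow>\<^sub>0 int) set"
  where "tensor_gens R M N =
    {frag_of (x \<oplus>\<^bsub>M\<^esub> x', y) - frag_of (x, y) - frag_of (x', y) | x x' y.
        x \<in> carrier M \<and> x' \<in> carrier M \<and> y \<in> carrier N} \<union>
    {frag_of (x, y \<oplus>\<^bsub>N\<^esub> y') - frag_of (x, y) - frag_of (x, y') | x y y'.
        x \<in> carrier M \<and> y \<in> carrier N \<and> y' \<in> carrier N} \<union>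
    {frag_of (r \<odot>\<^bsub>M\<^esub> x, y) - frag_of (x, r \<odot>\<^bsub>N\<^esub> y) | r x y.
        r \<in> carrier R \<and> x \<in> carrier M \<and> y \<in> carrier N}"

locale module_pair = M: module R M + N: module R N for R (structure) and M and N
begin

abbreviation "free_pairs \<equiv> free_Abelian_group (carrier M \<times> carrier N)"
abbreviation "rels \<equiv> tensor_rel R M N"

lemma free_pairs_diff:
  assumes "c \<in> carrier free_pairs" "d \<in> carrier free_pairs"
  shows "c - d \<in> carrier free_pairs"
  using assms keys_diff[of c d] unfolding carrier_free_Abelian_group_iff by blast

lemma tensor_gens_carrier: "tensor_gens R M N \<subseteq> carrier free_pairs"
proof
  fix c assume "c \<in> tensor_gens R M N"
  then show "c \<in> carrier free_pairs"
    unfolding tensor_gens_def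
    by (elim UnE CollectE exE conjE) (simp only:, intro free_pairs_diff; simp)+
qed

lemma tensor_rel_subgroup: "subgroup rels free_pairs"
  unfolding tensor_rel_def tensor_gens_def[symmetric]
  by (rule group.generate_is_subgroup[OF group_free_Abelian_group tensor_gens_carrier])

lemma rels_carrier: "c \<in> rels \<Longrightarrow> c \<in> carrier free_pairs"
  using subgroup.subset[OF tensor_rel_subgroup] by blast

lemma rels_zero: "0 \<in> rels"
  using subgroup.one_closed[OF tensor_rel_subgroup] by simp

lemma rels_add: "c \<in> rels \<Longrightarrow> d \<in> rels \<Longrightarrow> c + d \<in> rels"
  using subgroup.m_closed[OF tensor_rel_subgroup, of c d] by simp

lemma rels_uminus: "c \<in> rels \<Longrightarrow> - c \<in> rels"
  using subgroup.m_inv_closed[OF tensor_rel_subgroup, of c] rels_carrier[of c] by simp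

lemma rels_diff: "c \<in> rels \<Longrightarrow> d \<in> rels \<Longrightarrow> c - d \<in> rels"
  using rels_add[OF _ rels_uminus] by simp

lemma rels_sum: "(\<And>i. i \<in> A \<Longrightarrow> f i \<in> rels) \<Longrightarrow> (\<Sum>i\<in>A. f i) \<in> rels"
  by (induction A rule: infinite_finite_induct) (auto intro: rels_zero rels_add)

lemma rels_gen: "c \<in> tensor_gens R M N \<Longrightarrow> c \<in> rels"
  unfolding tensor_rel_def tensor_gens_def[symmetric] by (rule generate.incl)

lemma rels_left_add:
  "x \<in> carrier M \<Longrightarrow> x' \<in> carrier M \<Longrightarrow> y \<in> carrier N \<Longrightarrow>
   frag_of (x \<oplus>\<^bsub>M\<^esub> x', y) - frag_of (x, y) - frag_of (x', y) \<in> rels"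
  by (rule rels_gen) (unfold tensor_gens_def, blast)

lemma rels_right_add:
  "x \<in> carrier M \<Longrightarrow> y \<in> carrier N \<Longrightarrow> y' \<in> carrier N \<Longrightarrow>
   frag_of (x, y \<oplus>\<^bsub>N\<^esub> y') - frag_of (x, y) - frag_of (x, y') \<in> rels"
  by (rule rels_gen) (unfold tensor_gens_def, blast)

lemma rels_smult:
  "r \<in> carrier R \<Longrightarrow> x \<in> carrier M \<Longrightarrow> y \<in> carrier N \<Longrightarrow>
   frag_of (r \<odot>\<^bsub>M\<^esub> x, y) - frag_of (x, r \<odot>\<^bsub>N\<^esub> y) \<in> rels"
  by (rule rels_gen) (unfold tensor_gens_def, blast)

lemma rels_left_zero: "y \<in> carrier N \<Longrightarrow> frag_of (\<zero>\<^bsub>M\<^esub>, y) \<in> rels"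
  using rels_uminus[OF rels_left_add[of "\<zero>\<^bsub>M\<^esub>" "\<zero>\<^bsub>M\<^esub>" y]] by simp

lemma rels_right_zero: "x \<in> carrier M \<Longrightarrow> frag_of (x, \<zero>\<^bsub>N\<^esub>) \<in> rels"
  using rels_uminus[OF rels_right_add[of x "\<zero>\<^bsub>N\<^esub>" "\<zero>\<^bsub>N\<^esub>"]] by simp

lemma rels_additive_sum:
  assumes "abelian_monoid X" and zero: "F \<zero>\<^bsub>X\<^esub> \<in> rels"
    and add: "\<And>a b. a \<in> carrier X \<Longrightarrow> b \<in> carrier X \<Longrightarrow> F (a \<oplus>\<^bsub>X\<^esub> b) - F a - F b \<in> rels"
    and "finite A" "f \<in> A \<rightarrow> carrier X"
  shows "F (\<Oplus>\<^bsub>X\<^esub>i\<in>A. f i) - (\<Sum>i\<in>A. F (f i)) \<in> rels"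
proof -
  interpret X: abelian_monoid X by fact
  show ?thesis
    using assms(4,5)
  proof (induction A)
    case empty
    show ?case using zero by simp
  next
    case (insert j A)
    then have cl: "f \<in> A \<rightarrow> carrier X" "f j \<in> carrier X" by auto
    then show ?case
      using rels_add[OF add[OF cl(2) X.finsum_closed[OF cl(1)]] insert.IH] insert.hyps
      by (simp add: X.finsum_insert algebra_simps)
  qed
qed

text \<open>
  \<open>(\<Sum>i. r i x i) \<otimes> y = (\<Sum>i. x i \<otimes> r i y)\<close> and its mirror image, written as membership of a formal
  difference in the group of relations.
\<close>

lemma rels_left_combination:
  assumes "finite A" "\<And>i. i \<in> A \<Longrightarrow> r i \<in> carrier R" "\<And>i. i \<in> A \<Longrightarrow> x i \<in> carrier M" "y \<in> carrier N"
  shows "frag_of (\<Oplus>\<^bsub>M\<^esub>i\<in>A. r i \<odot>\<^bsub>M\<^esub> x i, y) - (\<Sum>i\<in>A. frag_of (x i, r i \<odot>\<^bsub>N\<^esub> y)) \<in> rels"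
proof -
  have "frag_of (\<Oplus>\<^bsub>M\<^esub>i\<in>A. r i \<odot>\<^bsub>M\<^esub> x i, y) - (\<Sum>i\<in>A. frag_of (r i \<odot>\<^bsub>M\<^esub> x i, y)) \<in> rels"
    by (rule rels_additive_sum[OF M.abelian_monoid_axioms, of "\<lambda>x. frag_of (x, y)"])
       (use assms in \<open>auto intro: rels_left_zero rels_left_add\<close>)
  moreover have "(\<Sum>i\<in>A. frag_of (r i \<odot>\<^bsub>M\<^esub> x i, y) - frag_of (x i, r i \<odot>\<^bsub>N\<^esub> y)) \<in> rels"
    by (intro rels_sum rels_smult) (use assms in auto)
  ultimately show ?thesis using rels_add unfolding sum_subtractf by fastforce
qed

lemma rels_right_combination:
  assumes "finite A" "\<And>i. i \<in> A \<Longrightarrow> r i \<in> carrier R" "\<And>i. i \<in> A \<Longrightarrow> y i \<in> carrier N" "x \<in> carrier M"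
  shows "frag_of (x, \<Oplus>\<^bsub>N\<^esub>i\<in>A. r i \<odot>\<^bsub>N\<^esub> y i) - (\<Sum>i\<in>A. frag_of (r i \<odot>\<^bsub>M\<^esub> x, y i)) \<in> rels"
proof -
  have "frag_of (x, \<Oplus>\<^bsub>N\<^esub>i\<in>A. r i \<odot>\<^bsub>N\<^esub> y i) - (\<Sum>i\<in>A. frag_of (x, r i \<odot>\<^bsub>N\<^esub> y i)) \<in> rels"
    by (rule rels_additive_sum[OF N.abelian_monoid_axioms, of "\<lambda>y. frag_of (x, y)"])
       (use assms in \<open>auto intro: rels_right_zero rels_right_add\<close>)
  moreover have "(\<Sum>i\<in>A. frag_of (r i \<odot>\<^bsub>M\<^esub> x, y i) - frag_of (x, r i \<odot>\<^bsub>N\<^esub> y i)) \<in> rels"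
    by (intro rels_sum rels_smult) (use assms in auto)
  ultimately show ?thesis using rels_diff unfolding sum_subtractf by fastforce
qed

lemma pure_tensor_eq_zero_iff:
  assumes "x \<in> carrier M" "y \<in> carrier N"
  shows "pure_tensor R M N x y = \<zero>\<^bsub>tensor R M N\<^esub> \<longleftrightarrow> frag_of (x, y) \<in> rels"
proof -
  have "\<zero>\<^bsub>tensor R M N\<^esub> = rels" by (simp add: tensor_def Let_def)
  moreover have "frag_of (x, y) \<in> carrier free_pairs" using assms by simp
  ultimately show ?thesis
    using group.coset_join1[OF group_free_Abelian_group _ _ tensor_rel_subgroup]
      group.coset_join2[OF group_free_Abelian_group _ tensor_rel_subgroup]
      subgroup.subset[OF tensor_rel_subgroup]
    unfolding pure_tensor_def tensor_coset_def by metis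
qed

end

text \<open>
  The additive extension of \<open>(x, y) \<mapsto> (f x, g y)\<close> maps generating relations to generating relations,
  so every representative of \<open>x \<otimes> y\<close> gives the same coset.
\<close>

lemma tensor_map_pure_tensor:
  assumes "module_pair R M N" "module_pair R M' N'"
    and f: "linear_map R M M' f" and g: "linear_map R N N' g"
    and x: "x \<in> carrier M" and y: "y \<in> carrier N"
  shows "tensor_map R M' N' f g (pure_tensor R M N x y) = pure_tensor R M' N' (f x) (g y)"
proof -
  interpret A: module_pair R M N by fact
  interpret B: module_pair R M' N' by fact
  define k where "k = frag_extend (\<lambda>(x, y). frag_of (f x, g y))"
  have kd: "k (c - d) = k c - k d" and kn: "k (- c) = - k c" and ka: "k (c + d) = k c + k d" for c d
    unfolding k_def by (rule frag_extend_diff frag_extend_minus frag_extend_add)+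
  have k1: "k (frag_of (a, b)) = frag_of (f a, g b)" for a b by (simp add: k_def)
  have gens: "k c \<in> B.rels" if "c \<in> tensor_gens R M N" for c
    using that unfolding tensor_gens_def
    by (elim UnE CollectE exE conjE)
       (simp_all add: kd k1 linear_mapD[OF f] linear_mapD[OF g] B.rels_left_add B.rels_right_add B.rels_smult)
  have rels: "k c \<in> B.rels" if "c \<in> A.rels" for c
    using that unfolding tensor_rel_def[of R M N] tensor_gens_def[symmetric]
  proof (induction rule: generate.induct)
    case one
    show ?case using B.rels_zero by (simp add: k_def)
  next
    case (incl c)
    then show ?case by (rule gens)
  next
    case (inv c)
    then show ?case
      using A.tensor_gens_carrier B.rels_uminus[OF gens[of c]] by (auto simp: kn subset_iff)
  next
    case (eng c d)
    then show ?case using B.rels_add by (simp add: ka)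
  qed
  let ?k = "\<lambda>c. tensor_coset R M' N' (k c)"
  have "?k c = pure_tensor R M' N' (f x) (g y)" if c: "c \<in> pure_tensor R M N x y" for c
  proof -
    obtain t where t: "t \<in> A.rels" "c = t + frag_of (x, y)"
      using c by (auto simp: pure_tensor_def tensor_coset_def r_coset_def)
    have "k c = k t \<otimes>\<^bsub>B.free_pairs\<^esub> frag_of (f x, g y)" by (simp add: t(2) ka k1)
    moreover have fc: "frag_of (f x, g y) \<in> carrier B.free_pairs"
      using linear_mapD(1)[OF f x] linear_mapD(1)[OF g y] by simp
    moreover have "B.rels #>\<^bsub>B.free_pairs\<^esub> k t = B.rels"
      by (rule group.coset_join2[OF group_free_Abelian_group _ B.tensor_rel_subgroup])
         (use rels[OF t(1)] B.rels_carrier in auto)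
    ultimately show ?thesis
      using group.coset_mult_assoc[OF group_free_Abelian_group subgroup.subset[OF B.tensor_rel_subgroup]
          B.rels_carrier[OF rels[OF t(1)]] fc]
      by (simp only: pure_tensor_def tensor_coset_def)
  qed
  moreover have "frag_of (x, y) \<in> pure_tensor R M N x y"
    using A.rels_zero by (force simp: pure_tensor_def tensor_coset_def r_coset_def)
  ultimately show ?thesis unfolding tensor_map_def k_def[symmetric] by blast
qed

text \<open>
  The functional induces \<open>M \<otimes> N \<rightarrow> M\<close>, \<open>z \<otimes> x \<mapsto> \<phi> x z\<close>: the additive extension \<open>h\<close> of
  \<open>(a, b) \<mapsto> \<phi> b a\<close> to formal sums kills all relations.
\<close>

lemma pure_tensor_zero_imp_functional_vanishes:
  assumes "module_pair R M N"
    and \<phi>: "linear_map R N (self_module R) \<phi>"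
    and z: "z \<in> carrier M" and x: "x \<in> carrier N"
    and zero: "frag_of (z, x) \<in> tensor_rel R M N"
  shows "\<phi> x \<odot>\<^bsub>M\<^esub> z = \<zero>\<^bsub>M\<^esub>"
proof -
  interpret module_pair R M N by fact
  have \<phi>c: "\<phi> b \<in> carrier R" if "b \<in> carrier N" for b
    using linear_mapD(1)[OF \<phi> that] by (simp add: ring_module_def)
  have \<phi>a: "\<phi> (b \<oplus>\<^bsub>N\<^esub> b') = \<phi> b \<oplus>\<^bsub>R\<^esub> \<phi> b'" if "b \<in> carrier N" "b' \<in> carrier N" for b b'
    using linear_mapD(2)[OF \<phi> that] by (simp add: ring_module_def)
  have \<phi>s: "\<phi> (r \<odot>\<^bsub>N\<^esub> b) = r \<otimes>\<^bsub>R\<^esub> \<phi> b" if "r \<in> carrier R" "b \<in> carrier N" for r b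
    using linear_mapD(3)[OF \<phi> that] by (simp add: ring_module_def)
  have "(\<lambda>(a, b). \<phi> b \<odot>\<^bsub>M\<^esub> a) ` (carrier M \<times> carrier N) \<subseteq> carrier (add_monoid M)"
    using \<phi>c by auto
  then obtain h where h: "h \<in> hom free_pairs (add_monoid M)"
    "\<And>q. q \<in> carrier M \<times> carrier N \<Longrightarrow> h (frag_of q) = (case q of (a, b) \<Rightarrow> \<phi> b \<odot>\<^bsub>M\<^esub> a)"
    using comm_group.free_Abelian_group_universal[OF M.a_comm_group] by blast
  have hf: "h (frag_of (a, b)) = \<phi> b \<odot>\<^bsub>M\<^esub> a" if "a \<in> carrier M" "b \<in> carrier N" for a b
    using h(2)[of "(a, b)"] that by simp
  interpret h: group_hom free_pairs "add_monoid M" h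
    using h(1) M.a_group by (intro group_hom.intro group_hom_axioms.intro group_free_Abelian_group)
  have ha: "h (c + d) = h c \<oplus>\<^bsub>M\<^esub> h d" if "c \<in> carrier free_pairs" "d \<in> carrier free_pairs" for c d
    using h.hom_mult[OF that] by simp
  have hn: "h (- c) = \<ominus>\<^bsub>M\<^esub> h c" if "c \<in> carrier free_pairs" for c
    using h.hom_inv[OF that] that by (simp add: a_inv_def)
  have hd: "h (c - d) = h c \<oplus>\<^bsub>M\<^esub> \<ominus>\<^bsub>M\<^esub> h d" if "c \<in> carrier free_pairs" "d \<in> carrier free_pairs" for c d
    using ha[of c "- d"] hn[of d] that by simp
  have fc: "frag_of (a, b) \<in> carrier free_pairs" if "a \<in> carrier M" "b \<in> carrier N" for a b
    using that by simp
  note hd' = hd[OF free_pairs_diff[OF fc fc] fc] hd[OF fc fc]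
  have gen: "h c = \<zero>\<^bsub>M\<^esub>" if c: "c \<in> tensor_gens R M N" for c
    using c unfolding tensor_gens_def
  proof (elim UnE CollectE exE conjE)
    fix a a' b
    assume *: "c = frag_of (a \<oplus>\<^bsub>M\<^esub> a', b) - frag_of (a, b) - frag_of (a', b)"
      "a \<in> carrier M" "a' \<in> carrier M" "b \<in> carrier N"
    then have "\<phi> b \<odot>\<^bsub>M\<^esub> a \<in> carrier M" "\<phi> b \<odot>\<^bsub>M\<^esub> a' \<in> carrier M" using \<phi>c by auto
    then show ?thesis unfolding *(1) using *(2-4) \<phi>c
      by (simp add: hd' hf M.smult_r_distr M.minus_add M.a_ac M.r_neg M.r_neg1 M.r_neg2)
  next
    fix a b b'
    assume *: "c = frag_of (a, b \<oplus>\<^bsub>N\<^esub> b') - frag_of (a, b) - frag_of (a, b')"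
      "a \<in> carrier M" "b \<in> carrier N" "b' \<in> carrier N"
    then have "\<phi> b \<odot>\<^bsub>M\<^esub> a \<in> carrier M" "\<phi> b' \<odot>\<^bsub>M\<^esub> a \<in> carrier M" using \<phi>c by auto
    then show ?thesis unfolding *(1) using *(2-4) \<phi>c
      by (simp add: hd' hf \<phi>a M.smult_l_distr M.minus_add M.a_ac M.r_neg M.r_neg1 M.r_neg2)
  next
    fix r a b
    assume *: "c = frag_of (r \<odot>\<^bsub>M\<^esub> a, b) - frag_of (a, r \<odot>\<^bsub>N\<^esub> b)"
      "r \<in> carrier R" "a \<in> carrier M" "b \<in> carrier N"
    then show ?thesis unfolding *(1) using \<phi>c
      by (simp add: hd' hf \<phi>s M.smult_assoc1[symmetric] M.R.m_comm M.r_neg)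
  qed
  have "tensor_rel R M N \<subseteq> kernel free_pairs (add_monoid M) h"
    unfolding tensor_rel_def tensor_gens_def[symmetric]
    by (rule h.generate_subgroup_incl[OF _ h.subgroup_kernel])
       (use gen tensor_gens_carrier in \<open>unfold kernel_def, auto simp del: carrier_free_Abelian_group_iff\<close>)
  then have "h (frag_of (z, x)) = \<zero>\<^bsub>M\<^esub>" using zero by (auto simp: kernel_def)
  then show ?thesis using hf[OF z x] by simp
qed


text \<open>
  A solution \<open>y\<close> of the system of \<open>injective_linear_system\<close> lets the coefficients of \<open>x\<close> be moved across
  the tensor sign until only the relations \<open>(\<Sum>s. \<rho> s s) = 0\<close> remain on the right.
\<close>

theorem functionals_vanish_imp_pure_tensor_zero:
  fixes R :: "('a, 'b) ring_scheme" and M :: "('a, 'm, 'c) module_scheme"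
    and E :: "('a, 'e, 'd) module_scheme"
  assumes R: "cring R" "noetherian_ring R"
    and E: "injective_module TYPE('a) R E"
    and M: "module R M" "fin_gen_module R M"
    and x: "x \<in> carrier M" and z: "z \<in> carrier E"
    and vanish: "\<And>\<phi>. \<phi> \<in> Hom_mod R M (self_module R) \<Longrightarrow> \<phi> x \<odot>\<^bsub>E\<^esub> z = \<zero>\<^bsub>E\<^esub>"
  shows "frag_of (z, x) \<in> tensor_rel R E M"
proof -
  interpret M: module R M by fact
  interpret E: module R E using E by (simp add: injective_module_def)
  interpret module_pair R E M
    by (intro module_pair.intro M.module_axioms E.module_axioms)
  obtain S where S: "finite S" "submodule_generated_by R M S (carrier M)"
    using M(2) unfolding M.fin_gen_module_generated by blast
  then have SM: "S \<subseteq> carrier M" by (simp add: submodule_generated_by_def)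
  obtain v where v: "v \<in> S \<rightarrow>\<^sub>E carrier R" and xv: "x = (\<Oplus>\<^bsub>M\<^esub>s\<in>S. v s \<odot>\<^bsub>M\<^esub> s)"
    by (rule M.generated_linear_combination[OF S(2,1) x])
  obtain G y where G: "finite G" "G \<subseteq> S \<rightarrow>\<^sub>E carrier R"
    and rel: "\<And>\<rho>. \<rho> \<in> G \<Longrightarrow> (\<Oplus>\<^bsub>M\<^esub>s\<in>S. \<rho> s \<odot>\<^bsub>M\<^esub> s) = \<zero>\<^bsub>M\<^esub>"
    and y: "y \<in> G \<rightarrow> carrier E"
    and sys: "\<And>s. s \<in> S \<Longrightarrow> (\<Oplus>\<^bsub>E\<^esub>\<rho>\<in>G. \<rho> s \<odot>\<^bsub>E\<^esub> y \<rho>) = v s \<odot>\<^bsub>E\<^esub> z"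
    using injective_linear_system[OF R E M(1) S, of v x z] v xv z vanish by blast
  \<comment> \<open>\<open>z \<otimes> x = (\<Sum>s. v s z \<otimes> s) = (\<Sum>s. (\<Sum>\<rho>. \<rho> s y \<rho>) \<otimes> s) = (\<Sum>\<rho>. y \<rho> \<otimes> (\<Sum>s. \<rho> s s)) = 0\<close>\<close>
  have "frag_of (z, x) - (\<Sum>s\<in>S. frag_of (v s \<odot>\<^bsub>E\<^esub> z, s)) \<in> rels"
    unfolding xv by (rule rels_right_combination) (use S v SM z in auto)
  moreover have "(\<Sum>s\<in>S. frag_of (v s \<odot>\<^bsub>E\<^esub> z, s) - (\<Sum>\<rho>\<in>G. frag_of (y \<rho>, \<rho> s \<odot>\<^bsub>M\<^esub> s))) \<in> rels"
  proof (rule rels_sum)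
    fix s assume s: "s \<in> S"
    show "frag_of (v s \<odot>\<^bsub>E\<^esub> z, s) - (\<Sum>\<rho>\<in>G. frag_of (y \<rho>, \<rho> s \<odot>\<^bsub>M\<^esub> s)) \<in> rels"
      unfolding sys[OF s, symmetric]
      by (rule rels_left_combination) (use G y s SM in \<open>auto simp: PiE_iff Pi_iff subset_iff\<close>)
  qed
  moreover have "(\<Sum>\<rho>\<in>G. \<Sum>s\<in>S. frag_of (y \<rho>, \<rho> s \<odot>\<^bsub>M\<^esub> s)) \<in> rels"
  proof (rule rels_sum)
    fix \<rho> assume \<rho>: "\<rho> \<in> G"
    have y\<rho>: "y \<rho> \<in> carrier E" using y \<rho> by auto
    have \<rho>s: "\<rho> s \<in> carrier R" if "s \<in> S" for s using G(2) \<rho> that by auto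
    have "frag_of (y \<rho>, \<Oplus>\<^bsub>M\<^esub>s\<in>S. \<rho> s \<odot>\<^bsub>M\<^esub> s) - (\<Sum>s\<in>S. frag_of (\<rho> s \<odot>\<^bsub>E\<^esub> y \<rho>, s)) \<in> rels"
      by (rule rels_right_combination) (use S SM y\<rho> \<rho>s in auto)
    then have "(\<Sum>s\<in>S. frag_of (\<rho> s \<odot>\<^bsub>E\<^esub> y \<rho>, s)) \<in> rels"
      using rels_diff[OF rels_right_zero[OF y\<rho>]] unfolding rel[OF \<rho>] by fastforce
    moreover have "(\<Sum>s\<in>S. frag_of (\<rho> s \<odot>\<^bsub>E\<^esub> y \<rho>, s) - frag_of (y \<rho>, \<rho> s \<odot>\<^bsub>M\<^esub> s)) \<in> rels"
      by (rule rels_sum, rule rels_smult) (use \<rho>s y\<rho> SM in auto)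
    ultimately show "(\<Sum>s\<in>S. frag_of (y \<rho>, \<rho> s \<odot>\<^bsub>M\<^esub> s)) \<in> rels"
      using rels_diff unfolding sum_subtractf by fastforce
  qed
  ultimately have "(frag_of (z, x) - (\<Sum>s\<in>S. frag_of (v s \<odot>\<^bsub>E\<^esub> z, s))) +
      (\<Sum>s\<in>S. frag_of (v s \<odot>\<^bsub>E\<^esub> z, s) - (\<Sum>\<rho>\<in>G. frag_of (y \<rho>, \<rho> s \<odot>\<^bsub>M\<^esub> s))) +
      (\<Sum>\<rho>\<in>G. \<Sum>s\<in>S. frag_of (y \<rho>, \<rho> s \<odot>\<^bsub>M\<^esub> s)) \<in> rels"
    by (blast intro: rels_add)
  then show ?thesis
    unfolding sum_subtractf sum.swap[of _ S G] by simp
qed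

section \<open>Associated primes and integral fractions\<close>

text \<open>The ideal \<open>(a : b)\<close>, that is, the annihilator of \<open>b\<close> in \<open>R / (a)\<close>.\<close>

definition colon :: "('a, 'b) ring_scheme \<Rightarrow> 'a \<Rightarrow> 'a \<Rightarrow> 'a set"
  where "colon R a b = {r \<in> carrier R. \<exists>w\<in>carrier R. r \<otimes>\<^bsub>R\<^esub> b = w \<otimes>\<^bsub>R\<^esub> a}"

lemma (in cring) colon_ideal:
  assumes a: "a \<in> carrier R" and b: "b \<in> carrier R" shows "ideal (colon R a b) R"
proof (rule cring_idealI)
  show "\<zero> \<in> colon R a b" using a b by (auto simp: colon_def intro!: bexI[of _ \<zero>])
  fix x y assume "x \<in> colon R a b" "y \<in> colon R a b"
  then obtain w w' where w: "x \<in> carrier R" "y \<in> carrier R" "w \<in> carrier R" "w' \<in> carrier R"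
    "x \<otimes> b = w \<otimes> a" "y \<otimes> b = w' \<otimes> a"
    unfolding colon_def by blast
  then have "(x \<oplus> y) \<otimes> b = (w \<oplus> w') \<otimes> a" using a b by (simp add: l_distr)
  then show "x \<oplus> y \<in> colon R a b" unfolding colon_def using w by blast
next
  fix r x assume r: "r \<in> carrier R" and "x \<in> colon R a b"
  then obtain w where w: "x \<in> carrier R" "w \<in> carrier R" "x \<otimes> b = w \<otimes> a"
    unfolding colon_def by blast
  then have "(r \<otimes> x) \<otimes> b = (r \<otimes> w) \<otimes> a" using a b r by (simp add: m_assoc)
  then show "r \<otimes> x \<in> colon R a b" unfolding colon_def using w r by blast
qed (auto simp: colon_def)

text \<open>
  A maximal member of the ideals \<open>(a : b)\<close>, with \<open>b\<close> a multiple of \<open>b0\<close> none of whose \<open>S\<close>-multiples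
  lies in \<open>(a)\<close>, is prime: an associated prime of \<open>R / (a)\<close> that avoids \<open>S\<close>.
\<close>

lemma (in noetherian_ring) exists_associated_prime:
  assumes cring: "cring R" and a: "a \<in> carrier R" and b0: "b0 \<in> carrier R"
    and S: "S \<subseteq> carrier R" "\<one> \<in> S" "\<And>s s'. s \<in> S \<Longrightarrow> s' \<in> S \<Longrightarrow> s \<otimes> s' \<in> S"
    and disj: "S \<inter> colon R a b0 = {}"
  obtains b where "b \<in> carrier R" "primeideal (colon R a b) R" "S \<inter> colon R a b = {}"
    "colon R a b0 \<subseteq> colon R a b"
proof -
  interpret cring R by fact
  define B where "B = {b \<in> carrier R. S \<inter> colon R a b = {} \<and> (\<exists>r\<in>carrier R. b = r \<otimes> b0)}"
  have "b0 \<in> B" unfolding B_def using b0 disj by (auto intro!: bexI[of _ \<one>])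
  then obtain J where J: "J \<in> colon R a ` B" "\<And>K. K \<in> colon R a ` B \<Longrightarrow> J \<subseteq> K \<Longrightarrow> K = J"
    by (rule_tac exists_maximal_ideal_in[of "colon R a ` B"]) (auto simp: B_def intro: colon_ideal[OF a])
  then obtain b where b: "b \<in> B" "J = colon R a b" by blast
  then have bc: "b \<in> carrier R" and bS: "S \<inter> colon R a b = {}" by (auto simp: B_def)
  have max: "colon R a (x \<otimes> b) = colon R a b"
    if x: "x \<in> carrier R" and "S \<inter> colon R a (x \<otimes> b) = {}" for x
  proof -
    obtain r where "r \<in> carrier R" "b = r \<otimes> b0" using b(1) unfolding B_def by blast
    then have "x \<otimes> b = (x \<otimes> r) \<otimes> b0" "x \<otimes> r \<in> carrier R" using x b0 by (auto simp: m_assoc)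
    then have "x \<otimes> b \<in> B" using that bc unfolding B_def by blast
    moreover have "colon R a b \<subseteq> colon R a (x \<otimes> b)"
    proof
      fix q assume "q \<in> colon R a b"
      then obtain w where w: "q \<in> carrier R" "w \<in> carrier R" "q \<otimes> b = w \<otimes> a" unfolding colon_def by blast
      have "q \<otimes> (x \<otimes> b) = x \<otimes> (q \<otimes> b)" using w(1) x bc by (simp add: m_ac)
      then have "q \<otimes> (x \<otimes> b) = (x \<otimes> w) \<otimes> a" unfolding w(3) using w(2) x a by (simp add: m_assoc)
      then show "q \<in> colon R a (x \<otimes> b)" unfolding colon_def using w x by blast
    qed
    ultimately show ?thesis using J(2) b(2) by blast
  qed
  have swap: "x \<in> colon R a (y \<otimes> b) \<longleftrightarrow> x \<otimes> y \<in> colon R a b" if "x \<in> carrier R" "y \<in> carrier R" for x y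
    using that bc by (simp add: colon_def m_assoc)
  have "primeideal (colon R a b) R"
  proof (rule primeidealI)
    show "ideal (colon R a b) R" by (rule colon_ideal[OF a bc])
    show "cring R" by fact
    show "carrier R \<noteq> colon R a b" using bS S(2) by blast
    fix x y assume x: "x \<in> carrier R" and y: "y \<in> carrier R" and xy: "x \<otimes> y \<in> colon R a b"
    show "x \<in> colon R a b \<or> y \<in> colon R a b"
    proof (cases "S \<inter> colon R a (x \<otimes> b) = {}")
      case True
      moreover have "y \<in> colon R a (x \<otimes> b)" unfolding swap[OF y x] using xy x y by (simp add: m_comm)
      ultimately show ?thesis using max[OF x] by blast
    next
      case False
      then obtain s where s: "s \<in> S" "s \<in> colon R a (x \<otimes> b)" by blast
      then have sc: "s \<in> carrier R" using S(1) by blast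
      have "x \<in> colon R a (s \<otimes> b)" unfolding swap[OF x sc] using s(2) x sc by (simp add: swap m_comm)
      moreover have "S \<inter> colon R a (s \<otimes> b) = {}"
      proof -
        have "s' \<notin> colon R a (s \<otimes> b)" if "s' \<in> S" for s'
          using that S(1,3) sc bS s(1) swap[of s' s] by blast
        then show ?thesis by blast
      qed
      ultimately show ?thesis using max[OF sc] by blast
    qed
  qed
  moreover have "colon R a b0 \<subseteq> colon R a b"
  proof
    fix q assume "q \<in> colon R a b0"
    then obtain w where w: "q \<in> carrier R" "w \<in> carrier R" "q \<otimes> b0 = w \<otimes> a" unfolding colon_def by blast
    obtain r where r: "r \<in> carrier R" "b = r \<otimes> b0" using b(1) unfolding B_def by blast
    have "q \<otimes> b = r \<otimes> (q \<otimes> b0)" unfolding r(2) using w(1) r(1) b0 by (simp add: m_ac)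
    then have "q \<otimes> b = (r \<otimes> w) \<otimes> a" unfolding w(3) using w(2) r(1) a by (simp add: m_assoc)
    then show "q \<in> colon R a b" unfolding colon_def using w r by blast
  qed
  ultimately show thesis using that bc bS by blast
qed

lemma finsum_self_module:
  assumes "cring R" "finite A" "f \<in> A \<rightarrow> carrier R"
  shows "finsum (self_module R) f A = finsum R f A"
proof -
  interpret cring R by fact
  interpret S: module R "self_module R" by (rule module_self_module[OF assms(1)])
  show ?thesis
    using assms(2,3)
  proof (induction A)
    case empty
    show ?case unfolding S.M.finsum_empty by (simp add: ring_module_def)
  next
    case (insert x A)
    then have "finsum (self_module R) f (insert x A) = f x \<oplus>\<^bsub>self_module R\<^esub> finsum (self_module R) f A"
      by (intro S.M.finsum_insert) (auto simp: ring_module_def)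
    moreover have "(\<oplus>\<^bsub>self_module R\<^esub>) = (\<oplus>\<^bsub>R\<^esub>)" by (simp add: ring_module_def)
    ultimately show ?case using insert by (simp add: Pi_iff)
  qed
qed

text \<open>
  If \<open>b / a\<close> maps an element \<open>c 0 \<noteq> 0\<close> around inside \<open>R\<close> for ever, the ideals generated by the
  initial segments of the orbit become stationary, which is an integral equation for \<open>b / a\<close>.
\<close>

lemma (in noetherian_domain) integral_if_orbit:
  assumes a: "a \<in> carrier R" "a \<noteq> \<zero>" and b: "b \<in> carrier R"
    and c: "\<And>n. c n \<in> carrier R" "c 0 \<noteq> \<zero>" "\<And>n. b \<otimes> c n = c (Suc n) \<otimes> a"
  shows "integral_over_base R (fraction R b a)"
proof -
  interpret S: module R "self_module R" by (rule module_self_module[OF is_cring])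
  let ?K = "total_fractions R" and ?y = "fraction R b a"
  interpret K: cring ?K by (rule cring_total_fractions)
  interpret h: ring_hom_cring R ?K "to_fractions R" by (rule to_fractions_ring_hom)
  note nzd = nonzerodivisors_eq
  have yK: "?y \<in> carrier ?K" using a b nzd by (simp add: fraction_closed)
  define J where "J n = genideal R (c ` {..<n})" for n :: nat
  have sub: "c ` {..<n} \<subseteq> carrier R" for n using c(1) by blast
  have "ideal I R" if "I \<in> range J" for I
    using that genideal_ideal[OF sub] unfolding J_def by blast
  then obtain I where I: "I \<in> range J" "\<And>K. K \<in> range J \<Longrightarrow> I \<subseteq> K \<Longrightarrow> K = I"
    using exists_maximal_ideal_in[of "range J"] by blast
  then obtain n where n: "I = J n" by blast
  have mono: "J n \<subseteq> J (Suc n)"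
    unfolding J_def
    by (rule genideal_minimal[OF genideal_ideal[OF sub]])
       (use genideal_self[OF sub, of "Suc n"] in auto)
  have "c n \<in> J (Suc n)"
    using genideal_self[OF sub, of "Suc n"] unfolding J_def by blast
  then have "c n \<in> J n" using I(2)[of "J (Suc n)"] mono n by blast
  then have mcn: "\<ominus> c n \<in> J n"
    using additive_subgroup.a_inv_closed[OF ideal.axioms(1)[OF genideal_ideal[OF sub]]]
    unfolding J_def by blast
  define comb where "comb d = (\<Oplus>\<^bsub>self_module R\<^esub>i\<in>{..<n}. d i \<odot>\<^bsub>self_module R\<^esub> c i)" for d
  have lin: "linear_map R (free_module R {..<n}) (self_module R) comb"
    unfolding comb_def
    by (rule linear_map_combination[OF S.module_axioms]) (use c(1) in \<open>auto simp: ring_module_def\<close>)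
  have L: "submodule (comb ` carrier (free_module R {..<n})) R (self_module R)" (is "submodule ?L _ _")
    by (rule linear_map_image_submodule[OF lin module_free_module[OF is_cring] S.module_axioms])
  have "ideal ?L R"
    using S.submodule_image_ideal[OF L, of "\<lambda>x. x"] S.submoduleE(1)[OF L]
    by (auto simp: ring_module_def)
  moreover have "c ` {..<n} \<subseteq> ?L"
  proof
    fix x assume "x \<in> c ` {..<n}"
    then obtain i where i: "i \<in> {..<n}" "x = c i" by blast
    have "comb (unit_vector R {..<n} i) = c i"
      unfolding comb_def
      by (rule combination_unit_vector[OF S.module_axioms _ _ i(1)]) (use c(1) in \<open>auto simp: ring_module_def\<close>)
    moreover have "unit_vector R {..<n} i \<in> carrier (free_module R {..<n})"
      by (simp add: unit_vector_closed)
    ultimately show "x \<in> ?L" unfolding i(2) by (metis imageI)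
  qed
  ultimately have "J n \<subseteq> ?L" unfolding J_def by (rule genideal_minimal)
  then obtain d where d: "d \<in> {..<n} \<rightarrow>\<^sub>E carrier R" "\<ominus> c n = comb d" using mcn by auto
  have comb_eq: "comb d = (\<Oplus>i\<in>{..<n}. d i \<otimes> c i)"
    unfolding comb_def using finsum_self_module[OF is_cring, of "{..<n}" "\<lambda>i. d i \<otimes> c i"] d(1) c(1)
    by (auto simp: ring_module_def PiE_iff)
  have n0: "n > 0"
  proof (rule ccontr)
    assume "\<not> n > 0"
    then have "\<ominus> c 0 = \<zero>" using d(2) comb_eq by simp
    then show False using c(1,2) by (metis minus_minus minus_zero)
  qed
  have orbit: "to_fractions R (c i) = ?y [^]\<^bsub>?K\<^esub> i \<otimes>\<^bsub>?K\<^esub> to_fractions R (c 0)" for i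
  proof (induction i)
    case (Suc i)
    have "?y \<otimes>\<^bsub>?K\<^esub> to_fractions R (c i) = fraction R (b \<otimes> c i) a"
      using a b c(1) nzd by (simp add: to_fractions_def fraction_mult one_nonzerodivisor)
    also have "\<dots> = to_fractions R (c (Suc i))"
      unfolding c(3) using a c(1) nzd
      by (simp add: to_fractions_def fraction_eq_iff one_nonzerodivisor)
    finally show ?case unfolding Suc using yK c(1) by (simp add: K.m_ac)
  qed (use c(1) in simp)
  let ?t = "\<lambda>i. to_fractions R (d i) \<otimes>\<^bsub>?K\<^esub> ?y [^]\<^bsub>?K\<^esub> i"
  have dc: "d i \<in> carrier R" if "i < n" for i using d(1) that by auto
  have t: "?t \<in> {..<n} \<rightarrow> carrier ?K" using dc yK by auto
  let ?z = "?y [^]\<^bsub>?K\<^esub> n \<oplus>\<^bsub>?K\<^esub> (\<Oplus>\<^bsub>?K\<^esub>i\<in>{..<n}. ?t i)"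
  have "(\<Oplus>\<^bsub>?K\<^esub>i\<in>{..<n}. ?t i) \<otimes>\<^bsub>?K\<^esub> to_fractions R (c 0) =
      (\<Oplus>\<^bsub>?K\<^esub>i\<in>{..<n}. ?t i \<otimes>\<^bsub>?K\<^esub> to_fractions R (c 0))"
    using t c(1) by (intro K.finsum_ldistr) auto
  also have "\<dots> = (\<Oplus>\<^bsub>?K\<^esub>i\<in>{..<n}. to_fractions R (d i \<otimes> c i))"
    by (rule K.finsum_cong') (use dc c(1) yK in \<open>auto simp: orbit[symmetric] K.m_assoc\<close>)
  also have "\<dots> = to_fractions R (\<ominus> c n)"
    unfolding d(2) comb_eq using dc c(1) by (subst h.hom_finsum) (auto simp: comp_def)
  finally have "?z \<otimes>\<^bsub>?K\<^esub> to_fractions R (c 0) = \<zero>\<^bsub>?K\<^esub>"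
    using yK c(1) K.finsum_closed[OF t] by (simp add: K.l_distr orbit[of n, symmetric] K.r_neg)
  then have "to_fractions R (c 0) \<otimes>\<^bsub>?K\<^esub> ?z = to_fractions R (c 0) \<otimes>\<^bsub>?K\<^esub> \<zero>\<^bsub>?K\<^esub>"
    using yK c(1) K.finsum_closed[OF t] by (simp add: K.m_comm)
  then have "?z = \<zero>\<^bsub>?K\<^esub>"
    by (rule to_fractions_smult_cancel[rotated -1])
       (use yK c(1,2) K.finsum_closed[OF t] nzd in auto)
  then show ?thesis unfolding integral_over_base_def using n0 dc by (intro exI[of _ n] conjI bexI[of _ d]) auto
qed

section \<open>Uniformizers and valuations\<close>

text \<open>The condition \<open>P R\<^sub>P = t R\<^sub>P\<close> with denominators cleared.\<close>

definition uniformizer_at :: "('a, 'b) ring_scheme \<Rightarrow> 'a set \<Rightarrow> 'a \<Rightarrow> bool"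
  where "uniformizer_at R P t \<longleftrightarrow>
    t \<in> P \<and> (\<forall>x\<in>P. \<exists>u\<in>carrier R - P. \<exists>w\<in>carrier R. u \<otimes>\<^bsub>R\<^esub> x = w \<otimes>\<^bsub>R\<^esub> t)"

text \<open>
  For \<open>P = (a : b)\<close> the fraction \<open>b / a\<close> maps \<open>P\<close> into \<open>R\<close>. It cannot map \<open>P\<close> into \<open>P\<close>: it would be
  integral, hence in \<open>R\<close>, and \<open>1 \<in> (a : b)\<close>. A \<open>t \<in> P\<close> with image outside \<open>P\<close> is a uniformizer.
\<close>

lemma (in noetherian_domain) associated_prime_uniformizer:
  assumes normal: "normal_domain R" and a: "a \<in> carrier R" "a \<noteq> \<zero>" and b: "b \<in> carrier R"
    and P: "primeideal (colon R a b) R"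
  shows "\<exists>t. uniformizer_at R (colon R a b) t"
proof -
  let ?P = "colon R a b"
  interpret P: primeideal ?P R by fact
  have "\<forall>x\<in>?P. \<exists>w. w \<in> carrier R \<and> x \<otimes> b = w \<otimes> a" unfolding colon_def by blast
  then obtain y where y: "\<And>x. x \<in> ?P \<Longrightarrow> y x \<in> carrier R" "\<And>x. x \<in> ?P \<Longrightarrow> x \<otimes> b = y x \<otimes> a"
    by metis
  have PR: "\<And>x. x \<in> ?P \<Longrightarrow> x \<in> carrier R" by (rule P.Icarr)
  show ?thesis
  proof (cases "\<forall>x\<in>?P. y x \<in> ?P")
    case True
    \<comment> \<open>The orbit of \<open>a\<close> itself, which lies in \<open>P\<close>, under multiplication by \<open>b / a\<close>.\<close>
    define c where "c n = (y ^^ n) a" for n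
    have "a \<otimes> b = b \<otimes> a" using a b by (simp add: m_comm)
    then have aP: "a \<in> ?P" unfolding colon_def using a b by blast
    have cP: "c n \<in> ?P" for n by (induction n) (use aP True in \<open>auto simp: c_def\<close>)
    have "integral_over_base R (fraction R b a)"
    proof (rule integral_if_orbit[OF a b, of c])
      show "c n \<in> carrier R" for n using cP PR by blast
      show "c 0 \<noteq> \<zero>" using a by (simp add: c_def)
      show "b \<otimes> c n = c (Suc n) \<otimes> a" for n
        using y(2)[OF cP[of n]] b PR[OF cP] by (simp add: c_def m_comm)
    qed
    moreover have anz: "a \<in> nonzerodivisors R"
      using a by (simp add: nonzerodivisors_eq)
    ultimately obtain r where r: "r \<in> carrier R" "fraction R b a = to_fractions R r"
      using normal fraction_closed[OF b anz] unfolding normal_domain_def by blast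
    then have "b = r \<otimes> a"
      using a b anz by (simp add: to_fractions_def fraction_eq_iff one_nonzerodivisor)
    then have "\<one> \<in> ?P" unfolding colon_def using r b by auto
    then show ?thesis using P.one_imp_carrier P.I_notcarr by blast
  next
    case False
    then obtain t where t: "t \<in> ?P" "y t \<notin> ?P" by blast
    have "y t \<otimes> x = y x \<otimes> t" if x: "x \<in> ?P" for x
    proof -
      note cl = x[THEN PR] t(1)[THEN PR] y(1)[OF x] y(1)[OF t(1)] a b
      have "a \<otimes> (y t \<otimes> x) = (t \<otimes> b) \<otimes> x" unfolding y(2)[OF t(1)] using cl by (simp add: m_ac)
      also have "\<dots> = t \<otimes> (x \<otimes> b)" using cl by (simp add: m_ac)
      also have "\<dots> = a \<otimes> (y x \<otimes> t)" unfolding y(2)[OF x] using cl by (simp add: m_ac)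
      finally show ?thesis using cl by (simp add: m_lcancel)
    qed
    then show ?thesis using t y(1) unfolding uniformizer_at_def by blast
  qed
qed

lemma (in noetherian_domain) height_one_prime_nonzero:
  assumes "P \<in> height_one_primes R" shows "primeideal P R" "P \<noteq> {\<zero>}"
proof -
  obtain Q where Q: "primeideal P R" "primeideal Q R" "Q \<subset> P"
    using assms unfolding height_one_primes_def by blast
  have "\<zero> \<in> Q" using Q(2) by (simp add: primeideal.axioms(1) additive_subgroup.zero_closed ideal.axioms(1))
  then show "primeideal P R" "P \<noteq> {\<zero>}" using Q by blast+
qed

text \<open>
  For \<open>0 \<noteq> a \<in> P\<close> an associated prime of \<open>R / (a)\<close> that avoids \<open>R - P\<close> is nonzero and contained in \<open>P\<close>,
  hence equal to \<open>P\<close> as \<open>P\<close> has height one.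
\<close>

lemma (in noetherian_domain) height_one_uniformizer:
  assumes normal: "normal_domain R" and P: "P \<in> height_one_primes R"
  shows "\<exists>t. uniformizer_at R P t"
proof -
  interpret P: primeideal P R by (rule height_one_prime_nonzero[OF P])
  have "\<zero> \<in> P" by simp
  then obtain a where a: "a \<in> P" "a \<noteq> \<zero>" using height_one_prime_nonzero(2)[OF P] by blast
  then have aR: "a \<in> carrier R" by (simp add: P.Icarr)
  have 1: "(carrier R - P) \<inter> colon R a \<one> = {}"
  proof -
    have "s \<in> P" if s: "s \<in> colon R a \<one>" for s
    proof -
      obtain w where "s \<in> carrier R" "w \<in> carrier R" "s \<otimes> \<one> = w \<otimes> a" using s unfolding colon_def by blast
      then show ?thesis using P.I_l_closed[OF a(1)] by simp
    qed
    then show ?thesis by blast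
  qed
  have 2: "\<one> \<in> carrier R - P" using P.one_imp_carrier P.I_notcarr by auto
  have 3: "s \<otimes> s' \<in> carrier R - P" if "s \<in> carrier R - P" "s' \<in> carrier R - P" for s s'
    using that P.I_prime by auto
  obtain b where b: "b \<in> carrier R" "primeideal (colon R a b) R"
    "(carrier R - P) \<inter> colon R a b = {}" "colon R a \<one> \<subseteq> colon R a b"
    by (rule exists_associated_prime[OF is_cring aR one_closed _ 2 3 1]) auto
  have "colon R a b \<subseteq> P" using b(3) unfolding colon_def by blast
  moreover have "a \<in> colon R a b"
    using aR b(1) m_comm[OF aR b(1)] unfolding colon_def by blast
  then have "{\<zero>} \<subset> colon R a b"
    using a(2) additive_subgroup.zero_closed[OF ideal.axioms(1)[OF primeideal.axioms(1)[OF b(2)]]] by blast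
  ultimately have "colon R a b = P"
    using P b(2) zeroprimeideal unfolding height_one_primes_def by blast
  then show ?thesis using associated_prime_uniformizer[OF normal aR a(2) b(1,2)] by simp
qed

text \<open>
  A choice for each prime, so that valuations at different primes can be compared; the value is
  arbitrary if there is no uniformizer.
\<close>

definition uniformizer :: "('a, 'b) ring_scheme \<Rightarrow> 'a set \<Rightarrow> 'a"
  where "uniformizer R P = (SOME t. uniformizer_at R P t)"

text \<open>
  The exponent \<open>n\<close> in \<open>a = (v / u) t\<^sup>n\<close> with \<open>v / u\<close> a unit of \<open>R\<^sub>P\<close>. Only meaningful for \<open>a \<noteq> 0\<close>.
\<close>

definition nat_val :: "('a, 'b) ring_scheme \<Rightarrow> 'a set \<Rightarrow> 'a \<Rightarrow> nat"
  where "nat_val R P a = (THE n. \<exists>u\<in>carrier R - P. \<exists>v\<in>carrier R - P.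
    u \<otimes>\<^bsub>R\<^esub> a = v \<otimes>\<^bsub>R\<^esub> uniformizer R P [^]\<^bsub>R\<^esub> n)"

locale valued_prime = noetherian_domain R + P: primeideal P R for R (structure) and P +
  assumes exists_uniformizer: "\<exists>t. uniformizer_at R P t" and nonzero: "P \<noteq> {\<zero>}"
begin

abbreviation "t \<equiv> uniformizer R P"
abbreviation "val \<equiv> nat_val R P"
abbreviation "K \<equiv> total_fractions R"

lemma t_uniformizer: "uniformizer_at R P t"
  unfolding uniformizer_def using exists_uniformizer by (rule someI_ex)

lemma t_in: "t \<in> P" and t_divides: "x \<in> P \<Longrightarrow> \<exists>u\<in>carrier R - P. \<exists>w\<in>carrier R. u \<otimes> x = w \<otimes> t"
  using t_uniformizer by (auto simp: uniformizer_at_def)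

lemma t_closed [simp]: "t \<in> carrier R" using t_in by (rule P.Icarr)

lemma not_in_nonzero: "u \<in> carrier R - P \<Longrightarrow> u \<noteq> \<zero>" by auto

lemma mult_not_in: "u \<in> carrier R - P \<Longrightarrow> v \<in> carrier R - P \<Longrightarrow> u \<otimes> v \<in> carrier R - P"
  using P.I_prime by auto

lemma one_not_in: "\<one> \<in> carrier R - P"
  using P.one_imp_carrier P.I_notcarr by auto

lemma t_nonzero: "t \<noteq> \<zero>"
proof
  assume t: "t = \<zero>"
  have "x = \<zero>" if x: "x \<in> P" for x
  proof -
    obtain u w where u: "u \<in> carrier R - P" "w \<in> carrier R" "u \<otimes> x = w \<otimes> t"
      using t_divides[OF x] by blast
    then have "u \<otimes> x = \<zero>" using t by simp
    then show ?thesis using integral u(1) not_in_nonzero P.Icarr[OF x] by blast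
  qed
  moreover have "\<zero> \<in> P" by simp
  ultimately show False using nonzero by blast
qed

lemma pow_nonzero: "x \<in> carrier R \<Longrightarrow> x \<noteq> \<zero> \<Longrightarrow> x [^] (n::nat) \<noteq> \<zero>"
proof (induction n)
  case (Suc n)
  then show ?case using integral[of "x [^] n" x] by auto
qed simp

text \<open>
  If \<open>a\<close> cannot be exhausted by extracting factors \<open>t\<close>, the contractions of \<open>a R\<^sub>P\<close>, \<open>(a / t) R\<^sub>P\<close>, \dots
  form a strictly ascending chain of ideals.
\<close>

lemma exists_val:
  assumes "a \<in> carrier R" "a \<noteq> \<zero>"
  shows "\<exists>n. \<exists>u\<in>carrier R - P. \<exists>v\<in>carrier R - P. u \<otimes> a = v \<otimes> t [^] (n::nat)"
proof (rule ccontr)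
  define good where "good b \<longleftrightarrow> (\<exists>n. \<exists>u\<in>carrier R - P. \<exists>v\<in>carrier R - P. u \<otimes> b = v \<otimes> t [^] (n::nat))" for b
  define Bad where "Bad = {b \<in> carrier R. b \<noteq> \<zero> \<and> \<not> good b}"
  define J where "J b = {r \<in> carrier R. \<exists>u\<in>carrier R - P. \<exists>w\<in>carrier R. u \<otimes> r = w \<otimes> b}" for b
  have JI: "r \<in> J b" if "r \<in> carrier R" "u \<in> carrier R - P" "w \<in> carrier R" "u \<otimes> r = w \<otimes> b" for r u w b
    using that unfolding J_def by blast
  have JE: "\<exists>u w. r \<in> carrier R \<and> u \<in> carrier R - P \<and> w \<in> carrier R \<and> u \<otimes> r = w \<otimes> b" if "r \<in> J b" for r b
    using that unfolding J_def by blast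
  have J: "ideal (J b) R" if b: "b \<in> carrier R" for b
  proof (rule cring_idealI)
    show "\<zero> \<in> J b" by (rule JI[OF zero_closed one_not_in zero_closed]) (use b in simp)
    fix r s assume "r \<in> J b" "s \<in> J b"
    then obtain u w u' w' where *: "r \<in> carrier R" "u \<in> carrier R - P" "w \<in> carrier R" "u \<otimes> r = w \<otimes> b"
      "s \<in> carrier R" "u' \<in> carrier R - P" "w' \<in> carrier R" "u' \<otimes> s = w' \<otimes> b"
      by (metis JE)
    have uu: "u \<in> carrier R" "u' \<in> carrier R" using * by auto
    have "(u \<otimes> u') \<otimes> (r \<oplus> s) = u' \<otimes> (u \<otimes> r) \<oplus> u \<otimes> (u' \<otimes> s)"
      using *(1,5) uu by (simp add: r_distr m_ac)
    also have "\<dots> = (u' \<otimes> w \<oplus> u \<otimes> w') \<otimes> b"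
      unfolding *(4,8) using *(1,3,5,7) uu b by (simp add: l_distr m_assoc)
    finally show "r \<oplus> s \<in> J b"
      by (rule JI[rotated 3]) (use * uu mult_not_in in auto)
  next
    fix x r assume x: "x \<in> carrier R" and "r \<in> J b"
    then obtain u w where *: "r \<in> carrier R" "u \<in> carrier R - P" "w \<in> carrier R" "u \<otimes> r = w \<otimes> b"
      by (metis JE)
    have uu: "u \<in> carrier R" using * by auto
    have "u \<otimes> (x \<otimes> r) = x \<otimes> (u \<otimes> r)" using *(1) uu x by (simp add: m_ac)
    also have "\<dots> = (x \<otimes> w) \<otimes> b" unfolding *(4) using *(3) x b by (simp add: m_assoc)
    finally show "x \<otimes> r \<in> J b" by (rule JI[rotated 3]) (use * x in auto)
  qed (auto simp: J_def)
  assume "\<not> (\<exists>n. \<exists>u\<in>carrier R - P. \<exists>v\<in>carrier R - P. u \<otimes> a = v \<otimes> t [^] (n::nat))"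
  then have "a \<in> Bad" using assms by (simp add: Bad_def good_def)
  then obtain I where I: "I \<in> J ` Bad" "\<And>K. K \<in> J ` Bad \<Longrightarrow> I \<subseteq> K \<Longrightarrow> K = I"
    by (rule_tac exists_maximal_ideal_in[of "J ` Bad"]) (auto simp: Bad_def intro: J)
  then obtain b where b: "b \<in> Bad" "I = J b" by blast
  then have bR: "b \<in> carrier R" "b \<noteq> \<zero>" "\<not> good b" by (auto simp: Bad_def)
  have "b \<in> P"
  proof (rule ccontr)
    assume "b \<notin> P"
    moreover have "\<one> \<otimes> b = b \<otimes> t [^] (0::nat)" using bR by simp
    ultimately have "good b" unfolding good_def using bR(1) one_not_in by blast
    then show False using bR by simp
  qed
  then obtain u b' where u: "u \<in> carrier R - P" "b' \<in> carrier R" "u \<otimes> b = b' \<otimes> t"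
    using t_divides by blast
  have uR: "u \<in> carrier R" using u by simp
  have "b' \<noteq> \<zero>"
  proof
    assume "b' = \<zero>"
    then have "u \<otimes> b = \<zero>" using u(3) by simp
    then show False using integral uR bR not_in_nonzero[OF u(1)] by blast
  qed
  moreover have "\<not> good b'"
  proof
    assume "good b'"
    then obtain n x v where x: "x \<in> carrier R - P" "v \<in> carrier R - P" "x \<otimes> b' = v \<otimes> t [^] (n::nat)"
      unfolding good_def by blast
    then have xR: "x \<in> carrier R" "v \<in> carrier R" by auto
    have "(x \<otimes> u) \<otimes> b = (x \<otimes> b') \<otimes> t" using xR uR u bR by (simp add: m_assoc)
    also have "\<dots> = v \<otimes> t [^] Suc n" unfolding x(3) using xR by (simp add: m_assoc)
    finally show False using bR(3) mult_not_in[OF x(1) u(1)] x(2) unfolding good_def by blast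
  qed
  ultimately have b'B: "b' \<in> Bad" using u(2) by (simp add: Bad_def)
  have "J b \<subseteq> J b'"
  proof
    fix r assume "r \<in> J b"
    then obtain x w where x: "r \<in> carrier R" "x \<in> carrier R - P" "w \<in> carrier R" "x \<otimes> r = w \<otimes> b"
      by (metis JE)
    have xR: "x \<in> carrier R" using x by simp
    have "(u \<otimes> x) \<otimes> r = w \<otimes> (u \<otimes> b)" using x(1,3) xR uR bR
      by (simp add: m_assoc x(4)) (simp add: m_ac)
    also have "\<dots> = (w \<otimes> t) \<otimes> b'" unfolding u(3) using x(3) u(2) by (simp add: m_ac)
    finally show "r \<in> J b'" by (rule JI[rotated 3]) (use x u mult_not_in in auto)
  qed
  then have "J b' = J b" using I(2)[of "J b'"] b b'B by blast
  moreover have "b' \<in> J b'" by (rule JI[OF u(2) one_not_in one_closed]) simp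
  ultimately obtain v w where v: "v \<in> carrier R - P" "w \<in> carrier R" "v \<otimes> b' = w \<otimes> b"
    by (metis JE)
  have vR: "v \<in> carrier R" using v by simp
  have "b \<otimes> (v \<otimes> u) = v \<otimes> (u \<otimes> b)" using vR uR bR by (simp add: m_ac)
  also have "\<dots> = (v \<otimes> b') \<otimes> t" unfolding u(3) using vR u(2) by (simp add: m_assoc)
  also have "\<dots> = b \<otimes> (w \<otimes> t)" unfolding v(3) using v(2) bR by (simp add: m_ac)
  finally have "v \<otimes> u = w \<otimes> t" using m_lcancel[OF bR(2,1)] vR uR v(2) by simp
  then have "v \<otimes> u \<in> P" using P.I_l_closed[OF t_in v(2)] by simp
  then show False using mult_not_in[OF v(1) u(1)] by simp
qed

text \<open>
  For \<open>n > m\<close>, cancelling \<open>t\<^sup>m\<close> would exhibit the product \<open>u' v\<close> of elements outside \<open>P\<close> as a multiple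
  of \<open>t\<close>. With \<open>w\<close> outside \<open>P\<close> this gives uniqueness of the exponent, with \<open>w\<close> arbitrary the usual lower
  bounds for valuations.
\<close>

lemma val_bound:
  assumes u: "u \<in> carrier R - P" "v \<in> carrier R - P" "u \<otimes> a = v \<otimes> t [^] (m::nat)"
    and u': "u' \<in> carrier R - P" "w \<in> carrier R" "u' \<otimes> a = w \<otimes> t [^] (n::nat)"
    and a: "a \<in> carrier R"
  shows "n \<le> m"
proof (rule ccontr)
  assume "\<not> n \<le> m"
  then obtain k where k: "n = m + Suc k" by (metis add_Suc_right less_imp_Suc_add not_le)
  have cl: "u \<in> carrier R" "v \<in> carrier R" "u' \<in> carrier R" using u u' by auto
  have "t [^] m \<otimes> (u' \<otimes> v) = u' \<otimes> (u \<otimes> a)" unfolding u(3) using cl by (simp add: m_ac)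
  also have "\<dots> = u \<otimes> (u' \<otimes> a)" using cl a by (simp add: m_ac)
  also have "\<dots> = u \<otimes> (w \<otimes> (t [^] m \<otimes> t [^] Suc k))" unfolding u'(3) k nat_pow_mult[OF t_closed] ..
  also have "\<dots> = t [^] m \<otimes> (u \<otimes> w \<otimes> t [^] k \<otimes> t)" using cl u'(2) by (simp add: m_ac)
  finally have "u' \<otimes> v = u \<otimes> w \<otimes> t [^] k \<otimes> t"
    using m_lcancel[of "t [^] m" "u' \<otimes> v" "u \<otimes> w \<otimes> t [^] k \<otimes> t"] pow_nonzero[OF t_closed t_nonzero] cl u'(2) by simp
  then have "u' \<otimes> v \<in> P" using P.I_l_closed[OF t_in, of "u \<otimes> w \<otimes> t [^] k"] cl u'(2) by simp
  then show False using mult_not_in[OF u'(1) u(2)] by simp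
qed

lemma val_eqI:
  assumes "u \<in> carrier R - P" "v \<in> carrier R - P" "u \<otimes> a = v \<otimes> t [^] (n::nat)" "a \<in> carrier R"
  shows "val a = n"
  unfolding nat_val_def
proof (rule the_equality)
  show "\<exists>u\<in>carrier R - P. \<exists>v\<in>carrier R - P. u \<otimes> a = v \<otimes> t [^] n" using assms by blast
  fix m :: nat assume "\<exists>u\<in>carrier R - P. \<exists>v\<in>carrier R - P. u \<otimes> a = v \<otimes> t [^] (m::nat)"
  then obtain u' v' where "u' \<in> carrier R - P" "v' \<in> carrier R - P" "u' \<otimes> a = v' \<otimes> t [^] m" by blast
  then show "m = n" using val_bound[of u v a n u' v' m] val_bound[of u' v' a m u v n] assms by simp
qed

lemma val_rep:
  assumes "a \<in> carrier R" "a \<noteq> \<zero>"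
  obtains u v where "u \<in> carrier R - P" "v \<in> carrier R - P" "u \<otimes> a = v \<otimes> t [^] val a"
  using exists_val[OF assms] val_eqI[OF _ _ _ assms(1)] by metis

lemma val_geI:
  assumes "a \<in> carrier R" "a \<noteq> \<zero>" "u \<in> carrier R - P" "w \<in> carrier R" "u \<otimes> a = w \<otimes> t [^] (n::nat)"
  shows "n \<le> val a"
  using val_rep[OF assms(1,2)] val_bound[OF _ _ _ assms(3-5,1)] by metis

lemma val_mult:
  assumes a: "a \<in> carrier R" "a \<noteq> \<zero>" and b: "b \<in> carrier R" "b \<noteq> \<zero>"
  shows "val (a \<otimes> b) = val a + val b"
proof -
  obtain u v where u: "u \<in> carrier R - P" "v \<in> carrier R - P" "u \<otimes> a = v \<otimes> t [^] val a"
    by (rule val_rep[OF a])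
  obtain u' v' where u': "u' \<in> carrier R - P" "v' \<in> carrier R - P" "u' \<otimes> b = v' \<otimes> t [^] val b"
    by (rule val_rep[OF b])
  have cl: "u \<in> carrier R" "v \<in> carrier R" "u' \<in> carrier R" "v' \<in> carrier R" using u u' by auto
  have "(u \<otimes> u') \<otimes> (a \<otimes> b) = (u \<otimes> a) \<otimes> (u' \<otimes> b)" using cl a b by (simp add: m_ac)
  also have "\<dots> = (v \<otimes> v') \<otimes> (t [^] val a \<otimes> t [^] val b)" unfolding u(3) u'(3) using cl by (simp add: m_ac)
  finally have "(u \<otimes> u') \<otimes> (a \<otimes> b) = (v \<otimes> v') \<otimes> t [^] (val a + val b)"
    by (simp add: nat_pow_mult)
  then show ?thesis by (rule val_eqI[rotated 2]) (use u u' a b mult_not_in in auto)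
qed

lemma val_not_in: "a \<in> carrier R - P \<Longrightarrow> val a = 0"
  by (rule val_eqI[of \<one> a]) (use one_not_in in auto)

lemma val_pos:
  assumes a: "a \<in> P" "a \<noteq> \<zero>" shows "1 \<le> val a"
proof -
  obtain u w where "u \<in> carrier R - P" "w \<in> carrier R" "u \<otimes> a = w \<otimes> t" using t_divides[OF a(1)] by blast
  then show ?thesis using val_geI[of a u w 1] a P.Icarr by simp
qed

lemma val_t: "val t = 1"
  by (rule val_eqI[of \<one> \<one>]) (use one_not_in in auto)

lemma val_pow: "a \<in> carrier R \<Longrightarrow> a \<noteq> \<zero> \<Longrightarrow> val (a [^] (n::nat)) = n * val a"
  by (induction n) (simp_all add: val_mult pow_nonzero val_not_in[OF one_not_in])

lemma val_add:
  assumes a: "a \<in> carrier R" "a \<noteq> \<zero>" "n \<le> val a" and b: "b \<in> carrier R" "b \<noteq> \<zero>" "n \<le> val b"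
    and ab: "a \<oplus> b \<noteq> \<zero>"
  shows "n \<le> val (a \<oplus> b)"
proof -
  obtain u v where u: "u \<in> carrier R - P" "v \<in> carrier R - P" "u \<otimes> a = v \<otimes> t [^] val a"
    by (rule val_rep[OF a(1,2)])
  obtain u' v' where u': "u' \<in> carrier R - P" "v' \<in> carrier R - P" "u' \<otimes> b = v' \<otimes> t [^] val b"
    by (rule val_rep[OF b(1,2)])
  have cl: "u \<in> carrier R" "v \<in> carrier R" "u' \<in> carrier R" "v' \<in> carrier R" using u u' by auto
  define w where "w = v \<otimes> t [^] (val a - n)"
  define w' where "w' = v' \<otimes> t [^] (val b - n)"
  have w: "w \<in> carrier R" "w' \<in> carrier R" using cl by (auto simp: w_def w'_def)
  have "u \<otimes> a = w \<otimes> t [^] n" "u' \<otimes> b = w' \<otimes> t [^] n"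
    using a(3) b(3) cl unfolding u(3) u'(3) w_def w'_def by (simp_all add: m_assoc nat_pow_mult)
  then have eq: "u \<otimes> a = w \<otimes> t [^] n" "u' \<otimes> b = w' \<otimes> t [^] n" .
  have "(u \<otimes> u') \<otimes> (a \<oplus> b) = u' \<otimes> (u \<otimes> a) \<oplus> u \<otimes> (u' \<otimes> b)"
    using cl a b by (simp add: r_distr m_ac)
  also have "\<dots> = (u' \<otimes> w \<oplus> u \<otimes> w') \<otimes> t [^] n"
    unfolding eq using cl w by (simp add: l_distr m_assoc)
  finally show ?thesis by (rule val_geI[rotated 4]) (use u u' w cl a b ab mult_not_in in auto)
qed

text \<open>
  A prime \<open>Q' \<subseteq> P\<close> that contains some \<open>c \<noteq> 0\<close> contains a power of \<open>t\<close>, because the unit factors of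
  \<open>c\<close> lie outside \<open>P\<close>; so it contains \<open>t\<close> and then all of \<open>P\<close>.
\<close>

lemma height_one: "P \<in> height_one_primes R"
proof -
  have "Q' = P" if Q': "primeideal Q' R" "Q' \<subseteq> P" "Q' \<noteq> {\<zero>}" for Q'
  proof -
    interpret Q: primeideal Q' R by fact
    have "\<zero> \<in> Q'" by simp
    then obtain c where c: "c \<in> Q'" "c \<noteq> \<zero>" using Q'(3) by blast
    obtain u v where u: "u \<in> carrier R - P" "v \<in> carrier R - P" "u \<otimes> c = v \<otimes> t [^] val c"
      by (rule val_rep[OF Q.Icarr[OF c(1)] c(2)])
    have "v \<otimes> t [^] val c \<in> Q'" unfolding u(3)[symmetric] using Q.I_l_closed[OF c(1)] u(1) by auto
    then have tn: "t [^] val c \<in> Q'" using Q.I_prime[of v "t [^] val c"] u(2) Q'(2) by auto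
    have tQ: "t \<in> Q'" if "t [^] n \<in> Q'" for n :: nat
      using that
    proof (induction n)
      case 0
      then show ?case using Q.one_imp_carrier Q.I_notcarr by auto
    next
      case (Suc n)
      then show ?case using Q.I_prime[of "t [^] n" t] by auto
    qed
    have "P \<subseteq> Q'"
    proof
      fix x assume x: "x \<in> P"
      then obtain y w where y: "y \<in> carrier R - P" "w \<in> carrier R" "y \<otimes> x = w \<otimes> t" using t_divides by blast
      then have "y \<otimes> x \<in> Q'" using Q.I_l_closed[OF tQ[OF tn]] by simp
      then show "x \<in> Q'" using Q.I_prime[of y x] y(1) Q'(2) P.Icarr[OF x] by auto
    qed
    then show ?thesis using Q'(2) by blast
  qed
  then have below: "Q' = {\<zero>}" if "primeideal Q' R" "Q' \<subset> P" for Q' using that by blast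
  have zero: "\<zero> \<in> Q" if "primeideal Q R" for Q
    using additive_subgroup.zero_closed[OF ideal.axioms(1)[OF primeideal.axioms(1)[OF that]]] .
  have "\<not> (\<exists>Q Q'. primeideal Q R \<and> primeideal Q' R \<and> Q' \<subset> Q \<and> Q \<subset> P)"
  proof
    assume "\<exists>Q Q'. primeideal Q R \<and> primeideal Q' R \<and> Q' \<subset> Q \<and> Q \<subset> P"
    then obtain Q Q' where "primeideal Q R" "primeideal Q' R" "Q' \<subset> Q" "Q \<subset> P" by blast
    then show False using below[of Q] zero[of Q'] by blast
  qed
  moreover have "{\<zero>} \<subset> P" using nonzero zero[OF P.primeideal] by blast
  ultimately show ?thesis
    unfolding height_one_primes_def using P.primeideal zeroprimeideal
    by (intro CollectI conjI) (auto intro!: exI[of _ "{\<zero>}"])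
qed

end

section \<open>The order of a fraction at a prime of height one\<close>

context valued_prime
begin

lemma localization_simps:
  "carrier (localization_at R P) = {fraction R a s | a s. a \<in> carrier R \<and> s \<in> carrier R - P}"
  "x \<otimes>\<^bsub>localization_at R P\<^esub> y = x \<otimes>\<^bsub>K\<^esub> y"
  "\<one>\<^bsub>localization_at R P\<^esub> = \<one>\<^bsub>K\<^esub>"
  by (simp_all add: localization_at_def)

lemma fraction_mult_nonzero:
  "a \<in> carrier R \<Longrightarrow> b \<in> carrier R \<Longrightarrow> s \<in> carrier R - {\<zero>} \<Longrightarrow> s' \<in> carrier R - {\<zero>} \<Longrightarrow>
   fraction R a s \<otimes>\<^bsub>K\<^esub> fraction R b s' = fraction R (a \<otimes> b) (s \<otimes> s')"
  by (simp add: fraction_mult nonzerodivisors_eq)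

lemma fraction_eq_iff_nonzero:
  "a \<in> carrier R \<Longrightarrow> b \<in> carrier R \<Longrightarrow> s \<in> carrier R - {\<zero>} \<Longrightarrow> s' \<in> carrier R - {\<zero>} \<Longrightarrow>
   fraction R a s = fraction R b s' \<longleftrightarrow> a \<otimes> s' = b \<otimes> s"
  by (simp add: fraction_eq_iff nonzerodivisors_eq)

lemma nonzero_mult: "a \<in> carrier R - {\<zero>} \<Longrightarrow> b \<in> carrier R - {\<zero>} \<Longrightarrow> a \<otimes> b \<in> carrier R - {\<zero>}"
  using integral by blast

lemma nonzero_pow: "a \<in> carrier R - {\<zero>} \<Longrightarrow> a [^] (n::nat) \<in> carrier R - {\<zero>}"
  using pow_nonzero by auto

lemma not_in_carrier_nonzero: "u \<in> carrier R - P \<Longrightarrow> u \<in> carrier R - {\<zero>}"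
  using not_in_nonzero by auto

lemma fraction_swap:
  assumes "x \<in> carrier R - {\<zero>}" "y \<in> carrier R - {\<zero>}"
  shows "fraction R x y \<otimes>\<^bsub>K\<^esub> fraction R y x = \<one>\<^bsub>K\<^esub>"
  unfolding total_fractions_one
  using assms nonzero_mult[OF assms(2,1)] one_not_zero
  by (simp add: fraction_mult_nonzero fraction_eq_iff_nonzero m_comm)

lemma Units_localization:
  assumes u: "u \<in> carrier R - P" and v: "v \<in> carrier R - P"
  shows "fraction R u v \<in> Units (localization_at R P)"
proof -
  note nz = not_in_carrier_nonzero[OF u] not_in_carrier_nonzero[OF v]
  have "fraction R v u \<otimes>\<^bsub>K\<^esub> fraction R u v = \<one>\<^bsub>K\<^esub>" "fraction R u v \<otimes>\<^bsub>K\<^esub> fraction R v u = \<one>\<^bsub>K\<^esub>"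
    by (rule fraction_swap[OF nz(2,1)], rule fraction_swap[OF nz])
  then show ?thesis
    using u v unfolding Units_def localization_simps by blast
qed

lemma Units_localization_cases:
  assumes "x \<in> Units (localization_at R P)"
  obtains u v where "u \<in> carrier R - P" "v \<in> carrier R - P" "x = fraction R u v"
proof -
  obtain y where y: "x \<in> carrier (localization_at R P)" "y \<in> carrier (localization_at R P)"
    "x \<otimes>\<^bsub>K\<^esub> y = \<one>\<^bsub>K\<^esub>"
    using assms unfolding Units_def localization_simps(2,3) by blast
  obtain u v where x: "u \<in> carrier R" "v \<in> carrier R - P" "x = fraction R u v"
    using y(1) unfolding localization_simps by blast
  obtain u' v' where y': "u' \<in> carrier R" "v' \<in> carrier R - P" "y = fraction R u' v'"
    using y(2) unfolding localization_simps by blast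
  note nz = not_in_carrier_nonzero[OF x(2)] not_in_carrier_nonzero[OF y'(2)]
  have "fraction R (u \<otimes> u') (v \<otimes> v') = fraction R \<one> \<one>"
    using y(3) nz x(1) y'(1) unfolding x(3) y'(3) total_fractions_one by (simp add: fraction_mult_nonzero)
  then have "u \<otimes> u' = v \<otimes> v'"
    using nonzero_mult[OF nz] x(1) y'(1) one_not_zero by (simp add: fraction_eq_iff_nonzero)
  then have "u \<otimes> u' \<notin> P" using mult_not_in[OF x(2) y'(2)] by simp
  then have "u \<notin> P" using P.I_r_closed y'(1) by blast
  then show thesis using that x by blast
qed

lemma fraction_nat_pow:
  assumes "p \<in> carrier R" "q \<in> carrier R - {\<zero>}"
  shows "fraction R p q [^]\<^bsub>K\<^esub> (n::nat) = fraction R (p [^] n) (q [^] n)"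
proof (induction n)
  case 0
  show ?case by (simp add: total_fractions_one)
next
  case (Suc n)
  then show ?case using assms nonzero_pow[OF assms(2), of n] by (simp add: fraction_mult_nonzero)
qed

text \<open>
  Writing the integer exponent as a difference of naturals treats both signs alike and keeps
  the powers in \<open>R\<close>.
\<close>

lemma fraction_int_pow:
  assumes p: "p \<in> carrier R - {\<zero>}" and q: "q \<in> carrier R - {\<zero>}"
  shows "fraction R p q [^]\<^bsub>K\<^esub> (int k - int l) = fraction R (p [^] k \<otimes> q [^] l) (q [^] k \<otimes> p [^] l)"
proof -
  interpret K: cring K by (rule cring_total_fractions)
  note pq = nonzero_pow[OF p] nonzero_pow[OF q]
  have cl: "p \<in> carrier R" "q \<in> carrier R" using p q by auto
  show ?thesis
  proof (cases "l \<le> k")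
    case True
    then obtain m where m: "k = l + m" using le_Suc_ex by blast
    have "fraction R p q [^]\<^bsub>K\<^esub> (int k - int l) = fraction R (p [^] m) (q [^] m)"
      unfolding m using fraction_nat_pow[OF cl(1) q, of m] by (simp add: int_pow_int)
    also have "\<dots> = fraction R (p [^] k \<otimes> q [^] l) (q [^] k \<otimes> p [^] l)"
    proof (rule iffD2[OF fraction_eq_iff_nonzero[OF _ _ pq(2) nonzero_mult[OF pq(2) pq(1)]]])
      show "p [^] m \<otimes> (q [^] k \<otimes> p [^] l) = p [^] k \<otimes> q [^] l \<otimes> q [^] m"
        using cl by (simp add: m nat_pow_mult[symmetric] m_ac)
    qed (use cl in auto)
    finally show ?thesis .
  next
    case False
    then obtain m where m: "l = k + Suc m" by (metis add_Suc_right less_imp_Suc_add not_le)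
    let ?m = "Suc m"
    have "fraction R (p [^] ?m) (q [^] ?m) \<otimes>\<^bsub>K\<^esub> fraction R (q [^] ?m) (p [^] ?m) = \<one>\<^bsub>K\<^esub>"
      by (rule fraction_swap[OF pq])
    then have inv: "inv\<^bsub>K\<^esub> (fraction R (p [^] ?m) (q [^] ?m)) = fraction R (q [^] ?m) (p [^] ?m)"
      using pq[of ?m] by (intro K.comm_inv_char) (auto simp: fraction_closed nonzerodivisors_eq simp del: nat_pow_Suc)
    have "int k - int l < 0" "nat (- (int k - int l)) = ?m" unfolding m by auto
    then have "fraction R p q [^]\<^bsub>K\<^esub> (int k - int l) = fraction R (q [^] ?m) (p [^] ?m)"
      unfolding int_pow_def2 using fraction_nat_pow[OF cl(1) q, of ?m] inv by (simp del: nat_pow_Suc)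
    also have "\<dots> = fraction R (p [^] k \<otimes> q [^] l) (q [^] k \<otimes> p [^] l)"
    proof (rule iffD2[OF fraction_eq_iff_nonzero[OF _ _ pq(1) nonzero_mult[OF pq(2) pq(1)]]])
      show "q [^] ?m \<otimes> (q [^] k \<otimes> p [^] l) = p [^] k \<otimes> q [^] l \<otimes> p [^] ?m"
        unfolding m nat_pow_mult[OF cl(1), symmetric] nat_pow_mult[OF cl(2), symmetric]
        using cl by (simp add: m_ac del: nat_pow_Suc)
    qed (use cl in auto)
    finally show ?thesis .
  qed
qed

lemma localization_max_principal:
  "localization_max R P = PIdl\<^bsub>localization_at R P\<^esub> (to_fractions R t)"
proof
  show "localization_max R P \<subseteq> PIdl\<^bsub>localization_at R P\<^esub> (to_fractions R t)"
  proof
    fix x assume "x \<in> localization_max R P"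
    then obtain a s where x: "a \<in> P" "s \<in> carrier R - P" "x = fraction R a s"
      unfolding localization_max_def by blast
    obtain u w where u: "u \<in> carrier R - P" "w \<in> carrier R" "u \<otimes> a = w \<otimes> t"
      using t_divides[OF x(1)] by blast
    note us = mult_not_in[OF u(1) x(2)]
    note nz = not_in_carrier_nonzero[OF us] not_in_carrier_nonzero[OF x(2)]
    have cl: "u \<in> carrier R" "s \<in> carrier R" "a \<in> carrier R" using u x P.Icarr by auto
    have "fraction R w (u \<otimes> s) \<otimes>\<^bsub>K\<^esub> to_fractions R t = fraction R (w \<otimes> t) (u \<otimes> s)"
      unfolding to_fractions_def using u(2) nz(1) one_not_zero cl by (simp add: fraction_mult_nonzero)
    also have "\<dots> = x"
      unfolding x(3) u(3)[symmetric] using nz cl by (simp add: fraction_eq_iff_nonzero m_ac)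
    finally show "x \<in> PIdl\<^bsub>localization_at R P\<^esub> (to_fractions R t)"
      unfolding cgenideal_def localization_simps using u(2) us by blast
  qed
  show "PIdl\<^bsub>localization_at R P\<^esub> (to_fractions R t) \<subseteq> localization_max R P"
  proof
    fix x assume "x \<in> PIdl\<^bsub>localization_at R P\<^esub> (to_fractions R t)"
    then obtain c d where x: "c \<in> carrier R" "d \<in> carrier R - P"
      "x = fraction R c d \<otimes>\<^bsub>K\<^esub> to_fractions R t"
      unfolding cgenideal_def localization_simps by blast
    have "x = fraction R (c \<otimes> t) d"
      unfolding x(3) to_fractions_def using x(1) not_in_carrier_nonzero[OF x(2)] one_not_zero
      by (simp add: fraction_mult_nonzero)
    then show "x \<in> localization_max R P"
      unfolding localization_max_def using P.I_l_closed[OF t_in x(1)] x(2) by blast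
  qed
qed

text \<open>
  The definition of \<open>ord_at\<close> admits any generator \<open>\<tau>\<close> of the maximal ideal. As \<open>t\<close> has valuation \<open>1\<close>
  and is a multiple of \<open>\<tau>\<close>, the numerator of \<open>\<tau>\<close> has valuation at most \<open>1\<close>, and at least \<open>1\<close> since it
  lies in \<open>P\<close>.
\<close>

lemma localization_max_generator:
  assumes \<tau>: "\<tau> \<in> carrier (localization_at R P)"
    "localization_max R P = PIdl\<^bsub>localization_at R P\<^esub> \<tau>"
  obtains a s where "a \<in> carrier R - {\<zero>}" "s \<in> carrier R - P" "\<tau> = fraction R a s" "val a = 1"
proof -
  have "\<one>\<^bsub>K\<^esub> \<otimes>\<^bsub>K\<^esub> \<tau> = \<tau>"
    using \<tau>(1) unfolding localization_simps total_fractions_one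
    using not_in_carrier_nonzero one_not_zero by (auto simp: fraction_mult_nonzero)
  moreover have "\<one>\<^bsub>K\<^esub> \<in> carrier (localization_at R P)"
    unfolding localization_simps total_fractions_one using one_not_in by blast
  ultimately have "\<tau> \<in> PIdl\<^bsub>localization_at R P\<^esub> \<tau>"
    unfolding cgenideal_def localization_simps(2) by (metis (mono_tags, lifting) mem_Collect_eq)
  then obtain a s where a: "a \<in> P" "s \<in> carrier R - P" "\<tau> = fraction R a s"
    unfolding \<tau>(2)[symmetric] localization_max_def by blast
  have aR: "a \<in> carrier R" using P.Icarr[OF a(1)] .
  have "fraction R t \<one> \<in> localization_max R P"
    unfolding localization_max_def using t_in one_not_in by blast
  then obtain c d where c: "c \<in> carrier R" "d \<in> carrier R - P"
    "fraction R t \<one> = fraction R c d \<otimes>\<^bsub>K\<^esub> \<tau>"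
    unfolding \<tau>(2) cgenideal_def localization_simps by blast
  note nz = not_in_carrier_nonzero[OF a(2)] not_in_carrier_nonzero[OF c(2)]
  have eq: "t \<otimes> (d \<otimes> s) = c \<otimes> a"
    using c(3) nz c(1) aR nonzero_mult[OF nz(2,1)] one_not_zero unfolding a(3)
    by (simp add: fraction_mult_nonzero fraction_eq_iff_nonzero)
  have "t \<otimes> (d \<otimes> s) \<in> carrier R - {\<zero>}"
    using nonzero_mult[OF _ nonzero_mult[OF nz(2,1)], of t] t_nonzero by simp
  then have ca: "c \<noteq> \<zero>" "a \<noteq> \<zero>" using eq aR c(1) by auto
  have "val (t \<otimes> (d \<otimes> s)) = 1"
    using nz nonzero_mult[OF nz(2,1)] t_nonzero by (simp add: val_mult val_t val_not_in[OF mult_not_in[OF c(2) a(2)]])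
  then have "val c + val a = 1" unfolding eq using val_mult[OF c(1) ca(1) aR ca(2)] by simp
  then have "val a = 1" using val_pos[OF a(1) ca(2)] by simp
  then show thesis using that[of a s] a aR ca(2) by blast
qed

text \<open>
  Existence of the exponent comes from the factorizations of \<open>a\<close> and \<open>s\<close>; uniqueness from comparing
  valuations after clearing denominators.
\<close>

theorem ord_at_fraction:
  assumes a: "a \<in> carrier R - {\<zero>}" and s: "s \<in> carrier R - {\<zero>}"
  shows "ord_at R P (fraction R a s) = int (val a) - int (val s)"
  unfolding ord_at_def
proof (rule the_equality)
  have aR: "a \<in> carrier R" "a \<noteq> \<zero>" and sR: "s \<in> carrier R" "s \<noteq> \<zero>" using a s by auto
  obtain u v where u: "u \<in> carrier R - P" "v \<in> carrier R - P" "u \<otimes> a = v \<otimes> t [^] val a"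
    by (rule val_rep[OF aR])
  obtain u' v' where u': "u' \<in> carrier R - P" "v' \<in> carrier R - P" "u' \<otimes> s = v' \<otimes> t [^] val s"
    by (rule val_rep[OF sR])
  let ?U = "fraction R (v \<otimes> u') (u \<otimes> v')"
  have tnz: "t \<in> carrier R - {\<zero>}" using t_nonzero by simp
  have one: "\<one> \<in> carrier R - {\<zero>}" using one_not_zero by simp
  note nz = u(1,2)[THEN not_in_carrier_nonzero] u'(1,2)[THEN not_in_carrier_nonzero]
  have cl: "u \<in> carrier R" "v \<in> carrier R" "u' \<in> carrier R" "v' \<in> carrier R" using u u' by auto
  have U: "?U \<in> Units (localization_at R P)"
    by (rule Units_localization) (use u u' mult_not_in in auto)
  have "to_fractions R t [^]\<^bsub>K\<^esub> (int (val a) - int (val s)) =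
      fraction R (t [^] val a) (t [^] val s)"
    unfolding to_fractions_def fraction_int_pow[OF tnz one] by simp
  then have "?U \<otimes>\<^bsub>K\<^esub> (to_fractions R t [^]\<^bsub>K\<^esub> (int (val a) - int (val s))) =
      fraction R (v \<otimes> u' \<otimes> t [^] val a) (u \<otimes> v' \<otimes> t [^] val s)"
    using nonzero_mult[OF nz(1) nz(4)] nonzero_pow[OF tnz, of "val s"] cl by (simp add: fraction_mult_nonzero)
  also have "\<dots> = fraction R a s"
  proof -
    have "v \<otimes> u' \<otimes> t [^] val a \<otimes> s = (u \<otimes> a) \<otimes> (u' \<otimes> s)"
      unfolding u(3) using cl sR by (simp add: m_ac)
    also have "\<dots> = a \<otimes> (u \<otimes> v' \<otimes> t [^] val s)"
      unfolding u'(3) using cl aR by (simp add: m_ac)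
    finally show ?thesis
      using nonzero_mult[OF nonzero_mult[OF nz(1) nz(4)] nonzero_pow[OF tnz, of "val s"]] cl a s
      by (simp add: fraction_eq_iff_nonzero)
  qed
  finally have eq: "fraction R a s = ?U \<otimes>\<^bsub>K\<^esub> (to_fractions R t [^]\<^bsub>K\<^esub> (int (val a) - int (val s)))"
    by (rule sym)
  have "to_fractions R t \<in> carrier (localization_at R P)"
    unfolding localization_simps to_fractions_def using one_not_in t_closed by blast
  then show "\<exists>\<tau> u. \<tau> \<in> carrier (localization_at R P) \<and>
      localization_max R P = PIdl\<^bsub>localization_at R P\<^esub> \<tau> \<and> u \<in> Units (localization_at R P) \<and>
      fraction R a s = u \<otimes>\<^bsub>K\<^esub> (\<tau> [^]\<^bsub>K\<^esub> (int (val a) - int (val s)))"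
    by (intro exI conjI) (rule localization_max_principal U eq | assumption)+
next
  fix n :: int assume "\<exists>\<tau> u. \<tau> \<in> carrier (localization_at R P) \<and>
      localization_max R P = PIdl\<^bsub>localization_at R P\<^esub> \<tau> \<and> u \<in> Units (localization_at R P) \<and>
      fraction R a s = u \<otimes>\<^bsub>K\<^esub> (\<tau> [^]\<^bsub>K\<^esub> n)"
  then obtain \<tau> x where \<tau>: "\<tau> \<in> carrier (localization_at R P)"
      "localization_max R P = PIdl\<^bsub>localization_at R P\<^esub> \<tau>" and x: "x \<in> Units (localization_at R P)"
      and eq: "fraction R a s = x \<otimes>\<^bsub>K\<^esub> (\<tau> [^]\<^bsub>K\<^esub> n)" by blast
  obtain b c where b: "b \<in> carrier R - {\<zero>}" "c \<in> carrier R - P" "\<tau> = fraction R b c" "val b = 1"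
    by (rule localization_max_generator[OF \<tau>])
  obtain u v where u: "u \<in> carrier R - P" "v \<in> carrier R - P" "x = fraction R u v"
    by (rule Units_localization_cases[OF x])
  define k l where "k = nat n" and "l = nat (- n)"
  have n: "n = int k - int l" by (simp add: k_def l_def)
  note nz = u(1,2)[THEN not_in_carrier_nonzero]
  have c: "c \<in> carrier R - {\<zero>}" by (rule not_in_carrier_nonzero[OF b(2)])
  have bcnz: "b [^] k \<otimes> c [^] l \<in> carrier R - {\<zero>}" "c [^] k \<otimes> b [^] l \<in> carrier R - {\<zero>}"
    using nonzero_mult nonzero_pow b(1) c by blast+
  have "fraction R a s = fraction R (u \<otimes> (b [^] k \<otimes> c [^] l)) (v \<otimes> (c [^] k \<otimes> b [^] l))"
    unfolding eq b(3) u(3) n fraction_int_pow[OF b(1) c]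
    using nz bcnz by (simp add: fraction_mult_nonzero)
  then have "a \<otimes> (v \<otimes> (c [^] k \<otimes> b [^] l)) = u \<otimes> (b [^] k \<otimes> c [^] l) \<otimes> s"
    using a s nonzero_mult[OF nz(1) bcnz(1)] nonzero_mult[OF nz(2) bcnz(2)]
    by (simp add: fraction_eq_iff_nonzero)
  then have "val (a \<otimes> (v \<otimes> (c [^] k \<otimes> b [^] l))) = val (u \<otimes> (b [^] k \<otimes> c [^] l) \<otimes> s)" by simp
  moreover have vm: "val (y \<otimes> z) = val y + val z" if "y \<in> carrier R - {\<zero>}" "z \<in> carrier R - {\<zero>}" for y z
    using val_mult that by simp
  have vp: "val (y [^] m) = m * val y" if "y \<in> carrier R - {\<zero>}" for y and m :: nat
    using val_pow that by simp
  note vc = val_not_in[OF b(2)] val_not_in[OF u(1)] val_not_in[OF u(2)]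
  have "val (a \<otimes> (v \<otimes> (c [^] k \<otimes> b [^] l))) = val a + l"
    unfolding vm[OF a nonzero_mult[OF nz(2) bcnz(2)]] vm[OF nz(2) bcnz(2)]
      vm[OF nonzero_pow[OF c] nonzero_pow[OF b(1)]] vp[OF b(1)] vp[OF c] vc b(4) by simp
  moreover have "val (u \<otimes> (b [^] k \<otimes> c [^] l) \<otimes> s) = k + val s"
    unfolding vm[OF nonzero_mult[OF nz(1) bcnz(1)] s] vm[OF nz(1) bcnz(1)]
      vm[OF nonzero_pow[OF b(1)] nonzero_pow[OF c]] vp[OF b(1)] vp[OF c] vc b(4) by simp
  ultimately have "val a + l = k + val s" by simp
  then show "n = int (val a) - int (val s)" unfolding n by simp
qed

end

context noetherian_domain
begin

lemma height_one_valued_prime: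
  "normal_domain R \<Longrightarrow> P \<in> height_one_primes R \<Longrightarrow> valued_prime R P"
  by (intro valued_prime.intro valued_prime_axioms.intro noetherian_domain_axioms
      height_one_prime_nonzero height_one_uniformizer)

text \<open>
  This says that \<open>R\<close> is the intersection of its localizations at primes of height one. If \<open>s\<close> did not
  divide \<open>a\<close>, then \<open>(s : a)\<close> would lie in an associated prime \<open>Q\<close> of \<open>R / (s)\<close>. Such a \<open>Q\<close> has a
  uniformizer, hence height one, and the hypothesis at \<open>Q\<close> yields an element of \<open>(s : a)\<close> outside \<open>Q\<close>.
\<close>

theorem dvd_if_val_le:
  assumes normal: "normal_domain R"
    and a: "a \<in> carrier R - {\<zero>}" and s: "s \<in> carrier R - {\<zero>}"
    and le: "\<And>P. P \<in> height_one_primes R \<Longrightarrow> nat_val R P s \<le> nat_val R P a"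
  obtains (factor) w where "w \<in> carrier R" "a = w \<otimes> s"
proof (rule ccontr)
  assume not: "\<not> thesis"
  have no: "a \<noteq> w \<otimes> s" if "w \<in> carrier R" for w using not that factor by blast
  have aR: "a \<in> carrier R" "a \<noteq> \<zero>" and sR: "s \<in> carrier R" "s \<noteq> \<zero>" using a s by auto
  have disj: "{\<one>} \<inter> colon R s a = {}" using no aR by (auto simp: colon_def)
  obtain b where b: "b \<in> carrier R" "primeideal (colon R s b) R" "{\<one>} \<inter> colon R s b = {}"
    "colon R s a \<subseteq> colon R s b"
    by (rule exists_associated_prime[OF is_cring sR(1) aR(1) _ _ _ disj]) auto
  let ?Q = "colon R s b"
  interpret Q: primeideal ?Q R by fact
  have "s \<in> ?Q" using m_comm[OF sR(1) b(1)] sR(1) b(1) unfolding colon_def by blast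
  then have "?Q \<noteq> {\<zero>}" using sR by blast
  then interpret V: valued_prime R ?Q
    using associated_prime_uniformizer[OF normal sR b(1,2)] b(2)
    by (intro valued_prime.intro valued_prime_axioms.intro noetherian_domain_axioms)
  obtain u v where u: "u \<in> carrier R - ?Q" "v \<in> carrier R - ?Q" "u \<otimes> a = v \<otimes> V.t [^] V.val a"
    by (rule V.val_rep[OF aR])
  obtain u' v' where u': "u' \<in> carrier R - ?Q" "v' \<in> carrier R - ?Q" "u' \<otimes> s = v' \<otimes> V.t [^] V.val s"
    by (rule V.val_rep[OF sR])
  have cl: "u \<in> carrier R" "v \<in> carrier R" "u' \<in> carrier R" "v' \<in> carrier R" using u u' by auto
  obtain k where k: "V.val a = V.val s + k" using le[OF V.height_one] le_Suc_ex by blast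
  have "(v' \<otimes> u) \<otimes> a = v' \<otimes> (u \<otimes> a)" using cl aR by (simp add: m_ac)
  also have "\<dots> = v \<otimes> V.t [^] k \<otimes> (v' \<otimes> V.t [^] V.val s)"
    unfolding u(3) k nat_pow_mult[OF V.t_closed, symmetric] using cl by (simp add: m_ac)
  also have "\<dots> = (v \<otimes> V.t [^] k \<otimes> u') \<otimes> s"
    unfolding u'(3)[symmetric] using cl sR by (simp add: m_ac)
  finally have eq: "(v' \<otimes> u) \<otimes> a = (v \<otimes> V.t [^] k \<otimes> u') \<otimes> s" .
  have "v \<otimes> V.t [^] k \<otimes> u' \<in> carrier R" "v' \<otimes> u \<in> carrier R" using cl by auto
  with eq have "v' \<otimes> u \<in> colon R s a"
    unfolding colon_def[of R s a] by blast
  then show False using V.mult_not_in[OF u'(2) u(1)] b(4) by blast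
qed

end

section \<open>Global sections of effective divisors\<close>

lemma module_ring_module:
  assumes "ring_hom_cring R S f" shows "module R (ring_module f S)"
proof -
  interpret ring_hom_cring R S f by fact
  have "abelian_group (ring_module f S)"
  proof (rule abelian_groupI)
    fix x assume "x \<in> carrier (ring_module f S)"
    then show "\<exists>y\<in>carrier (ring_module f S). y \<oplus>\<^bsub>ring_module f S\<^esub> x = \<zero>\<^bsub>ring_module f S\<^esub>"
      by (intro bexI[of _ "\<ominus>\<^bsub>S\<^esub> x"]) (auto simp: ring_module_def S.l_neg)
  qed (auto simp: ring_module_def S.a_ac)
  then show ?thesis
    by (intro moduleI R.is_cring) (auto simp: ring_module_def S.l_distr S.r_distr S.m_assoc)
qed

context noetherian_domain
begin

abbreviation "Frac_module \<equiv> ring_module (to_fractions R) (total_fractions R)"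

lemma fraction_eq_zero_iff:
  assumes "a \<in> carrier R" "s \<in> carrier R - {\<zero>}"
  shows "fraction R a s = \<zero>\<^bsub>total_fractions R\<^esub> \<longleftrightarrow> a = \<zero>"
  unfolding total_fractions_zero using assms one_not_zero
  by (simp add: fraction_eq_iff nonzerodivisors_eq)

text \<open>
  The case \<open>a = 0\<close> is separate because \<open>ord_at\<close> has no meaningful value at \<open>0\<close>.
\<close>

lemma fraction_in_sections:
  assumes normal: "normal_domain R" and D: "D \<noteq> (\<lambda>_. 0)"
    and a: "a \<in> carrier R" and s: "s \<in> carrier R - {\<zero>}"
  shows "fraction R a s \<in> sections R D \<longleftrightarrow> a = \<zero> \<or>
    (\<forall>P\<in>height_one_primes R. int (nat_val R P s) \<le> int (nat_val R P a) + D P)"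
proof (cases "a = \<zero>")
  case False
  have "ord_at R P (fraction R a s) = int (nat_val R P a) - int (nat_val R P s)"
    if "P \<in> height_one_primes R" for P
    using valued_prime.ord_at_fraction[OF height_one_valued_prime[OF normal that]] a s False by simp
  then show ?thesis
    using a s False D fraction_eq_zero_iff[OF a s] fraction_closed[of a s]
    by (auto simp: sections_def nonzerodivisors_eq)
next
  case True
  then show ?thesis
    using a s D fraction_eq_zero_iff[OF a s] fraction_closed[of a s]
    by (auto simp: sections_def nonzerodivisors_eq)
qed

lemma sections_submodule_normal:
  assumes normal: "normal_domain R" and D: "D \<noteq> (\<lambda>_. 0)"
  shows "submodule (sections R D) R Frac_module"
proof -
  let ?K = "total_fractions R"
  interpret K: cring ?K by (rule cring_total_fractions)
  interpret F: module R Frac_module by (rule module_ring_module[OF to_fractions_ring_hom])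
  note mem = fraction_in_sections[OF normal D]
  have KF: "carrier Frac_module = carrier ?K" "(\<oplus>\<^bsub>Frac_module\<^esub>) = (\<oplus>\<^bsub>?K\<^esub>)" "\<zero>\<^bsub>Frac_module\<^esub> = \<zero>\<^bsub>?K\<^esub>"
    "\<And>r x. r \<odot>\<^bsub>Frac_module\<^esub> x = to_fractions R r \<otimes>\<^bsub>?K\<^esub> x"
    by (simp_all add: ring_module_def)
  have sub: "sections R D \<subseteq> carrier ?K" using D by (auto simp: sections_def)
  have smult: "to_fractions R r \<otimes>\<^bsub>?K\<^esub> x \<in> sections R D"
    if r: "r \<in> carrier R" and x: "x \<in> sections R D" for r x
  proof -
    obtain a s where a: "a \<in> carrier R" "s \<in> carrier R - {\<zero>}" "x = fraction R a s"
      using sub x fraction_cases[of x] unfolding nonzerodivisors_eq by blast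
    have "r \<otimes> a = \<zero> \<or> (\<forall>P\<in>height_one_primes R. int (nat_val R P s) \<le> int (nat_val R P (r \<otimes> a)) + D P)"
    proof (cases "r = \<zero> \<or> a = \<zero>")
      case False
      have "int (nat_val R P s) \<le> int (nat_val R P (r \<otimes> a)) + D P" if P: "P \<in> height_one_primes R" for P
      proof -
        interpret V: valued_prime R P by (rule height_one_valued_prime[OF normal P])
        show ?thesis using x P False mem[OF a(1,2)] r a by (auto simp: V.val_mult)
      qed
      then show ?thesis by blast
    qed (use r a in auto)
    then show ?thesis
      using mem[of "r \<otimes> a" s] r a by (simp add: to_fractions_mult_fraction nonzerodivisors_eq)
  qed
  have add: "x \<oplus>\<^bsub>?K\<^esub> y \<in> sections R D" if x: "x \<in> sections R D" and y: "y \<in> sections R D" for x y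
  proof -
    obtain a s where a: "a \<in> carrier R" "s \<in> carrier R - {\<zero>}" "x = fraction R a s"
      using sub x fraction_cases[of x] unfolding nonzerodivisors_eq by blast
    obtain b t where b: "b \<in> carrier R" "t \<in> carrier R - {\<zero>}" "y = fraction R b t"
      using sub y fraction_cases[of y] unfolding nonzerodivisors_eq by blast
    have cl: "s \<in> carrier R" "t \<in> carrier R" using a b by auto
    show ?thesis
    proof (cases "a = \<zero> \<or> b = \<zero>")
      case True
      then have "x = \<zero>\<^bsub>?K\<^esub> \<or> y = \<zero>\<^bsub>?K\<^esub>" using a b fraction_eq_zero_iff by blast
      then show ?thesis using x y sub by auto
    next
      case False
      let ?n = "a \<otimes> t \<oplus> b \<otimes> s"
      have nz: "a \<otimes> t \<noteq> \<zero>" "b \<otimes> s \<noteq> \<zero>" "s \<otimes> t \<in> carrier R - {\<zero>}"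
        using False a b integral by blast+
      have "int (nat_val R P (s \<otimes> t)) \<le> int (nat_val R P ?n) + D P"
        if P: "P \<in> height_one_primes R" and n: "?n \<noteq> \<zero>" for P
      proof -
        interpret V: valued_prime R P by (rule height_one_valued_prime[OF normal P])
        \<comment> \<open>A common lower bound for the valuations of both summands of the numerator.\<close>
        let ?m = "nat (int (V.val s) + int (V.val t) - D P)"
        have "int (V.val s) \<le> int (V.val a) + D P" "int (V.val t) \<le> int (V.val b) + D P"
          using x y P False mem[OF a(1,2)] mem[OF b(1,2)] a b by auto
        then have "?m \<le> V.val (a \<otimes> t)" "?m \<le> V.val (b \<otimes> s)"
          using a b False by (auto simp: V.val_mult)
        then have "?m \<le> V.val ?n"
          using nz n a(1) b(1) cl by (intro V.val_add) auto
        then show ?thesis using a b by (simp add: V.val_mult)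
      qed
      then have "fraction R ?n (s \<otimes> t) \<in> sections R D"
        using mem[of ?n "s \<otimes> t"] nz(3) a(1) b(1) cl by auto
      then show ?thesis using a b by (simp add: fraction_add nonzerodivisors_eq)
    qed
  qed
  show ?thesis
    by (rule F.submoduleI_smult) (use D sub smult add in \<open>auto simp: KF sections_def\<close>)
qed

lemma to_fractions_in_sections_normal:
  assumes normal: "normal_domain R" and D: "D \<noteq> (\<lambda>_. 0)" "\<And>P. D P \<ge> 0" and a: "a \<in> carrier R"
  shows "to_fractions R a \<in> sections R D"
proof -
  have "int (nat_val R P \<one>) \<le> int (nat_val R P a) + D P" if P: "P \<in> height_one_primes R" for P
  proof -
    interpret V: valued_prime R P by (rule height_one_valued_prime[OF normal P])
    show ?thesis using V.val_not_in[OF V.one_not_in] D(2)[of P] by simp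
  qed
  then show ?thesis
    unfolding to_fractions_def using fraction_in_sections[OF normal D(1) a, of \<one>] one_not_zero by simp
qed

text \<open>
  The denominator is the product of \<open>t\<^sub>P\<close> to the power \<open>D P\<close> over the support of \<open>D\<close>; multiplication
  by it removes all poles.
\<close>

lemma sections_common_denominator_normal:
  assumes normal: "normal_domain R" and D: "D \<noteq> (\<lambda>_. 0)"
    and fin: "finite {P. D P \<noteq> 0}" and supp: "{P. D P \<noteq> 0} \<subseteq> height_one_primes R"
  shows "\<exists>c\<in>nonzerodivisors R. \<forall>x\<in>sections R D.
    to_fractions R c \<otimes>\<^bsub>total_fractions R\<^esub> x \<in> to_fractions R ` carrier R"
proof -
  have ex: "\<exists>c\<in>carrier R - {\<zero>}. \<forall>P\<in>S. D P \<le> int (nat_val R P c)"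
    if "finite S" "S \<subseteq> height_one_primes R" for S
    using that
  proof (induction S)
    case empty
    then show ?case using one_not_zero by auto
  next
    case (insert P S)
    then obtain c where c: "c \<in> carrier R - {\<zero>}" "\<forall>Q\<in>S. D Q \<le> int (nat_val R Q c)" by auto
    interpret V: valued_prime R P by (rule height_one_valued_prime[OF normal]) (use insert.prems in simp)
    let ?d = "V.t [^] nat (D P)"
    have d: "?d \<in> carrier R - {\<zero>}" using V.pow_nonzero[OF V.t_closed V.t_nonzero] by simp
    have "D Q \<le> int (nat_val R Q (c \<otimes> ?d))" if Q: "Q \<in> insert P S" for Q
    proof -
      interpret W: valued_prime R Q
        by (rule height_one_valued_prime[OF normal]) (use insert.prems Q in auto)
      have m: "W.val (c \<otimes> ?d) = W.val c + W.val ?d" using c(1) d by (simp add: W.val_mult)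
      show ?thesis
      proof (cases "Q = P")
        case True
        have "V.val ?d = nat (D P)" using V.val_pow[OF V.t_closed V.t_nonzero] V.val_t by simp
        then show ?thesis using m True by simp
      qed (use c(2) Q m in force)
    qed
    moreover have "c \<otimes> ?d \<in> carrier R - {\<zero>}" using c(1) d integral by blast
    ultimately show ?case by blast
  qed
  from ex[OF fin supp] obtain c
    where "c \<in> carrier R - {\<zero>}" "\<forall>P\<in>{P. D P \<noteq> 0}. D P \<le> int (nat_val R P c)" ..
  then have c: "c \<in> carrier R - {\<zero>}" "\<And>P. D P \<noteq> 0 \<Longrightarrow> D P \<le> int (nat_val R P c)" by auto
  have "to_fractions R c \<otimes>\<^bsub>total_fractions R\<^esub> x \<in> to_fractions R ` carrier R" if x: "x \<in> sections R D" for x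
  proof -
    have "x \<in> carrier (total_fractions R)" using x D by (simp add: sections_def)
    then obtain a s where a: "a \<in> carrier R" "s \<in> carrier R - {\<zero>}" "x = fraction R a s"
      using fraction_cases[of x] unfolding nonzerodivisors_eq by blast
    have eq: "to_fractions R c \<otimes>\<^bsub>total_fractions R\<^esub> x = fraction R (c \<otimes> a) s"
      using a c by (simp add: to_fractions_mult_fraction nonzerodivisors_eq)
    have "\<exists>w\<in>carrier R. c \<otimes> a = w \<otimes> s"
    proof (cases "a = \<zero>")
      case True
      then show ?thesis using a c by (auto intro!: bexI[of _ \<zero>])
    next
      case False
      have "nat_val R P s \<le> nat_val R P (c \<otimes> a)" if P: "P \<in> height_one_primes R" for P
      proof -
        interpret V: valued_prime R P by (rule height_one_valued_prime[OF normal P])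
        have "int (V.val s) \<le> int (V.val a) + D P"
          using x P False fraction_in_sections[OF normal D a(1,2)] a(3) by blast
        moreover have "D P \<le> int (V.val c)" using c(2)[of P] by (cases "D P = 0") auto
        moreover have "V.val (c \<otimes> a) = V.val c + V.val a" using c(1) a(1) False by (simp add: V.val_mult)
        ultimately show ?thesis by linarith
      qed
      moreover have "c \<otimes> a \<in> carrier R - {\<zero>}" using c(1) a(1) False integral by blast
      ultimately obtain w where "w \<in> carrier R" "c \<otimes> a = w \<otimes> s"
        using dvd_if_val_le[OF normal _ a(2)] by blast
      then show ?thesis by blast
    qed
    then obtain w where w: "w \<in> carrier R" "c \<otimes> a = w \<otimes> s" by blast
    have "fraction R (c \<otimes> a) s = to_fractions R w"
      unfolding to_fractions_def w(2) using w(1) a(2) one_not_zero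
      by (simp add: fraction_eq_iff nonzerodivisors_eq)
    then show ?thesis using eq w by simp
  qed
  then show ?thesis using c(1) unfolding nonzerodivisors_eq by blast
qed

end

text \<open>
  For \<open>D \<ge> 0\<close> the module \<open>R(D)\<close> lies between \<open>R\<close> and \<open>(1 / c) R\<close>; this covers the convention
  \<open>R(0) = R\<close> for rings that are not normal.
\<close>

lemma sections_fractional_ideal:
  assumes R: "cring R" "noetherian_ring R"
    and D: "\<And>P. D P \<ge> 0" "finite {P. D P \<noteq> 0}" "{P. D P \<noteq> 0} \<subseteq> height_one_primes R"
      "D \<noteq> (\<lambda>_. 0) \<Longrightarrow> normal_domain R"
  shows "submodule (sections R D) R (ring_module (to_fractions R) (total_fractions R))"
    and "\<And>a. a \<in> carrier R \<Longrightarrow> to_fractions R a \<in> sections R D"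
    and "\<exists>c\<in>nonzerodivisors R. \<forall>x\<in>sections R D.
      to_fractions R c \<otimes>\<^bsub>total_fractions R\<^esub> x \<in> to_fractions R ` carrier R"
proof -
  interpret cring R by fact
  let ?K = "total_fractions R"
  interpret h: ring_hom_cring R ?K "to_fractions R" by (rule to_fractions_ring_hom)
  have "submodule (sections R D) R (ring_module (to_fractions R) ?K) \<and>
    (\<forall>a\<in>carrier R. to_fractions R a \<in> sections R D) \<and>
    (\<exists>c\<in>nonzerodivisors R. \<forall>x\<in>sections R D. to_fractions R c \<otimes>\<^bsub>?K\<^esub> x \<in> to_fractions R ` carrier R)"
  proof (cases "D = (\<lambda>_. 0)")
    case True
    then have eq: "sections R D = to_fractions R ` carrier (self_module R)"
      by (simp add: sections_def ring_module_def)
    have "linear_map R (self_module R) (ring_module (to_fractions R) ?K) (to_fractions R)"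
      by (simp add: linear_map_def ring_module_def)
    then have "submodule (sections R D) R (ring_module (to_fractions R) ?K)"
      unfolding eq
      by (rule linear_map_image_submodule[OF _ module_self_module[OF R(1)] module_ring_module[OF to_fractions_ring_hom]])
    moreover have "to_fractions R \<one>\<^bsub>R\<^esub> \<otimes>\<^bsub>?K\<^esub> x \<in> to_fractions R ` carrier R" if "x \<in> sections R D" for x
      using that unfolding eq by (auto simp: ring_module_def)
    moreover have "to_fractions R a \<in> sections R D" if "a \<in> carrier R" for a
      using that unfolding eq by (simp add: ring_module_def)
    ultimately show ?thesis
      using one_nonzerodivisor by blast
  next
    case False
    then have normal: "normal_domain R" using D(4) by simp
    interpret noetherian_domain R
      using normal R(2) by (intro noetherian_domain.intro) (simp_all add: normal_domain_def)
    show ?thesis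
      using sections_submodule_normal[OF normal False] to_fractions_in_sections_normal[OF normal False D(1)]
        sections_common_denominator_normal[OF normal False D(2,3)] by blast
  qed
  then show "submodule (sections R D) R (ring_module (to_fractions R) (total_fractions R))"
    and "\<And>a. a \<in> carrier R \<Longrightarrow> to_fractions R a \<in> sections R D"
    and "\<exists>c\<in>nonzerodivisors R. \<forall>x\<in>sections R D.
      to_fractions R c \<otimes>\<^bsub>total_fractions R\<^esub> x \<in> to_fractions R ` carrier R"
    by blast+
qed

section \<open>Frobenius pushforwards\<close>

lemma Frob_push_simps [simp]:
  "carrier (Frob_push R p e M) = carrier M" "(\<oplus>\<^bsub>Frob_push R p e M\<^esub>) = (\<oplus>\<^bsub>M\<^esub>)"
  "\<zero>\<^bsub>Frob_push R p e M\<^esub> = \<zero>\<^bsub>M\<^esub>"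
  "r \<odot>\<^bsub>Frob_push R p e M\<^esub> x = (r [^]\<^bsub>R\<^esub> (p ^ e)) \<odot>\<^bsub>M\<^esub> x"
  by (simp_all add: Frob_push_def)

lemma module_Frob_push:
  assumes p: "normalization_semidom_class.prime p" "has_ring_char R p" and M: "module R M"
  shows "module R (Frob_push R p e M)"
proof -
  interpret module R M by fact
  have "abelian_group (Frob_push R p e M)"
  proof (rule abelian_groupI)
    fix x assume "x \<in> carrier (Frob_push R p e M)"
    then show "\<exists>y\<in>carrier (Frob_push R p e M). y \<oplus>\<^bsub>Frob_push R p e M\<^esub> x = \<zero>\<^bsub>Frob_push R p e M\<^esub>"
      by (intro bexI[of _ "\<ominus>\<^bsub>M\<^esub> x"]) (auto simp: M.l_neg)
  qed (auto simp: M.a_ac)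
  then show ?thesis
    by (intro moduleI R.is_cring)
       (auto simp: R.frobenius_add[OF p] smult_l_distr smult_r_distr R.nat_pow_distrib smult_assoc1)
qed

lemma (in module) submodule_preimage:
  assumes N: "module R N" and f: "linear_map R M N f" and H: "submodule H R N"
  shows "submodule {x \<in> carrier M. f x \<in> H} R M"
proof -
  interpret N: module R N by fact
  show ?thesis
    by (rule submoduleI)
       (auto simp: linear_map_zero[OF f module_axioms N] linear_map_minus[OF f module_axioms N]
          linear_mapD[OF f] N.submodule_zero[OF H] N.submoduleE(3-5)[OF H])
qed

text \<open>
  If \<open>S\<close> generates \<open>F\<^sup>e\<^sub>*R\<close> and \<open>G\<close> generates \<open>N\<close>, the products \<open>s g\<close> generate \<open>F\<^sup>e\<^sub>*N\<close>: a submodule of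
  \<open>F\<^sup>e\<^sub>*N\<close> that contains them contains \<open>R g\<close> for every \<open>g \<in> G\<close>, and the \<open>n\<close> with \<open>R n\<close> contained in it
  form a submodule of \<open>N\<close>.
\<close>

lemma fin_gen_Frob_push:
  assumes p: "normalization_semidom_class.prime p" "has_ring_char R p" and N: "module R N"
    and fgR: "fin_gen_module R (FR R p e)" and fgN: "fin_gen_module R N"
  shows "fin_gen_module R (Frob_push R p e N)"
proof -
  interpret N: module R N by fact
  interpret F: module R "Frob_push R p e N" by (rule module_Frob_push[OF p N])
  have FRm: "module R (FR R p e)" by (rule module_Frob_push[OF p module_self_module[OF N.R.is_cring]])
  interpret FR: module R "FR R p e" by (rule FRm)
  obtain S where S: "finite S" "submodule_generated_by R (FR R p e) S (carrier (FR R p e))"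
    using fgR unfolding FR.fin_gen_module_generated by blast
  obtain G where G: "finite G" "submodule_generated_by R N G (carrier N)"
    using fgN unfolding N.fin_gen_module_generated by blast
  have SR: "S \<subseteq> carrier R" using S(2) by (simp add: submodule_generated_by_def ring_module_def)
  have GN: "G \<subseteq> carrier N" using G(2) by (simp add: submodule_generated_by_def)
  define T where "T = (\<lambda>(s, g). s \<odot>\<^bsub>N\<^esub> g) ` (S \<times> G)"
  have "carrier N \<subseteq> H" if H: "submodule H R (Frob_push R p e N)" and T: "T \<subseteq> H" for H
  proof -
    note HE = F.submoduleE[OF H]
    have rg: "x \<odot>\<^bsub>N\<^esub> g \<in> H" if g: "g \<in> G" and x: "x \<in> carrier R" for x g
    proof -
      have gN: "g \<in> carrier N" using g GN by blast
      have "linear_map R (FR R p e) (Frob_push R p e N) (\<lambda>x. x \<odot>\<^bsub>N\<^esub> g)"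
        using gN by (auto simp: linear_map_def ring_module_def N.smult_l_distr N.smult_assoc1)
      then have "submodule {x \<in> carrier (FR R p e). x \<odot>\<^bsub>N\<^esub> g \<in> H} R (FR R p e)"
        by (rule FR.submodule_preimage[OF F.module_axioms _ H])
      moreover have "S \<subseteq> {x \<in> carrier (FR R p e). x \<odot>\<^bsub>N\<^esub> g \<in> H}"
        using SR T g by (auto simp: T_def ring_module_def)
      ultimately have "carrier (FR R p e) \<subseteq> {x \<in> carrier (FR R p e). x \<odot>\<^bsub>N\<^esub> g \<in> H}"
        using S(2) unfolding submodule_generated_by_def by blast
      then show ?thesis using x by (auto simp: ring_module_def)
    qed
    let ?H' = "{n \<in> carrier N. \<forall>x\<in>carrier R. x \<odot>\<^bsub>N\<^esub> n \<in> H}"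
    have "submodule ?H' R N"
    proof (rule N.submoduleI_smult)
      show "\<zero>\<^bsub>N\<^esub> \<in> ?H'" using F.submodule_zero[OF H] by simp
      show "n \<oplus>\<^bsub>N\<^esub> n' \<in> ?H'" if "n \<in> ?H'" "n' \<in> ?H'" for n n'
        using that HE(5) by (auto simp: N.smult_r_distr)
      show "r \<odot>\<^bsub>N\<^esub> n \<in> ?H'" if "r \<in> carrier R" "n \<in> ?H'" for r n
        using that by (auto simp: N.smult_assoc1[symmetric])
    qed auto
    moreover have "G \<subseteq> ?H'" using rg GN by blast
    ultimately have H': "carrier N \<subseteq> ?H'" using G(2) unfolding submodule_generated_by_def by blast
    show ?thesis
    proof
      fix n assume n: "n \<in> carrier N"
      then have "\<one>\<^bsub>R\<^esub> \<odot>\<^bsub>N\<^esub> n \<in> H" using H' by blast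
      then show "n \<in> H" using n by simp
    qed
  qed
  moreover have "T \<subseteq> carrier N" using SR GN by (auto simp: T_def)
  ultimately have "submodule_generated_by R (Frob_push R p e N) T (carrier (Frob_push R p e N))"
    unfolding submodule_generated_by_def by simp
  moreover have "finite T" using S(1) G(1) by (simp add: T_def)
  ultimately show ?thesis unfolding F.fin_gen_module_generated by blast
qed

text \<open>
  \<open>F\<^sup>e\<^sup>+\<^sup>1\<^sub>*R = F\<^sup>e\<^sub>*(F\<^sub>*R)\<close>. As records the two agree only on scalars from the carrier of \<open>R\<close>, so the
  equality is applied to their submodules.
\<close>

lemma F_finite_iterate:
  assumes R: "cring R" and p: "normalization_semidom_class.prime p" "has_ring_char R p"
    and F: "F_finite R p" and e: "e > 0"
  shows "fin_gen_module R (FR R p e)"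
  using e
proof (induction e rule: nat_induct_non_zero)
  case 1
  show ?case using F by (simp add: F_finite_def)
next
  case (Suc e)
  interpret cring R by fact
  note m = module_Frob_push[OF p module_self_module[OF R]]
  interpret A: module R "Frob_push R p e (FR R p 1)" by (rule module_Frob_push[OF p m])
  interpret B: module R "FR R p (Suc e)" by (rule m)
  have "fin_gen_module R (Frob_push R p e (FR R p 1))"
    using fin_gen_Frob_push[OF p m Suc.IH] F by (simp add: F_finite_def)
  then obtain S where S: "finite S"
    "submodule_generated_by R (Frob_push R p e (FR R p 1)) S (carrier (Frob_push R p e (FR R p 1)))"
    unfolding A.fin_gen_module_generated by blast
  have "submodule H R (Frob_push R p e (FR R p 1))" if H: "submodule H R (FR R p (Suc e))" for H
    by (rule A.submoduleI_smult)
       (use B.submoduleE(1,4,5)[OF H] B.submodule_zero[OF H] in \<open>auto simp: nat_pow_pow mult.commute\<close>)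
  then have "submodule_generated_by R (FR R p (Suc e)) S (carrier (FR R p (Suc e)))"
    using S(2) unfolding submodule_generated_by_def by simp
  then show ?case unfolding B.fin_gen_module_generated using S(1) by blast
qed

text \<open>Such a module is isomorphic to an ideal; the images of submodules are ideals as well.\<close>

lemma fin_gen_if_embeds:
  assumes R: "cring R" "noetherian_ring R" and N: "module R N"
    and l: "linear_map R N (self_module R) l" "inj_on l (carrier N)"
  shows "fin_gen_module R N"
proof -
  interpret cring R by fact
  interpret N: module R N by fact
  have lc: "l x \<in> carrier R" if "x \<in> carrier N" for x
    using linear_mapD(1)[OF l(1) that] by (simp add: ring_module_def)
  have id: "ideal (l ` H) R" if H: "submodule H R N" for H
  proof (rule N.submodule_image_ideal[OF H])
    note HN = N.submoduleE(1)[OF H]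
    show "l (x \<oplus>\<^bsub>N\<^esub> y) = l x \<oplus>\<^bsub>R\<^esub> l y" if "x \<in> H" "y \<in> H" for x y
      using linear_mapD(2)[OF l(1)] that HN by (auto simp: ring_module_def)
    show "l (r \<odot>\<^bsub>N\<^esub> x) = r \<otimes>\<^bsub>R\<^esub> l x" if "r \<in> carrier R" "x \<in> H" for r x
      using linear_mapD(3)[OF l(1)] that HN by (auto simp: ring_module_def)
    show "l x \<in> carrier R" if "x \<in> H" for x using lc that HN by auto
  qed
  obtain A where A: "A \<subseteq> carrier R" "finite A" "l ` carrier N = genideal R A"
    using noetherian_ring.finetely_gen[OF R(2) id[OF N.carrier_is_submodule]] by blast
  have "A \<subseteq> l ` carrier N" unfolding A(3) by (rule genideal_self[OF A(1)])
  then obtain B where B: "B \<subseteq> carrier N" "finite B" "A = l ` B"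
    using finite_subset_image[OF A(2)] by blast
  have "carrier N \<subseteq> H" if H: "submodule H R N" and BH: "B \<subseteq> H" for H
  proof
    fix x assume x: "x \<in> carrier N"
    have "A \<subseteq> l ` H" using B(3) BH by blast
    then have "l ` carrier N \<subseteq> l ` H" unfolding A(3) by (rule genideal_minimal[OF id[OF H]])
    then obtain h where "h \<in> H" "l x = l h" using x by blast
    then show "x \<in> H" using inj_onD[OF l(2)] x N.submoduleE(1)[OF H] by blast
  qed
  then show ?thesis
    unfolding N.fin_gen_module_generated submodule_generated_by_def using B by blast
qed

text \<open>
  Multiplication by a common denominator \<open>c\<close> embeds \<open>R(D)\<close> into \<open>R\<close>; it is the map \<open>l\<close> below.
\<close>

theorem FR_div_finite:
  assumes R: "cring R" "noetherian_ring R"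
    and p: "normalization_semidom_class.prime p" "has_ring_char R p" and F: "F_finite R p"
    and T: "is_triple R \<Delta> \<aa>" and e: "e > 0"
  shows "module R (FR_div R p \<Delta> e)" "fin_gen_module R (FR_div R p \<Delta> e)"
    and "linear_map R (FR R p e) (FR_div R p \<Delta> e) (to_fractions R)"
proof -
  interpret cring R by fact
  define D where "D = ceil_mult (p ^ e - 1) \<Delta>"
  let ?K = "total_fractions R"
  let ?F = "ring_module (to_fractions R) ?K"
  interpret h: ring_hom_cring R ?K "to_fractions R" by (rule to_fractions_ring_hom)
  have \<Delta>: "\<Delta> P \<ge> 0" "finite {P. \<Delta> P \<noteq> 0}" "{P. \<Delta> P \<noteq> 0} \<subseteq> height_one_primes R"
    "\<Delta> \<noteq> (\<lambda>_. 0) \<Longrightarrow> normal_domain R" for P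
    using T unfolding is_triple_def effective_R_divisor_def by auto
  have D0: "D P = 0" if "\<Delta> P = 0" for P using that by (simp add: D_def ceil_mult_def)
  have supp: "{P. D P \<noteq> 0} \<subseteq> {P. \<Delta> P \<noteq> 0}" using D0 by blast
  have Dpos: "D P \<ge> 0" for P
    using \<Delta>(1)[of P] by (simp add: D_def ceil_mult_def zero_le_ceiling less_le_trans[OF _ mult_nonneg_nonneg])
  have "D \<noteq> (\<lambda>_. 0) \<Longrightarrow> normal_domain R" using \<Delta>(4) D0 by blast
  note sec = sections_fractional_ideal[OF R Dpos finite_subset[OF supp \<Delta>(2)] subset_trans[OF supp \<Delta>(3)] this]
  let ?N = "sections_module R D"
  have N: "module R ?N"
    unfolding sections_module_def
    by (rule submodule.submodule_is_module[OF sec(1) module_ring_module[OF to_fractions_ring_hom]])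
  interpret N: module R ?N by (rule N)
  have Ns: "carrier ?N = sections R D" "(\<oplus>\<^bsub>?N\<^esub>) = (\<oplus>\<^bsub>?K\<^esub>)" "\<And>r x. r \<odot>\<^bsub>?N\<^esub> x = to_fractions R r \<otimes>\<^bsub>?K\<^esub> x"
    by (simp_all add: sections_module_def ring_module_def)
  have secK: "sections R D \<subseteq> carrier ?K"
    using module.submoduleE(1)[OF module_ring_module[OF to_fractions_ring_hom] sec(1)]
    by (simp add: ring_module_def)
  obtain c where c: "c \<in> nonzerodivisors R"
    "\<And>x. x \<in> sections R D \<Longrightarrow> to_fractions R c \<otimes>\<^bsub>?K\<^esub> x \<in> to_fractions R ` carrier R"
    using sec(3) by blast
  have cR: "c \<in> carrier R" by (rule nonzerodivisor_closed[OF c(1)])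
  have "\<forall>x\<in>sections R D. \<exists>r. r \<in> carrier R \<and> to_fractions R c \<otimes>\<^bsub>?K\<^esub> x = to_fractions R r"
    using c(2) by blast
  then obtain l where l: "\<And>x. x \<in> sections R D \<Longrightarrow> l x \<in> carrier R"
    "\<And>x. x \<in> sections R D \<Longrightarrow> to_fractions R c \<otimes>\<^bsub>?K\<^esub> x = to_fractions R (l x)"
    by metis
  have "linear_map R ?N (self_module R) l"
    unfolding linear_map_def
  proof (intro conjI ballI)
    fix x assume x: "x \<in> carrier ?N"
    then have xs: "x \<in> sections R D" "x \<in> carrier ?K" using secK by (auto simp: Ns)
    show "l x \<in> carrier (self_module R)" using l(1)[OF xs(1)] by (simp add: ring_module_def)
    fix y assume y: "y \<in> carrier ?N"
    then have ys: "y \<in> sections R D" "y \<in> carrier ?K" using secK by (auto simp: Ns)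
    have xy: "x \<oplus>\<^bsub>?K\<^esub> y \<in> sections R D" using N.a_closed[OF x y] by (simp add: Ns)
    have "to_fractions R (l (x \<oplus>\<^bsub>?K\<^esub> y)) = to_fractions R (l x \<oplus>\<^bsub>R\<^esub> l y)"
      using xs ys cR l by (simp add: l(2)[OF xy, symmetric] h.S.r_distr l(2)[symmetric] to_fractions_closed)
    then have "l (x \<oplus>\<^bsub>?K\<^esub> y) = l x \<oplus>\<^bsub>R\<^esub> l y"
      by (rule iffD1[OF to_fractions_eq_iff, rotated 2]) (use l(1) xy xs ys in auto)
    then show "l (x \<oplus>\<^bsub>?N\<^esub> y) = l x \<oplus>\<^bsub>self_module R\<^esub> l y"
      by (simp add: Ns ring_module_def)
  next
    fix r x assume r: "r \<in> carrier R" and x: "x \<in> carrier ?N"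
    then have xs: "x \<in> sections R D" "x \<in> carrier ?K" using secK by (auto simp: Ns)
    have rx: "to_fractions R r \<otimes>\<^bsub>?K\<^esub> x \<in> sections R D" using N.smult_closed[OF r x] by (simp add: Ns)
    have "to_fractions R (l (to_fractions R r \<otimes>\<^bsub>?K\<^esub> x)) = to_fractions R (r \<otimes>\<^bsub>R\<^esub> l x)"
    proof -
      have "to_fractions R (r \<otimes>\<^bsub>R\<^esub> l x) = to_fractions R r \<otimes>\<^bsub>?K\<^esub> (to_fractions R c \<otimes>\<^bsub>?K\<^esub> x)"
        unfolding l(2)[OF xs(1)] using r l(1)[OF xs(1)] by simp
      also have "\<dots> = to_fractions R c \<otimes>\<^bsub>?K\<^esub> (to_fractions R r \<otimes>\<^bsub>?K\<^esub> x)"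
        using xs(2) cR r by (simp add: h.S.m_ac)
      finally show ?thesis unfolding l(2)[OF rx] ..
    qed
    then have "l (to_fractions R r \<otimes>\<^bsub>?K\<^esub> x) = r \<otimes>\<^bsub>R\<^esub> l x"
      by (rule iffD1[OF to_fractions_eq_iff, rotated 2]) (use l(1) rx xs r in auto)
    then show "l (r \<odot>\<^bsub>?N\<^esub> x) = r \<odot>\<^bsub>self_module R\<^esub> l x"
      by (simp add: Ns ring_module_def)
  qed
  moreover have "inj_on l (carrier ?N)"
  proof (rule inj_onI)
    fix x y assume "x \<in> carrier ?N" "y \<in> carrier ?N" "l x = l y"
    then show "x = y"
      using to_fractions_smult_cancel[OF c(1), of x y] l(2)[of x] l(2)[of y] secK by (auto simp: Ns)
  qed
  ultimately have "fin_gen_module R ?N" by (rule fin_gen_if_embeds[OF R N])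
  then show "fin_gen_module R (FR_div R p \<Delta> e)"
    unfolding FR_div_def D_def[symmetric] by (rule fin_gen_Frob_push[OF p N F_finite_iterate[OF R(1) p F e]])
  show "module R (FR_div R p \<Delta> e)" unfolding FR_div_def D_def[symmetric] by (rule module_Frob_push[OF p N])
  show "linear_map R (FR R p e) (FR_div R p \<Delta> e) (to_fractions R)"
    unfolding linear_map_def FR_div_def D_def[symmetric] Frob_push_simps Ns
    using sec(2) by (simp add: ring_module_def)
qed

section \<open>Annihilators in the injective hull of the residue field\<close>

text \<open>
  \<open>R / I\<close> acts faithfully on \<open>E\<^bsub>R/I\<^esub>\<close>: let \<open>w \<in> E\<close> be the image of \<open>1 \<in> R / \<mm>\<close>. On the submodule of \<open>R / I\<close>
  generated by the class of \<open>r\<close>, the map that sends the class of \<open>s r\<close> to \<open>s w\<close> is well defined,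
  because \<open>(I : r) \<subseteq> \<mm>\<close> annihilates \<open>w\<close>. It extends to \<open>R / I\<close>, and \<open>z\<close> is the image of \<open>1\<close>.
\<close>

lemma exists_annihilated_by_ideal_not_by:
  fixes R :: "('a, 'b) ring_scheme" (structure)
  assumes R: "cring R" "noetherian_ring R" and loc: "local_ring R \<mm>"
    and E: "injective_hull R (quot_module R \<mm>) E"
    and I: "ideal I R" and r: "r \<in> carrier R" "r \<notin> I"
  shows "\<exists>z\<in>Ann_in E I. r \<odot>\<^bsub>E\<^esub> z \<noteq> \<zero>\<^bsub>E\<^esub>"
proof -
  interpret R: cring R by fact
  have inj: "injective_module TYPE('a) R E" using E by (simp add: injective_hull_def)
  then have Em: "module R E" by (simp add: injective_module_def)
  interpret E: module R E by (rule Em)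
  interpret I: ideal I R by fact
  interpret m: maximalideal \<mm> R using loc by (simp add: local_ring_def)
  have quot: "module R (quot_module R J)" "linear_map R (self_module R) (quot_module R J) (\<lambda>x. J +> x)"
    if "ideal J R" for J
  proof -
    interpret h: ring_hom_cring R "R Quot J" "\<lambda>x. J +> x"
      by (rule ideal.rcos_ring_hom_cring[OF that R(1)])
    show "module R (quot_module R J)"
      unfolding quot_module_def by (rule module_ring_module[OF h.ring_hom_cring_axioms])
    show "linear_map R (self_module R) (quot_module R J) (\<lambda>x. J +> x)"
      by (simp add: linear_map_def quot_module_def ring_module_def)
  qed
  have quot0: "\<zero>\<^bsub>quot_module R J\<^esub> = J" for J
    by (simp add: quot_module_def ring_module_def FactRing_def)
  have coset: "J +> x = J \<longleftrightarrow> x \<in> J" if "ideal J R" "x \<in> carrier R" for J x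
  proof -
    interpret J: ideal J R by (rule that(1))
    show ?thesis using J.a_rcos_self[OF that(2)] J.a_rcos_const by blast
  qed
  have F: "module R (self_module R)" by (rule module_self_module[OF R(1)])
  have F_simps: "carrier (self_module R) = carrier R" "\<And>x y. x \<odot>\<^bsub>self_module R\<^esub> y = x \<otimes> y"
    by (simp_all add: ring_module_def)
  note lin = linear_mapD[OF quot(2), unfolded F_simps]
  let ?Qm = "quot_module R \<mm>" and ?Q = "quot_module R I"
  obtain j where "j \<in> Hom_mod R ?Qm E" and j_inj: "inj_on j (carrier ?Qm)"
    using E unfolding injective_hull_def essential_mono_def by blast
  then have j: "linear_map R ?Qm E j" by (intro Hom_mod_linear_map)
  define w where "w = j (\<mm> +> \<one>)"
  have w: "w \<in> carrier E"
    unfolding w_def by (intro linear_mapD(1)[OF j] lin m.is_ideal R.one_closed)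
  have xw: "x \<odot>\<^bsub>E\<^esub> w = j (\<mm> +> x)" if "x \<in> carrier R" for x
    using linear_mapD(3)[OF j that lin(1)[OF m.is_ideal R.one_closed]] that
      lin(3)[OF m.is_ideal that R.one_closed] by (simp add: w_def)
  have j0: "j \<mm> = \<zero>\<^bsub>E\<^esub>"
    using linear_map_zero[OF j quot(1)[OF m.is_ideal] Em] by (simp add: quot0)
  have mw: "x \<odot>\<^bsub>E\<^esub> w = \<zero>\<^bsub>E\<^esub>" if "x \<in> \<mm>" for x
    using xw[OF m.Icarr[OF that]] j0 m.a_rcos_const[OF that] by simp
  have w0: "w \<noteq> \<zero>\<^bsub>E\<^esub>"
  proof
    assume "w = \<zero>\<^bsub>E\<^esub>"
    then have "j (\<mm> +> \<one>) = j \<mm>" by (simp add: w_def j0)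
    moreover have "\<mm> \<in> carrier ?Qm"
      using lin(1)[OF m.is_ideal R.zero_closed] m.a_rcos_const[OF m.zero_closed] by simp
    ultimately have "\<mm> +> \<one> = \<mm>"
      using inj_onD[OF j_inj] lin(1)[OF m.is_ideal R.one_closed] by blast
    then show False using coset[OF m.is_ideal R.one_closed] m.one_imp_carrier m.I_notcarr by simp
  qed
  define C where "C = {s \<in> carrier R. s \<otimes> r \<in> I}"
  have C: "ideal C R"
    by (rule R.cring_idealI) (use r in \<open>auto simp: C_def R.l_distr R.m_assoc I.I_l_closed\<close>)
  have "\<one> \<notin> C" using r by (simp add: C_def)
  then have "C \<noteq> carrier R" using R.one_closed by blast
  then have Cm: "C \<subseteq> \<mm>"
    using noetherian_ring.exists_maximalideal_above[OF R(2) C] loc unfolding local_ring_def by metis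
  let ?q = "\<lambda>s. I +> (s \<otimes> r)"
  have q: "linear_map R (self_module R) ?Q ?q"
    by (rule linear_map_comp[OF _ quot(2)[OF I]])
       (use r(1) in \<open>simp add: linear_map_def ring_module_def R.l_distr R.m_assoc\<close>)
  let ?N = "?Q\<lparr>carrier := ?q ` carrier (self_module R)\<rparr>"
  have sub: "submodule (?q ` carrier (self_module R)) R ?Q"
    by (rule linear_map_image_submodule[OF q F quot(1)[OF I]])
  have N: "module R ?N" by (rule submodule.submodule_is_module[OF sub quot(1)[OF I]])
  have qN: "linear_map R (self_module R) ?N ?q" using q by (simp add: linear_map_def)
  have f: "linear_map R (self_module R) E (\<lambda>s. s \<odot>\<^bsub>E\<^esub> w)"
    by (rule linear_map_scale[OF Em w])
  have "s \<odot>\<^bsub>E\<^esub> w = \<zero>\<^bsub>E\<^esub>" if "s \<in> carrier (self_module R)" "?q s = \<zero>\<^bsub>?N\<^esub>" for s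
  proof (rule mw)
    have "s \<in> C" using that coset[OF I] r(1) by (simp add: quot0 F_simps C_def)
    then show "s \<in> \<mm>" using Cm by blast
  qed
  then obtain h where h: "h \<in> Hom_mod R ?N E" "\<And>s. s \<in> carrier R \<Longrightarrow> h (?q s) = s \<odot>\<^bsub>E\<^esub> w"
    using linear_map_factor[OF qN _ f F N Em] by (auto simp: F_simps)
  obtain g where g: "g \<in> Hom_mod R ?Q E" "\<And>x. x \<in> ?q ` carrier (self_module R) \<Longrightarrow> g x = h x"
    using injective_extend[OF inj quot(1)[OF I] sub h(1)] by blast
  define z where "z = g (I +> \<one>)"
  have z: "z \<in> carrier E" unfolding z_def by (intro Hom_mod_closed[OF g(1)] lin I R.one_closed)
  have xz: "x \<odot>\<^bsub>E\<^esub> z = g (I +> x)" if "x \<in> carrier R" for x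
    using Hom_mod_smult[OF g(1) that lin(1)[OF I R.one_closed]] that lin(3)[OF I that R.one_closed]
    by (simp add: z_def)
  have "i \<odot>\<^bsub>E\<^esub> z = \<zero>\<^bsub>E\<^esub>" if "i \<in> I" for i
    using xz[OF I.Icarr[OF that]] I.a_rcos_const[OF that] Hom_mod_zero[OF g(1) quot(1)[OF I] Em]
    by (simp add: quot0)
  moreover have "r \<odot>\<^bsub>E\<^esub> z = w"
    using xz[OF r(1)] g(2)[OF imageI[of \<one> "carrier (self_module R)" ?q]] h(2)[OF R.one_closed] r(1) w
    by (simp add: F_simps)
  ultimately show ?thesis using z w0 unfolding Ann_in_def by blast
qed

section \<open>Compatible ideals\<close>

lemma Hom_composite_eq:
  assumes R: "cring R" and "a \<in> carrier R" "f \<in> carrier R"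
  shows "Hom_composite R p I e a f \<phi> = I +>\<^bsub>R\<^esub> \<phi> (to_fractions R (a \<otimes>\<^bsub>R\<^esub> f))"
proof -
  interpret cring R by fact
  show ?thesis
    using assms by (simp add: Hom_composite_def Hom_pre_def compose_def ring_module_def)
qed

lemma coset_eq_zero_iff:
  assumes "ideal I R" "v \<in> carrier R"
  shows "I +>\<^bsub>R\<^esub> v = \<zero>\<^bsub>R Quot I\<^esub> \<longleftrightarrow> v \<in> I"
proof -
  interpret ideal I R by fact
  show ?thesis
    using a_rcos_self[OF assms(2)] a_rcos_const[of v] by (auto simp: FactRing_def)
qed

lemma tensor_composite_eq:
  assumes R: "cring R" and E: "module R E" and FR: "module R (FR R p e)"
    and FRD: "module R (FR_div R p \<Delta> e)"
    and lin: "linear_map R (FR R p e) (FR_div R p \<Delta> e) (to_fractions R)"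
    and af: "a \<in> carrier R" "f \<in> carrier R" and z: "z \<in> carrier E"
  shows "tensor_composite R p \<Delta> E e a f z =
    pure_tensor R E (FR_div R p \<Delta> e) z (to_fractions R (a \<otimes>\<^bsub>R\<^esub> f))"
proof -
  interpret cring R by fact
  have P: "module_pair R E (FR R p e)" "module_pair R E (FR_div R p \<Delta> e)"
    using E FR FRD by (auto intro: module_pair.intro)
  have id: "linear_map R E E (\<lambda>z. z)" by (simp add: linear_map_def)
  have mult: "linear_map R (FR R p e) (FR R p e) (\<lambda>x. (a \<otimes>\<^bsub>R\<^esub> f) \<otimes>\<^bsub>R\<^esub> x)"
    using af by (simp add: linear_map_def ring_module_def r_distr m_ac)
  have "tensor_map R E (FR R p e) (\<lambda>z. z) (\<lambda>x. (a \<otimes>\<^bsub>R\<^esub> f) \<otimes>\<^bsub>R\<^esub> x) (pure_tensor R E (FR R p e) z \<one>\<^bsub>R\<^esub>) =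
      pure_tensor R E (FR R p e) z (a \<otimes>\<^bsub>R\<^esub> f)"
    using tensor_map_pure_tensor[OF P(1,1) id mult z, of "\<one>\<^bsub>R\<^esub>"] af by (simp add: ring_module_def)
  moreover have "tensor_map R E (FR_div R p \<Delta> e) (\<lambda>z. z) (to_fractions R) (pure_tensor R E (FR R p e) z (a \<otimes>\<^bsub>R\<^esub> f)) =
      pure_tensor R E (FR_div R p \<Delta> e) z (to_fractions R (a \<otimes>\<^bsub>R\<^esub> f))"
    by (rule tensor_map_pure_tensor[OF P id lin z]) (use af in \<open>simp add: ring_module_def\<close>)
  ultimately show ?thesis by (simp add: tensor_composite_def)
qed

text \<open>
  This is what remains of the last equivalence once everything but the module and the element is
  forgotten; the two directions are independent of each other.
\<close>

lemma functionals_into_ideal_iff: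
  fixes R :: "('a, 'b) ring_scheme"
  assumes R: "cring R" "noetherian_ring R" and loc: "local_ring R \<mm>"
    and E: "injective_hull R (quot_module R \<mm>) E" and I: "ideal I R"
    and M: "module R M" "fin_gen_module R M" and x: "x \<in> carrier M"
  shows "(\<forall>\<phi>\<in>Hom_mod R M (self_module R). \<phi> x \<in> I) \<longleftrightarrow>
    (\<forall>z\<in>Ann_in E I. pure_tensor R E M z x = \<zero>\<^bsub>tensor R E M\<^esub>)"
proof -
  have inj: "injective_module TYPE('a) R E" using E by (simp add: injective_hull_def)
  then have Em: "module R E" by (simp add: injective_module_def)
  interpret module_pair R E M using Em M(1) by (rule module_pair.intro)
  show ?thesis
  proof (intro iffI ballI)
    fix z assume all: "\<forall>\<phi>\<in>Hom_mod R M (self_module R). \<phi> x \<in> I" and z: "z \<in> Ann_in E I"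
    have zE: "z \<in> carrier E" using z by (simp add: Ann_in_def)
    have "frag_of (z, x) \<in> rels"
      by (rule functionals_vanish_imp_pure_tensor_zero[OF R inj M x zE])
         (use all z in \<open>auto simp: Ann_in_def\<close>)
    then show "pure_tensor R E M z x = \<zero>\<^bsub>tensor R E M\<^esub>" using pure_tensor_eq_zero_iff[OF zE x] by simp
  next
    fix \<phi> assume zero: "\<forall>z\<in>Ann_in E I. pure_tensor R E M z x = \<zero>\<^bsub>tensor R E M\<^esub>"
      and \<phi>: "\<phi> \<in> Hom_mod R M (self_module R)"
    have \<phi>x: "\<phi> x \<in> carrier R" using Hom_mod_closed[OF \<phi> x] by (simp add: ring_module_def)
    have "\<phi> x \<odot>\<^bsub>E\<^esub> z = \<zero>\<^bsub>E\<^esub>" if z: "z \<in> Ann_in E I" for z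
    proof -
      have zE: "z \<in> carrier E" using z by (simp add: Ann_in_def)
      then have "frag_of (z, x) \<in> rels" using zero z pure_tensor_eq_zero_iff[OF zE x] by blast
      then show ?thesis
        by (rule pure_tensor_zero_imp_functional_vanishes[OF module_pair_axioms Hom_mod_linear_map[OF \<phi>] zE x])
    qed
    then show "\<phi> x \<in> I"
      using exists_annihilated_by_ideal_not_by[OF R loc E I \<phi>x] by blast
  qed
qed

theorem lemma5p1:
  fixes R :: "('a, 'b) ring_scheme"
    and p :: nat
    and \<Delta> :: "'a set \<Rightarrow> real"
    and \<aa> :: "nat \<Rightarrow> 'a set"
    and I \<mm> :: "'a set"
    and E :: "('a, 'e) module"
  assumes "cring R" and "noetherian_ring R"
    and "normalization_semidom_class.prime p" and "has_ring_char R p" and "F_finite R p"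
    and "is_triple R \<Delta> \<aa>"
    and "ideal I R"
  shows
    "(uniformly_compatible R p \<Delta> \<aa> I \<longleftrightarrow>
        (\<forall>e>0. \<forall>a\<in>\<aa> (p ^ e - 1). \<forall>f\<in>I. \<forall>\<phi>\<in>Hom_mod R (FR_div R p \<Delta> e) (self_module R).
           Hom_composite R p I e a f \<phi> = \<zero>\<^bsub>R Quot I\<^esub>)) \<and>
     (local_ring R \<mm> \<and> injective_hull R (quot_module R \<mm>) E \<longrightarrow>
        (uniformly_compatible R p \<Delta> \<aa> I \<longleftrightarrow>
          (\<forall>e>0. \<forall>a\<in>\<aa> (p ^ e - 1). \<forall>f\<in>I. \<forall>z\<in>Ann_in E I.
             tensor_composite R p \<Delta> E e a f z = \<zero>\<^bsub>tensor R E (FR_div R p \<Delta> e)\<^esub>)))"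
proof -
  note R = assms(1,2) and p = assms(3,4)
  interpret cring R by fact
  interpret I: ideal I R by fact
  note FRD = FR_div_finite[OF R p assms(5,6)]
  have aR: "a \<in> carrier R" if "a \<in> \<aa> n" for a n
    using assms(6) that ideal.Icarr unfolding is_triple_def graded_system_def by metis
  let ?x = "\<lambda>a f. to_fractions R (a \<otimes>\<^bsub>R\<^esub> f)"
  have x: "?x a f \<in> carrier (FR_div R p \<Delta> e)" if "e > 0" "a \<in> carrier R" "f \<in> I" for e a f
    using linear_mapD(1)[OF FRD(3)[OF that(1)], of "a \<otimes>\<^bsub>R\<^esub> f"] that(2,3) I.Icarr
    by (simp add: ring_module_def)
  have compat: "uniformly_compatible R p \<Delta> \<aa> I \<longleftrightarrow>
      (\<forall>e>0. \<forall>a\<in>\<aa> (p ^ e - 1). \<forall>f\<in>I. \<forall>\<phi>\<in>Hom_mod R (FR_div R p \<Delta> e) (self_module R). \<phi> (?x a f) \<in> I)"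
    unfolding uniformly_compatible_def by (auto simp: image_subset_iff)
  have "Hom_composite R p I e a f \<phi> = \<zero>\<^bsub>R Quot I\<^esub> \<longleftrightarrow> \<phi> (?x a f) \<in> I"
    if e: "e > 0" and a: "a \<in> \<aa> (p ^ e - 1)" and f: "f \<in> I"
      and \<phi>: "\<phi> \<in> Hom_mod R (FR_div R p \<Delta> e) (self_module R)" for e a f \<phi>
  proof -
    have "\<phi> (?x a f) \<in> carrier R"
      using Hom_mod_closed[OF \<phi> x[OF e aR[OF a] f]] by (simp add: ring_module_def)
    then show ?thesis
      unfolding Hom_composite_eq[OF R(1) aR[OF a] I.Icarr[OF f]] by (rule coset_eq_zero_iff[OF assms(7)])
  qed
  then have part1: "uniformly_compatible R p \<Delta> \<aa> I \<longleftrightarrow>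
      (\<forall>e>0. \<forall>a\<in>\<aa> (p ^ e - 1). \<forall>f\<in>I. \<forall>\<phi>\<in>Hom_mod R (FR_div R p \<Delta> e) (self_module R).
        Hom_composite R p I e a f \<phi> = \<zero>\<^bsub>R Quot I\<^esub>)"
    unfolding compat by (simp cong: ball_cong)
  have part2: "uniformly_compatible R p \<Delta> \<aa> I \<longleftrightarrow>
      (\<forall>e>0. \<forall>a\<in>\<aa> (p ^ e - 1). \<forall>f\<in>I. \<forall>z\<in>Ann_in E I.
        tensor_composite R p \<Delta> E e a f z = \<zero>\<^bsub>tensor R E (FR_div R p \<Delta> e)\<^esub>)"
    if loc: "local_ring R \<mm>" and E: "injective_hull R (quot_module R \<mm>) E"
  proof -
    have Em: "module R E" using E by (simp add: injective_hull_def injective_module_def)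
    have "(\<forall>\<phi>\<in>Hom_mod R (FR_div R p \<Delta> e) (self_module R). \<phi> (?x a f) \<in> I) \<longleftrightarrow>
        (\<forall>z\<in>Ann_in E I. tensor_composite R p \<Delta> E e a f z = \<zero>\<^bsub>tensor R E (FR_div R p \<Delta> e)\<^esub>)"
      if e: "e > 0" and a: "a \<in> \<aa> (p ^ e - 1)" and f: "f \<in> I" for e a f
    proof -
      have "tensor_composite R p \<Delta> E e a f z = pure_tensor R E (FR_div R p \<Delta> e) z (?x a f)"
        if "z \<in> Ann_in E I" for z
        using that by (intro tensor_composite_eq R(1) Em FRD e aR[OF a] I.Icarr[OF f]
            module_Frob_push[OF p module_self_module[OF R(1)]]) (simp add: Ann_in_def)
      then show ?thesis
        using functionals_into_ideal_iff[OF R loc E assms(7) FRD(1,2)[OF e] x[OF e aR[OF a] f]] by simp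
    qed
    then show ?thesis unfolding compat by (simp cong: ball_cong)
  qed
  show ?thesis using part1 part2 by blast
qed

end
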